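(* The sesquilinear form $a_H^{\phi,\psi}$, initially defined on $C_c^\infty(\Omega)\times C_c^\infty(\Omega)$, extends continuously to a sesquilinear form (still denoted $a_H^{\phi,\psi}$) on $V^0_{\phi,\psi}\times V^0_{\phi,\psi}$, and there is a constant $M>0$ such that $$|a_H^{\phi,\psi}(u,v)|\le M\,\|u\|_{V_{\phi,\psi}}\|v\|_{V_{\phi,\psi}}\qquad\text{for all } u,v\in V^0_{\phi,\psi}.$$
   Context: Fix real constants $a>0$, $\kappa>0$, $m>0$, $\sigma>0$, $r\ge 0$, $\rho\in[-1,1]$, $\omega>0$, $\nu>0$, $\mu>0$, and assume the Feller condition $\kappa m>\sigma^2/2$. Let $\Omega=\mathbb{R}\times[a,\infty)$ with points $(x,y)$. $C_c^\infty(\Omega)$ denotes the complex-valued smooth functions with compact support in the interior $\mathbb{R}\times(a,\infty)$ (Dirichlet boundary conditions). Weights: $\phi(x)=e^{\nu|x|}$, $\psi(y)=e^{\frac{\mu}{2}y^2}$. $L^2_{\phi,\psi}(\Omega)$ is the space of measurable $v:\Omega\to\mathbb{C}$ with $v\phi\psi\in L^2(\Omega)$, with norm $\|v\|_{\phi,\psi}=\left(\int_\Omega|v(x,y)|^2\phi^2(x)\psi^2(y)\,dx\,dy\right)^{1/2}$. $V_{\phi,\psi}$ is the space of $v$ such that $v,\ \sqrt{y}\,\partial v/\partial x,\ \sqrt{y}\,\partial v/\partial y$ (weak derivatives) all belong to $L^2_{\phi,\psi}(\Omega)$, with norm $$\|v\|_{V_{\phi,\psi}}=\left(\|v\|_{\phi,\psi}^2+\|\sqrt{y}\,\partial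 v/\partial x\|_{\phi,\psi}^2+\|\sqrt{y}\,\partial v/\partial y\|_{\phi,\psi}^2\right)^{1/2}.$$ $V^0_{\phi,\psi}$ is the closure of $C_c^\infty(\Omega)$ in $V_{\phi,\psi}$. The operator $\mathcal{L}^H$ is $$\mathcal{L}^H\varphi=-\tfrac12 y\,\varphi_{xx}-\tfrac12\sigma^2y\,\varphi_{yy}-\rho\sigma y\,\varphi_{xy}-\left(\omega\rho\sigma y^2-\tfrac12y+r\right)\varphi_x-\left[\omega\sigma^2y^2+\kappa(m-y)\right]\varphi_y-\left[\tfrac12\omega\sigma^2y(\omega y^2+1)+\omega y\kappa(m-y)-r\right]\varphi,$$ and for $u,v\in C_c^\infty(\Omega)$ $$a_H^{\phi,\psi}(u,v)=\int_\Omega(\mathcal{L}^Hu)(x,y)\,\overline{v}(x,y)\,\phi^2(x)\psi^2(y)\,dx\,dy.$$ *)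

theory Defs
  imports "HOL-Analysis.Analysis"
begin

definition half_plane :: "real \<Rightarrow> (real \<times> real) set" where
  "half_plane a = UNIV \<times> {a..}"

definition half_plane_interior :: "real \<Rightarrow> (real \<times> real) set" where
  "half_plane_interior a = UNIV \<times> {a<..}"


definition dir_deriv ::
    "real \<times> real \<Rightarrow> (real \<times> real \<Rightarrow> complex) \<Rightarrow> real \<times> real \<Rightarrow> complex" where
  "dir_deriv e u p = frechet_derivative u (at p) e"

abbreviation "Dx \<equiv> dir_deriv (1, 0)"
abbreviation "Dy \<equiv> dir_deriv (0, 1)"

primrec C_diff :: "nat \<Rightarrow> (real \<times> real \<Rightarrow> complex) \<Rightarrow> bool" where
  "C_diff 0 u \<longleftrightarrow> continuous_on UNIV u"
| "C_diff (Suc k) u \<longleftrightarrow>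
     (\<forall>p. u differentiable (at p)) \<and> C_diff k (Dx u) \<and> C_diff k (Dy u)"

definition smooth :: "(real \<times> real \<Rightarrow> complex) \<Rightarrow> bool" where
  "smooth u \<longleftrightarrow> (\<forall>k. C_diff k u)"

(* A smooth function on R x [a,oo) with compact support in the open half plane is identified
   with its extension by zero, which is smooth on the whole plane. *)
definition test_functions :: "real \<Rightarrow> (real \<times> real \<Rightarrow> complex) set" where
  "test_functions a =
     {u. smooth u \<and> compact (closure {p. u p \<noteq> 0})
         \<and> closure {p. u p \<noteq> 0} \<subseteq> half_plane_interior a}"


definition weight_x :: "real \<Rightarrow> real \<Rightarrow> real" where
  "weight_x \<nu> x = exp (\<nu> * \<bar>x\<bar>)"

definition weight_y :: "real \<Rightarrow> real \<Rightarrow> real" where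
  "weight_y \<mu> y = exp (\<mu> / 2 * y\<^sup>2)"

(* Elements of the function spaces below are represented by functions on the whole plane of which
   only the values on R x [a,oo) matter; two functions that agree almost everywhere there
   represent the same element. *)
definition L2_weighted :: "real \<Rightarrow> real \<Rightarrow> real \<Rightarrow> (real \<times> real \<Rightarrow> complex) set" where
  "L2_weighted a \<nu> \<mu> =
     {v. v \<in> borel_measurable (lebesgue_on (half_plane a)) \<and>
         integrable (lebesgue_on (half_plane a))
           (\<lambda>(x, y). (cmod (v (x, y)))\<^sup>2 * (weight_x \<nu> x)\<^sup>2 * (weight_y \<mu> y)\<^sup>2)}"

definition L2_norm_weighted ::
    "real \<Rightarrow> real \<Rightarrow> real \<Rightarrow> (real \<times> real \<Rightarrow> complex) \<Rightarrow> real" where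
  "L2_norm_weighted a \<nu> \<mu> v =
     sqrt (\<integral>(x, y). (cmod (v (x, y)))\<^sup>2 * (weight_x \<nu> x)\<^sup>2 * (weight_y \<mu> y)\<^sup>2
             \<partial>lebesgue_on (half_plane a))"


definition locally_integrable :: "real \<Rightarrow> (real \<times> real \<Rightarrow> complex) \<Rightarrow> bool" where
  "locally_integrable a v \<longleftrightarrow>
     (\<forall>K. compact K \<and> K \<subseteq> half_plane_interior a \<longrightarrow> v absolutely_integrable_on K)"

definition has_weak_deriv ::
    "real \<Rightarrow> real \<times> real \<Rightarrow> (real \<times> real \<Rightarrow> complex) \<Rightarrow> (real \<times> real \<Rightarrow> complex) \<Rightarrow> bool" where
  "has_weak_deriv a e v w \<longleftrightarrow>
     locally_integrable a v \<and> locally_integrable a w \<and>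
     (\<forall>\<eta> \<in> test_functions a.
        (\<integral>p. v p * dir_deriv e \<eta> p \<partial>lebesgue_on (half_plane a)) =
        - (\<integral>p. w p * \<eta> p \<partial>lebesgue_on (half_plane a)))"

(* Weak derivatives are unique only up to null sets, so this picks a representative. *)
definition weak_deriv ::
    "real \<Rightarrow> real \<times> real \<Rightarrow> (real \<times> real \<Rightarrow> complex) \<Rightarrow> real \<times> real \<Rightarrow> complex" where
  "weak_deriv a e v = (SOME w. has_weak_deriv a e v w)"

abbreviation "weak_Dx a \<equiv> weak_deriv a (1, 0)"
abbreviation "weak_Dy a \<equiv> weak_deriv a (0, 1)"

definition sqrt_y_times :: "(real \<times> real \<Rightarrow> complex) \<Rightarrow> real \<times> real \<Rightarrow> complex" where
  "sqrt_y_times v = (\<lambda>(x, y). of_real (sqrt y) * v (x, y))"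

definition V_space :: "real \<Rightarrow> real \<Rightarrow> real \<Rightarrow> (real \<times> real \<Rightarrow> complex) set" where
  "V_space a \<nu> \<mu> =
     {v \<in> L2_weighted a \<nu> \<mu>.
        (\<exists>w. has_weak_deriv a (1, 0) v w) \<and> (\<exists>w. has_weak_deriv a (0, 1) v w) \<and>
        sqrt_y_times (weak_Dx a v) \<in> L2_weighted a \<nu> \<mu> \<and>
        sqrt_y_times (weak_Dy a v) \<in> L2_weighted a \<nu> \<mu>}"

definition V_norm :: "real \<Rightarrow> real \<Rightarrow> real \<Rightarrow> (real \<times> real \<Rightarrow> complex) \<Rightarrow> real" where
  "V_norm a \<nu> \<mu> v =
     sqrt ((L2_norm_weighted a \<nu> \<mu> v)\<^sup>2
           + (L2_norm_weighted a \<nu> \<mu> (sqrt_y_times (weak_Dx a v)))\<^sup>2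
           + (L2_norm_weighted a \<nu> \<mu> (sqrt_y_times (weak_Dy a v)))\<^sup>2)"

definition V0_space :: "real \<Rightarrow> real \<Rightarrow> real \<Rightarrow> (real \<times> real \<Rightarrow> complex) set" where
  "V0_space a \<nu> \<mu> =
     {v \<in> V_space a \<nu> \<mu>.
        \<forall>\<epsilon>>0. \<exists>w \<in> test_functions a. V_norm a \<nu> \<mu> (\<lambda>p. v p - w p) < \<epsilon>}"


definition heston_operator ::
    "real \<Rightarrow> real \<Rightarrow> real \<Rightarrow> real \<Rightarrow> real \<Rightarrow> real \<Rightarrow>
     (real \<times> real \<Rightarrow> complex) \<Rightarrow> real \<times> real \<Rightarrow> complex" where
  "heston_operator \<kappa> m \<sigma> r \<rho> \<omega> u = (\<lambda>(x, y).
     - of_real (1/2 * y) * Dx (Dx u) (x, y)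
     - of_real (1/2 * \<sigma>\<^sup>2 * y) * Dy (Dy u) (x, y)
     - of_real (\<rho> * \<sigma> * y) * Dy (Dx u) (x, y)
     - of_real (\<omega> * \<rho> * \<sigma> * y\<^sup>2 - 1/2 * y + r) * Dx u (x, y)
     - of_real (\<omega> * \<sigma>\<^sup>2 * y\<^sup>2 + \<kappa> * (m - y)) * Dy u (x, y)
     - of_real (1/2 * \<omega> * \<sigma>\<^sup>2 * y * (\<omega> * y\<^sup>2 + 1) + \<omega> * y * \<kappa> * (m - y) - r) * u (x, y))"

definition heston_form ::
    "real \<Rightarrow> real \<Rightarrow> real \<Rightarrow> real \<Rightarrow> real \<Rightarrow> real \<Rightarrow> real \<Rightarrow> real \<Rightarrow> real \<Rightarrow>
     (real \<times> real \<Rightarrow> complex) \<Rightarrow> (real \<times> real \<Rightarrow> complex) \<Rightarrow> complex" where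
  "heston_form a \<kappa> m \<sigma> r \<rho> \<omega> \<nu> \<mu> u v =
     (\<integral>(x, y). heston_operator \<kappa> m \<sigma> r \<rho> \<omega> u (x, y) * cnj (v (x, y))
               * of_real ((weight_x \<nu> x)\<^sup>2 * (weight_y \<mu> y)\<^sup>2)
        \<partial>lebesgue_on (half_plane a))"


(* The last clause says that B is well defined on almost-everywhere equivalence classes. *)
definition sesquilinear_form_on ::
    "real \<Rightarrow> (real \<times> real \<Rightarrow> complex) set \<Rightarrow>
     ((real \<times> real \<Rightarrow> complex) \<Rightarrow> (real \<times> real \<Rightarrow> complex) \<Rightarrow> complex) \<Rightarrow> bool" where
  "sesquilinear_form_on a S B \<longleftrightarrow>
     (\<forall>u\<in>S. \<forall>u'\<in>S. \<forall>v\<in>S. B (\<lambda>p. u p + u' p) v = B u v + B u' v) \<and>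
     (\<forall>c. \<forall>u\<in>S. \<forall>v\<in>S. B (\<lambda>p. c * u p) v = c * B u v) \<and>
     (\<forall>u\<in>S. \<forall>v\<in>S. \<forall>v'\<in>S. B u (\<lambda>p. v p + v' p) = B u v + B u v') \<and>
     (\<forall>c. \<forall>u\<in>S. \<forall>v\<in>S. B u (\<lambda>p. c * v p) = cnj c * B u v) \<and>
     (\<forall>u\<in>S. \<forall>u'\<in>S. \<forall>v\<in>S. \<forall>v'\<in>S.
        (AE p in lebesgue_on (half_plane a). u p = u' p) \<and>
        (AE p in lebesgue_on (half_plane a). v p = v' p) \<longrightarrow> B u v = B u' v')"

(* Joint continuity; sequential continuity suffices, the topology being given by a seminorm. *)
definition continuous_form_on_V0 ::
    "real \<Rightarrow> real \<Rightarrow> real \<Rightarrow>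
     ((real \<times> real \<Rightarrow> complex) \<Rightarrow> (real \<times> real \<Rightarrow> complex) \<Rightarrow> complex) \<Rightarrow> bool" where
  "continuous_form_on_V0 a \<nu> \<mu> B \<longleftrightarrow>
     (\<forall>us vs. \<forall>u \<in> V0_space a \<nu> \<mu>. \<forall>v \<in> V0_space a \<nu> \<mu>.
        range us \<subseteq> V0_space a \<nu> \<mu> \<and> range vs \<subseteq> V0_space a \<nu> \<mu> \<and>
        (\<lambda>n. V_norm a \<nu> \<mu> (\<lambda>p. us n p - u p)) \<longlonglongrightarrow> 0 \<and>
        (\<lambda>n. V_norm a \<nu> \<mu> (\<lambda>p. vs n p - v p)) \<longlonglongrightarrow> 0 \<longrightarrow>
        (\<lambda>n. B (us n) (vs n)) \<longlonglongrightarrow> B u v)"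

end

theory Submission
  imports Defs
begin

text \<open>
  Write \<open>W = \<phi>\<^sup>2 \<psi>\<^sup>2\<close>. On test functions one integrates the three second-order terms of the
  operator by parts, twice in \<open>y\<close> and once in \<open>x\<close>. Since \<open>W\<^sub>x = 2 \<nu> sgn(x) W\<close> and \<open>W\<^sub>y = 2 \<mu> y W\<close>, the form
  becomes the integral over the half plane of
  \<open>(y/2) u\<^sub>x v\<^sub>x + (\<sigma>\<^sup>2 y/2) u\<^sub>y v\<^sub>y + \<rho> \<sigma> y u\<^sub>x v\<^sub>y + p u\<^sub>x v + q u\<^sub>y v + s u v\<close>
  against \<open>W\<close> (with \<open>v\<close> conjugated), where \<open>p\<close> and \<open>q\<close> grow like \<open>y\<^sup>2\<close> and \<open>s\<close> grows like \<open>y\<^sup>3\<close>.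

  The norm of the space controls \<open>u\<close>, \<open>y\<^sup>1\<^sup>/\<^sup>2 u\<^sub>x\<close> and \<open>y\<^sup>1\<^sup>/\<^sup>2 u\<^sub>y\<close> in the weighted \<open>L\<^sup>2\<close> space, so the growth of
  the lower-order coefficients has to be absorbed by something else: the Gaussian weight \<open>\<psi>\<close>.
  Integrating \<open>\<partial>\<^sub>y(y\<^sup>2 \<bar>v\<bar>\<^sup>2 W)\<close> gives the Hardy-type inequality
  \<open>\<mu> \<parallel>y\<^sup>3\<^sup>/\<^sup>2 v\<parallel> \<le> \<parallel>y\<^sup>1\<^sup>/\<^sup>2 v\<^sub>y\<parallel>\<close> (\<open>test_function_Hardy\<close>), which survives the passage to the closure
  of the test functions (\<open>V0_space_Hardy\<close>). Hence each of the six terms has the form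
  \<open>\<integral> b (S u) (T v)\<close> with \<open>S, T\<close> among \<open>u \<mapsto> y\<^sup>1\<^sup>/\<^sup>2 u\<^sub>x, y\<^sup>1\<^sup>/\<^sup>2 u\<^sub>y, y\<^sup>3\<^sup>/\<^sup>2 u\<close>, all bounded into the weighted \<open>L\<^sup>2\<close>,
  and with \<open>b\<close> one of \<open>1/2, \<sigma>\<^sup>2/2, \<rho> \<sigma>, p/y\<^sup>2, q/y\<^sup>2, s/y\<^sup>3\<close>, all bounded because \<open>y \<ge> a > 0\<close>.
  The Cauchy-Schwarz inequality bounds each term, and the sum is the required extension
  (\<open>heston_extension\<close>); it is given by an explicit integral, so no limit over approximating
  sequences has to be taken. Joint continuity follows from boundedness and sesquilinearity.

  The weak derivative is a chosen representative. For the form to be additive, and for the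
  norm to satisfy the triangle inequality, weak derivatives must be unique up to null sets, and for
  the form to be the given one on test functions they must agree there with classical derivatives.
  The first fact is the du Bois-Reymond lemma (\<open>AE_zero_if_orthogonal_to_test_functions\<close>), which needs
  smooth bump functions; the second is the case \<open>\<nu> = \<mu> = 0\<close> of the integration by parts.
\<close>

section \<open>Square-integrable complex functions\<close>

definition square_integrable :: "'a measure \<Rightarrow> ('a \<Rightarrow> complex) \<Rightarrow> bool" where
  "square_integrable M f \<longleftrightarrow> f \<in> borel_measurable M \<and> integrable M (\<lambda>x. (cmod (f x))\<^sup>2)"

definition L2_seminorm :: "'a measure \<Rightarrow> ('a \<Rightarrow> complex) \<Rightarrow> real" where
  "L2_seminorm M f = sqrt (\<integral>x. (cmod (f x))\<^sup>2 \<partial>M)"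

lemma L2_seminorm_nonneg [simp]: "L2_seminorm M f \<ge> 0"
  by (simp add: L2_seminorm_def)

lemma L2_seminorm_power2: "(L2_seminorm M f)\<^sup>2 = (\<integral>x. (cmod (f x))\<^sup>2 \<partial>M)"
  by (simp add: L2_seminorm_def)

lemma square_integrable_bound:
  assumes "square_integrable M f" "g \<in> borel_measurable M"
    and le: "AE x in M. cmod (g x) \<le> C * cmod (f x)"
  shows "square_integrable M g"
proof -
  have "integrable M (\<lambda>x. (cmod (g x))\<^sup>2)"
  proof (rule Bochner_Integration.integrable_bound)
    show "integrable M (\<lambda>x. C\<^sup>2 * (cmod (f x))\<^sup>2)"
      using assms(1) by (simp add: square_integrable_def)
    show "(\<lambda>x. (cmod (g x))\<^sup>2) \<in> borel_measurable M"
      using assms(2) by measurable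
    show "AE x in M. norm ((cmod (g x))\<^sup>2) \<le> norm (C\<^sup>2 * (cmod (f x))\<^sup>2)"
      using le
    proof eventually_elim
      case (elim x)
      then have "(cmod (g x))\<^sup>2 \<le> (C * cmod (f x))\<^sup>2"
        by (intro power_mono) auto
      then show ?case by (simp add: power_mult_distrib)
    qed
  qed
  then show ?thesis using assms by (simp add: square_integrable_def)
qed

lemma L2_seminorm_bound:
  assumes "square_integrable M f" "g \<in> borel_measurable M" "C \<ge> 0"
    and le: "AE x in M. cmod (g x) \<le> C * cmod (f x)"
  shows "L2_seminorm M g \<le> C * L2_seminorm M f"
proof -
  have "(\<integral>x. (cmod (g x))\<^sup>2 \<partial>M) \<le> (\<integral>x. C\<^sup>2 * (cmod (f x))\<^sup>2 \<partial>M)"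
  proof (rule integral_mono_AE)
    show "integrable M (\<lambda>x. (cmod (g x))\<^sup>2)"
      using square_integrable_bound[OF assms(1,2,4)] by (simp add: square_integrable_def)
    show "integrable M (\<lambda>x. C\<^sup>2 * (cmod (f x))\<^sup>2)"
      using assms(1) by (simp add: square_integrable_def)
    show "AE x in M. (cmod (g x))\<^sup>2 \<le> C\<^sup>2 * (cmod (f x))\<^sup>2"
      using le
    proof eventually_elim
      case (elim x)
      then have "(cmod (g x))\<^sup>2 \<le> (C * cmod (f x))\<^sup>2"
        by (intro power_mono) auto
      then show ?case by (simp add: power_mult_distrib)
    qed
  qed
  then have "L2_seminorm M g \<le> sqrt (C\<^sup>2 * (\<integral>x. (cmod (f x))\<^sup>2 \<partial>M))"
    unfolding L2_seminorm_def by simp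
  also have "\<dots> = C * L2_seminorm M f"
    using assms(3) by (simp add: real_sqrt_mult L2_seminorm_def)
  finally show ?thesis .
qed

lemma L2_seminorm_cong_AE:
  assumes "f \<in> borel_measurable M" "g \<in> borel_measurable M" "AE x in M. f x = g x"
  shows "L2_seminorm M f = L2_seminorm M g"
proof -
  have "(\<integral>x. (cmod (f x))\<^sup>2 \<partial>M) = (\<integral>x. (cmod (g x))\<^sup>2 \<partial>M)"
    by (rule integral_cong_AE) (use assms in \<open>auto elim!: eventually_mono\<close>)
  then show ?thesis by (simp add: L2_seminorm_def)
qed

lemma integrable_mult_square_integrable:
  assumes "square_integrable M f" "square_integrable M g"
  shows "integrable M (\<lambda>x. f x * g x)"
proof (rule Bochner_Integration.integrable_bound)
  show "integrable M (\<lambda>x. (cmod (f x))\<^sup>2 + (cmod (g x))\<^sup>2)"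
    using assms by (simp add: square_integrable_def)
  show "(\<lambda>x. f x * g x) \<in> borel_measurable M"
    using assms by (auto simp: square_integrable_def)
  show "AE x in M. norm (f x * g x) \<le> norm ((cmod (f x))\<^sup>2 + (cmod (g x))\<^sup>2)"
  proof (rule AE_I2)
    fix x
    have "2 * (cmod (f x) * cmod (g x)) \<le> (cmod (f x))\<^sup>2 + (cmod (g x))\<^sup>2"
      using sum_squares_bound[of "cmod (f x)" "cmod (g x)"] by simp
    then have "cmod (f x) * cmod (g x) \<le> (cmod (f x))\<^sup>2 + (cmod (g x))\<^sup>2"
      using mult_nonneg_nonneg[OF norm_ge_zero[of "f x"] norm_ge_zero[of "g x"]] by linarith
    then show "norm (f x * g x) \<le> norm ((cmod (f x))\<^sup>2 + (cmod (g x))\<^sup>2)"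
      by (simp add: norm_mult)
  qed
qed

lemma integrable_cmod_mult:
  assumes "square_integrable M f" "square_integrable M g"
  shows "integrable M (\<lambda>x. cmod (f x) * cmod (g x))"
  using integrable_norm[OF integrable_mult_square_integrable[OF assms]] by (simp add: norm_mult)

text \<open>Integrate the square of \<open>A \<bar>g\<bar> - C \<bar>f\<bar>\<close>, where \<open>A = \<parallel>f\<parallel>\<^sup>2\<close> and \<open>C\<close> is the integral of
  \<open>\<bar>f\<bar> \<bar>g\<bar>\<close>; the result is \<open>A (A \<parallel>g\<parallel>\<^sup>2 - C\<^sup>2)\<close>.\<close>
lemma L2_Cauchy_Schwarz_cmod:
  assumes f: "square_integrable M f" and g: "square_integrable M g"
  shows "(\<integral>x. cmod (f x) * cmod (g x) \<partial>M) \<le> L2_seminorm M f * L2_seminorm M g"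
proof -
  define A B C where "A = (\<integral>x. (cmod (f x))\<^sup>2 \<partial>M)" and "B = (\<integral>x. (cmod (g x))\<^sup>2 \<partial>M)"
    and "C = (\<integral>x. cmod (f x) * cmod (g x) \<partial>M)"
  note int = f[unfolded square_integrable_def] g[unfolded square_integrable_def]
    integrable_cmod_mult[OF f g]
  have "C\<^sup>2 \<le> A * B"
  proof (cases "A = 0")
    case True
    then have "AE x in M. (cmod (f x))\<^sup>2 = 0"
      using int integral_nonneg_eq_0_iff_AE[of M "\<lambda>x. (cmod (f x))\<^sup>2"] by (simp add: A_def)
    then have "AE x in M. cmod (f x) * cmod (g x) = 0"
      by eventually_elim simp
    then have "C = 0" unfolding C_def by (rule integral_eq_zero_AE)
    then show ?thesis by (simp add: True)
  next
    case False
    then have A: "A > 0" by (simp add: A_def order_less_le)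
    have "0 \<le> (\<integral>x. (A * cmod (g x) - C * cmod (f x))\<^sup>2 \<partial>M)" by simp
    also have "\<dots> = (\<integral>x. A\<^sup>2 * (cmod (g x))\<^sup>2 - 2 * A * C * (cmod (f x) * cmod (g x))
                       + C\<^sup>2 * (cmod (f x))\<^sup>2 \<partial>M)"
      by (simp add: power2_diff power_mult_distrib algebra_simps)
    also have "\<dots> = A\<^sup>2 * B - 2 * A * C * C + C\<^sup>2 * A"
      using int by (simp add: A_def B_def C_def)
    also have "\<dots> = A * (A * B - C\<^sup>2)" by (simp add: power2_eq_square algebra_simps)
    finally show ?thesis using A by (simp add: zero_le_mult_iff)
  qed
  then have "C \<le> sqrt (A * B)" by (rule real_le_rsqrt)
  then show ?thesis by (simp add: real_sqrt_mult A_def B_def C_def L2_seminorm_def)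
qed

lemma L2_Cauchy_Schwarz:
  assumes f: "square_integrable M f" and g: "square_integrable M g"
  shows "cmod (\<integral>x. f x * g x \<partial>M) \<le> L2_seminorm M f * L2_seminorm M g"
proof -
  have "cmod (\<integral>x. f x * g x \<partial>M) \<le> (\<integral>x. cmod (f x * g x) \<partial>M)"
    by (rule integral_norm_bound)
  then show ?thesis using L2_Cauchy_Schwarz_cmod[OF assms] by (simp add: norm_mult)
qed

lemma square_integrable_add:
  assumes f: "square_integrable M f" and g: "square_integrable M g"
  shows "square_integrable M (\<lambda>x. f x + g x)"
proof -
  have "integrable M (\<lambda>x. (cmod (f x + g x))\<^sup>2)"
  proof (rule Bochner_Integration.integrable_bound)
    show "integrable M (\<lambda>x. (cmod (f x))\<^sup>2 + 2 * (cmod (f x) * cmod (g x)) + (cmod (g x))\<^sup>2)"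
      using f g integrable_cmod_mult[OF f g] by (simp add: square_integrable_def)
    show "AE x in M. norm ((cmod (f x + g x))\<^sup>2)
            \<le> norm ((cmod (f x))\<^sup>2 + 2 * (cmod (f x) * cmod (g x)) + (cmod (g x))\<^sup>2)"
    proof (rule AE_I2)
      fix x
      have "(cmod (f x + g x))\<^sup>2 \<le> (cmod (f x) + cmod (g x))\<^sup>2"
        by (intro power_mono norm_triangle_ineq) auto
      then show "norm ((cmod (f x + g x))\<^sup>2)
            \<le> norm ((cmod (f x))\<^sup>2 + 2 * (cmod (f x) * cmod (g x)) + (cmod (g x))\<^sup>2)"
        by (simp add: power2_sum)
    qed
  qed (use f g in \<open>auto simp: square_integrable_def\<close>)
  then show ?thesis using f g by (auto simp: square_integrable_def)
qed

lemma L2_seminorm_triangle: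
  assumes f: "square_integrable M f" and g: "square_integrable M g"
  shows "L2_seminorm M (\<lambda>x. f x + g x) \<le> L2_seminorm M f + L2_seminorm M g"
proof -
  note int = f[unfolded square_integrable_def] g[unfolded square_integrable_def]
    integrable_cmod_mult[OF f g]
  have "(\<integral>x. (cmod (f x + g x))\<^sup>2 \<partial>M)
      \<le> (\<integral>x. (cmod (f x))\<^sup>2 + 2 * (cmod (f x) * cmod (g x)) + (cmod (g x))\<^sup>2 \<partial>M)"
  proof (rule integral_mono)
    show "integrable M (\<lambda>x. (cmod (f x + g x))\<^sup>2)"
      using square_integrable_add[OF f g] by (simp add: square_integrable_def)
    show "integrable M (\<lambda>x. (cmod (f x))\<^sup>2 + 2 * (cmod (f x) * cmod (g x)) + (cmod (g x))\<^sup>2)"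
      using int by simp
    fix x
    have "(cmod (f x + g x))\<^sup>2 \<le> (cmod (f x) + cmod (g x))\<^sup>2"
      by (intro power_mono norm_triangle_ineq) auto
    then show "(cmod (f x + g x))\<^sup>2
            \<le> (cmod (f x))\<^sup>2 + 2 * (cmod (f x) * cmod (g x)) + (cmod (g x))\<^sup>2"
      by (simp add: power2_sum)
  qed
  also have "\<dots> = (L2_seminorm M f)\<^sup>2 + 2 * (\<integral>x. cmod (f x) * cmod (g x) \<partial>M) + (L2_seminorm M g)\<^sup>2"
    using int by (simp add: L2_seminorm_power2)
  also have "\<dots> \<le> (L2_seminorm M f + L2_seminorm M g)\<^sup>2"
    using L2_Cauchy_Schwarz_cmod[OF f g] by (simp add: power2_sum)
  finally show ?thesis
    unfolding L2_seminorm_def[of M "\<lambda>x. f x + g x"] by (rule real_le_lsqrt[rotated]) simp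
qed

lemma square_integrable_scale:
  "square_integrable M f \<Longrightarrow> square_integrable M (\<lambda>x. c * f x)"
  by (rule square_integrable_bound[where C = "cmod c"])
     (auto simp: norm_mult square_integrable_def)

lemma L2_seminorm_scale: "L2_seminorm M (\<lambda>x. c * f x) = cmod c * L2_seminorm M f"
  by (simp add: L2_seminorm_def norm_mult power_mult_distrib real_sqrt_mult)

text \<open>Beppo Levi for \<open>L\<^sup>2\<close>: a uniform bound on truncations passes to the function itself. It is used to
  remove the cut-off in \<open>y\<close> from the Hardy inequality.\<close>
lemma square_integrable_monotone_limit:
  assumes int: "\<And>n. square_integrable M (f n)" and g: "g \<in> borel_measurable M"
    and mono: "\<And>x m n. x \<in> space M \<Longrightarrow> m \<le> n \<Longrightarrow> cmod (f m x) \<le> cmod (f n x)"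
    and lim: "\<And>x. x \<in> space M \<Longrightarrow> (\<lambda>n. f n x) \<longlonglongrightarrow> g x"
    and bound: "\<And>n. L2_seminorm M (f n) \<le> D"
  shows "square_integrable M g" "L2_seminorm M g \<le> D"
proof -
  let ?I = "\<lambda>n. \<integral>x. (cmod (f n x))\<^sup>2 \<partial>M"
  note i = int[unfolded square_integrable_def, THEN conjunct2]
  have bd: "?I n \<le> D\<^sup>2" for n
    unfolding L2_seminorm_power2[symmetric] by (intro power_mono bound) simp
  have "incseq ?I"
    by (intro incseq_SucI integral_mono i power_mono mono) simp_all
  then obtain l where l: "?I \<longlonglongrightarrow> l"
    using incseq_convergent[of ?I "D\<^sup>2"] bd by metis
  have cv: "integrable M (\<lambda>x. (cmod (g x))\<^sup>2)" "(\<integral>x. (cmod (g x))\<^sup>2 \<partial>M) = l"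
  proof -
    have 1: "AE x in M. mono (\<lambda>n. (cmod (f n x))\<^sup>2)"
      by (intro AE_I2 monoI power_mono mono) simp_all
    have 2: "AE x in M. (\<lambda>n. (cmod (f n x))\<^sup>2) \<longlonglongrightarrow> (cmod (g x))\<^sup>2"
      by (intro AE_I2 tendsto_intros lim)
    have 3: "AE x in M. 0 \<le> (cmod (f n x))\<^sup>2" for n by simp
    have 4: "(\<lambda>x. (cmod (g x))\<^sup>2) \<in> borel_measurable M" using g by simp
    note mc = integral_monotone_convergence_nonneg[OF i 1 3 2 l(1) 4]
    show "integrable M (\<lambda>x. (cmod (g x))\<^sup>2)" "(\<integral>x. (cmod (g x))\<^sup>2 \<partial>M) = l"
      by (fact mc)+
  qed
  then show "square_integrable M g" using g by (simp add: square_integrable_def)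
  have "l \<le> D\<^sup>2" using LIMSEQ_le_const2[OF l(1)] bd by blast
  then have "L2_seminorm M g \<le> sqrt (D\<^sup>2)"
    unfolding L2_seminorm_def cv(2) by (rule real_sqrt_le_mono)
  moreover have "D \<ge> 0" using bound[of 0] L2_seminorm_nonneg[of M "f 0"] by linarith
  ultimately show "L2_seminorm M g \<le> D" by simp
qed

section \<open>Calculus of smooth functions and test functions\<close>

text \<open>Points of the plane are treated as single variables throughout, so quantifiers over them should
  not be split into coordinates.\<close>

declare split_paired_All [simp del] split_paired_Ex [simp del]

lemma dir_deriv_eqI: "(u has_derivative D) (at p) \<Longrightarrow> dir_deriv e u p = D e"
  unfolding dir_deriv_def using frechet_derivative_at by metis

lemma has_derivative_frechet:
  "u differentiable (at p) \<Longrightarrow> (u has_derivative (\<lambda>e. dir_deriv e u p)) (at p)"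
  unfolding dir_deriv_def using frechet_derivative_works by (metis (full_types) eta_contract_eq)

lemma dir_deriv_const [simp]: "dir_deriv e (\<lambda>p. c) = (\<lambda>p. 0)"
  by (auto simp: dir_deriv_def)

lemma dir_deriv_add:
  assumes "\<And>p. u differentiable (at p)" "\<And>p. v differentiable (at p)"
  shows "dir_deriv e (\<lambda>p. u p + v p) = (\<lambda>p. dir_deriv e u p + dir_deriv e v p)"
  by (rule ext, rule dir_deriv_eqI)
     (intro has_derivative_add has_derivative_frechet assms)

lemma dir_deriv_mult:
  assumes "\<And>p. u differentiable (at p)" "\<And>p. v differentiable (at p)"
  shows "dir_deriv e (\<lambda>p. u p * v p) = (\<lambda>p. u p * dir_deriv e v p + dir_deriv e u p * v p)"
  by (rule ext, rule dir_deriv_eqI)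
     (intro has_derivative_mult has_derivative_frechet assms)

lemma dir_deriv_cnj:
  assumes "\<And>p. u differentiable (at p)"
  shows "dir_deriv e (\<lambda>p. cnj (u p)) = (\<lambda>p. cnj (dir_deriv e u p))"
  by (rule ext, rule dir_deriv_eqI)
     (intro bounded_linear.has_derivative[OF bounded_linear_cnj] has_derivative_frechet assms)

lemma C_diff_continuous: "C_diff k u \<Longrightarrow> continuous_on UNIV u"
  by (cases k) (auto intro!: differentiable_imp_continuous_on simp: differentiable_on_def
      intro: differentiable_at_withinI)

lemma C_diff_SucD: "C_diff (Suc k) u \<Longrightarrow> C_diff k u"
proof (induction k arbitrary: u)
  case 0
  then show ?case using C_diff_continuous by fastforce
next
  case (Suc k)
  then show ?case using C_diff.simps(2) by metis
qed

lemma C_diff_differentiable: "C_diff (Suc k) u \<Longrightarrow> u differentiable (at p)"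
  by simp

lemma C_diff_const: "C_diff k (\<lambda>p. c)"
  by (induction k arbitrary: c) auto

lemma C_diff_add: "C_diff k u \<Longrightarrow> C_diff k v \<Longrightarrow> C_diff k (\<lambda>p. u p + v p)"
proof (induction k arbitrary: u v)
  case 0
  then show ?case by (auto intro: continuous_intros)
next
  case (Suc k)
  then show ?case by (auto simp: dir_deriv_add)
qed

lemma C_diff_mult: "C_diff k u \<Longrightarrow> C_diff k v \<Longrightarrow> C_diff k (\<lambda>p. u p * v p)"
proof (induction k arbitrary: u v)
  case 0
  then show ?case by (auto intro: continuous_intros)
next
  case (Suc k)
  have "C_diff k u" "C_diff k v"
    using Suc.prems by (simp_all only: C_diff_SucD)
  with Suc show ?case by (auto simp: dir_deriv_mult intro!: C_diff_add)
qed

lemma C_diff_cnj: "C_diff k u \<Longrightarrow> C_diff k (\<lambda>p. cnj (u p))"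
proof (induction k arbitrary: u)
  case 0
  then show ?case by (auto intro: continuous_intros)
next
  case (Suc k)
  have "(\<lambda>p. cnj (u p)) differentiable (at p)" for p
    using bounded_linear.has_derivative[OF bounded_linear_cnj
        has_derivative_frechet[OF C_diff_differentiable[OF Suc.prems]]]
    by (rule differentiableI)
  then show ?case using Suc by (auto simp: dir_deriv_cnj)
qed

lemma smooth_continuous: "smooth u \<Longrightarrow> continuous_on UNIV u"
  using C_diff_continuous by (auto simp: smooth_def)

lemma smooth_differentiable: "smooth u \<Longrightarrow> u differentiable (at p)"
  using C_diff_differentiable[of 0] unfolding smooth_def by blast

lemma smooth_Dx: "smooth u \<Longrightarrow> smooth (Dx u)"
  by (meson C_diff.simps(2) smooth_def)

lemma smooth_Dy: "smooth u \<Longrightarrow> smooth (Dy u)"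
  by (meson C_diff.simps(2) smooth_def)

lemma smooth_add: "smooth u \<Longrightarrow> smooth v \<Longrightarrow> smooth (\<lambda>p. u p + v p)"
  by (simp add: smooth_def C_diff_add)

lemma smooth_mult: "smooth u \<Longrightarrow> smooth v \<Longrightarrow> smooth (\<lambda>p. u p * v p)"
  by (simp add: smooth_def C_diff_mult)

lemma smooth_cnj: "smooth u \<Longrightarrow> smooth (\<lambda>p. cnj (u p))"
  by (simp add: smooth_def C_diff_cnj)

lemma smooth_const: "smooth (\<lambda>p. c)"
  by (simp add: smooth_def C_diff_const)

lemma test_function_smooth: "u \<in> test_functions a \<Longrightarrow> smooth u"
  by (simp add: test_functions_def)

lemma test_functionI:
  assumes "smooth w" "compact K" "K \<subseteq> half_plane_interior a" "\<And>p. p \<notin> K \<Longrightarrow> w p = 0"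
  shows "w \<in> test_functions a"
proof -
  have sub: "closure {p. w p \<noteq> 0} \<subseteq> K"
    using assms(2,4) by (intro closure_minimal) (auto intro: compact_imp_closed)
  moreover have "compact (closure {p. w p \<noteq> 0})"
    using compact_Int_closed[OF assms(2) closed_closure, of "{p. w p \<noteq> 0}"] sub
    by (simp add: Int_absorb1)
  ultimately show ?thesis using assms(1,3) by (auto simp: test_functions_def)
qed

text \<open>The complement of the support is open and the function vanishes on it, so its derivative is \<open>0\<close>
  there. Thus derivatives of test functions have their supports in the same compact set.\<close>
lemma dir_deriv_outside_support:
  assumes "p \<notin> closure {p. u p \<noteq> 0}"
  shows "dir_deriv e u p = 0"
proof -
  let ?K = "closure {p. u p \<noteq> 0}"
  have "(u has_derivative (\<lambda>e. 0)) (at p)"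
  proof (rule has_derivative_transform_within_open[OF has_derivative_const, of "- ?K" p 0])
    show "0 = u q" if "q \<in> - ?K" for q
      using that subsetD[OF closure_subset, of q "{p. u p \<noteq> 0}"] by (metis (mono_tags) ComplD mem_Collect_eq)
  qed (use assms in \<open>simp_all add: open_Compl\<close>)
  then show ?thesis by (rule dir_deriv_eqI)
qed

lemma test_functionE:
  assumes "u \<in> test_functions a"
  obtains K where "compact K" "K \<subseteq> half_plane_interior a" "\<And>p. p \<notin> K \<Longrightarrow> u p = 0"
    "\<And>e p. p \<notin> K \<Longrightarrow> dir_deriv e u p = 0"
proof -
  let ?K = "closure {p. u p \<noteq> 0}"
  have 1: "u p = 0" if "p \<notin> ?K" for p
    using that subsetD[OF closure_subset, of p "{p. u p \<noteq> 0}"] by (metis (mono_tags) mem_Collect_eq)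
  have 2: "compact ?K" "?K \<subseteq> half_plane_interior a"
    using assms unfolding test_functions_def by simp_all
  show thesis
    by (rule that[OF 2]) (fact 1, fact dir_deriv_outside_support)
qed

lemma test_function_add:
  assumes "u \<in> test_functions a" "v \<in> test_functions a"
  shows "(\<lambda>p. u p + v p) \<in> test_functions a"
proof -
  obtain K where "compact K" "K \<subseteq> half_plane_interior a" "\<And>p. p \<notin> K \<Longrightarrow> u p = 0"
    by (rule test_functionE[OF assms(1)]) (rule that)
  moreover obtain L where "compact L" "L \<subseteq> half_plane_interior a" "\<And>p. p \<notin> L \<Longrightarrow> v p = 0"
    by (rule test_functionE[OF assms(2)]) (rule that)
  ultimately show ?thesis
    using assms by (intro test_functionI[of _ "K \<union> L"]) (auto intro: smooth_add test_function_smooth)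
qed

text \<open>All closure properties of the test functions reduce to smoothness: it is enough that the new
  function vanishes wherever the old one and its derivatives do.\<close>
lemma test_function_subsupport:
  assumes "u \<in> test_functions a" "smooth w"
    and "\<And>p. u p = 0 \<Longrightarrow> (\<And>e. dir_deriv e u p = 0) \<Longrightarrow> w p = 0"
  shows "w \<in> test_functions a"
proof -
  obtain K where K: "compact K" "K \<subseteq> half_plane_interior a" "\<And>p. p \<notin> K \<Longrightarrow> u p = 0"
    "\<And>e p. p \<notin> K \<Longrightarrow> dir_deriv e u p = 0"
    by (rule test_functionE[OF assms(1)]) (rule that)
  show ?thesis
    by (rule test_functionI[OF assms(2) K(1,2)]) (rule assms(3); fact K(3,4))
qed

lemma test_function_mult_smooth:
  assumes "u \<in> test_functions a" "smooth v"
  shows "(\<lambda>p. v p * u p) \<in> test_functions a"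
  by (rule test_function_subsupport[OF assms(1)])
     (simp_all add: smooth_mult test_function_smooth[OF assms(1)] assms(2))

lemma test_function_scale: "u \<in> test_functions a \<Longrightarrow> (\<lambda>p. c * u p) \<in> test_functions a"
  by (rule test_function_mult_smooth[OF _ smooth_const])

lemma test_function_cnj: "u \<in> test_functions a \<Longrightarrow> (\<lambda>p. cnj (u p)) \<in> test_functions a"
  using test_function_subsupport[of u a "\<lambda>p. cnj (u p)"] by (simp add: smooth_cnj test_function_smooth)

lemma test_function_Dx: "u \<in> test_functions a \<Longrightarrow> Dx u \<in> test_functions a"
  using test_function_subsupport[of u a "Dx u"] by (simp add: smooth_Dx test_function_smooth)

lemma test_function_Dy: "u \<in> test_functions a \<Longrightarrow> Dy u \<in> test_functions a"
  using test_function_subsupport[of u a "Dy u"] by (simp add: smooth_Dy test_function_smooth)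

section \<open>Smooth bump functions\<close>

text \<open>The case \<open>j = 0\<close> is the classical smooth function that is flat at the origin. The family in \<open>j\<close>
  is closed under differentiation up to linear combinations, which is what makes the induction for
  smoothness work.\<close>

definition flat_exp :: "nat \<Rightarrow> real \<Rightarrow> real" where
  "flat_exp j t = (if t > 0 then inverse t ^ j * exp (- inverse t) else 0)"

lemma flat_exp_tendsto_0: "(flat_exp j \<longlongrightarrow> 0) (at 0)"
proof (rule filterlim_split_at)
  show "(flat_exp j \<longlongrightarrow> 0) (at_left 0)"
    by (rule tendsto_eventually) (auto simp: eventually_at_filter flat_exp_def)
  have "((\<lambda>t::real. inverse t ^ j / exp (inverse t)) \<longlongrightarrow> 0) (at_right 0)"
    by (rule filterlim_compose[OF tendsto_power_div_exp_0 filterlim_inverse_at_top_right])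
  moreover have "(flat_exp j \<longlongrightarrow> 0) (at_right 0)
      \<longleftrightarrow> ((\<lambda>t::real. inverse t ^ j / exp (inverse t)) \<longlongrightarrow> 0) (at_right 0)"
    by (intro filterlim_cong refl)
       (auto simp: eventually_at_filter flat_exp_def exp_minus divide_inverse)
  ultimately show "(flat_exp j \<longlongrightarrow> 0) (at_right 0)" by simp
qed

lemma flat_exp_deriv:
  "(flat_exp j has_real_derivative flat_exp (j + 2) t - real j * flat_exp (j + 1) t) (at t)"
proof -
  consider "t > 0" | "t < 0" | "t = 0" by linarith
  then show ?thesis
  proof cases
    case 1
    have "((\<lambda>t. inverse t ^ j * exp (- inverse t)) has_real_derivative
        flat_exp (j + 2) t - real j * flat_exp (j + 1) t) (at t)"
      using 1
      apply (auto intro!: derivative_eq_intros simp: flat_exp_def)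
      apply (cases j)
       apply (auto simp: field_simps power2_eq_square)
      done
    then show ?thesis
      by (rule DERIV_cong_ev[THEN iffD1, rotated -1])
         (use 1 in \<open>auto simp: flat_exp_def eventually_at_filter
            intro!: eventually_mono[OF eventually_nhds_in_open[of "{0<..}"]]\<close>)
  next
    case 2
    have "((\<lambda>t. 0) has_real_derivative 0) (at t)" by simp
    then show ?thesis
      by (rule DERIV_cong_ev[THEN iffD1, rotated -1])
         (use 2 in \<open>auto simp: flat_exp_def eventually_at_filter
            intro!: eventually_mono[OF eventually_nhds_in_open[of "{..<0}"]]\<close>)
  next
    case 3
    have "((\<lambda>h. (flat_exp j (0 + h) - flat_exp j 0) / h) \<longlongrightarrow> 0) (at 0)
        \<longleftrightarrow> (flat_exp (Suc j) \<longlongrightarrow> 0) (at 0)"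
      by (intro filterlim_cong refl)
         (auto simp: eventually_at_filter flat_exp_def divide_inverse)
    then show ?thesis
      using flat_exp_tendsto_0 3 by (simp add: DERIV_def flat_exp_def)
  qed
qed

text \<open>Composing with an affine function of the point yields bumps in each coordinate. Every
  derivative is a combination of members of the family with larger \<open>j\<close>, so the induction on the
  order of differentiability has to be for all \<open>j\<close> at once.\<close>
lemma C_diff_flat_exp:
  "C_diff k (\<lambda>p. of_real (flat_exp j (\<alpha> * fst p + \<beta> * snd p + \<gamma>)))"
proof (induction k arbitrary: j)
  let ?l = "\<lambda>p::real \<times> real. \<alpha> * fst p + \<beta> * snd p + \<gamma>"
  have der: "((\<lambda>p. complex_of_real (flat_exp j (?l p))) has_derivative
      (\<lambda>e. of_real ((\<alpha> * fst e + \<beta> * snd e) *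
         (flat_exp (j + 2) (?l p) - real j * flat_exp (j + 1) (?l p))))) (at p)" for j p
  proof -
    have "(?l has_derivative (\<lambda>e. \<alpha> * fst e + \<beta> * snd e)) (at p)"
      by (auto intro!: derivative_eq_intros)
    from has_derivative_compose[OF this flat_exp_deriv[of j "?l p", unfolded has_field_derivative_def]]
    have "((\<lambda>p. flat_exp j (?l p)) has_derivative
      (\<lambda>e. (\<alpha> * fst e + \<beta> * snd e) *
         (flat_exp (j + 2) (?l p) - real j * flat_exp (j + 1) (?l p)))) (at p)"
      by (simp add: mult.commute)
    from bounded_linear.has_derivative[OF bounded_linear_of_real this] show ?thesis .
  qed
  {
    case 0
    have "(\<lambda>p. complex_of_real (flat_exp j (?l p))) differentiable at p" for p
      using der differentiable_def by blast
    then show ?case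
      unfolding C_diff.simps
      by (intro continuous_at_imp_continuous_on ballI differentiable_imp_continuous_within)
  next
    case (Suc k)
    have "dir_deriv e (\<lambda>p. of_real (flat_exp j (?l p))) = (\<lambda>p. of_real (\<alpha> * fst e + \<beta> * snd e) *
         (of_real (flat_exp (j + 2) (?l p)) + of_real (- real j) * of_real (flat_exp (j + 1) (?l p))))"
      for e
      by (rule ext) (simp add: dir_deriv_eqI[OF der])
    then show ?case
      using differentiableI[OF der]
      by (auto intro!: C_diff_mult C_diff_add C_diff_const Suc simp del: of_real_add of_real_minus)
  }
qed

text \<open>Since \<open>exp(-1/(n t))\<close> tends to \<open>1\<close> for \<open>t > 0\<close>, these bumps on the box with corners \<open>b\<close> and \<open>c\<close>
  converge to its indicator function as \<open>n\<close> grows, while all of them vanish off the box.\<close>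
definition box_bump :: "real \<times> real \<Rightarrow> real \<times> real \<Rightarrow> nat \<Rightarrow> real \<times> real \<Rightarrow> real" where
  "box_bump b c n p =
     flat_exp 0 (real n * (fst p - fst b)) * flat_exp 0 (real n * (fst c - fst p)) *
     (flat_exp 0 (real n * (snd p - snd b)) * flat_exp 0 (real n * (snd c - snd p)))"

lemma smooth_box_bump: "smooth (\<lambda>p. of_real (box_bump b c n p))"
proof -
  have 1: "smooth (\<lambda>p. of_real (flat_exp 0 (\<alpha> * fst p + \<beta> * snd p + \<gamma>)))" for \<alpha> \<beta> \<gamma>
    by (simp add: smooth_def C_diff_flat_exp)
  have "smooth (\<lambda>p. of_real (flat_exp 0 (real n * (fst p - fst b))))"
    using 1[of n 0 "- n * fst b"] by (simp add: algebra_simps)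
  moreover have "smooth (\<lambda>p. of_real (flat_exp 0 (real n * (fst c - fst p))))"
    using 1[of "- n" 0 "n * fst c"] by (simp add: algebra_simps)
  moreover have "smooth (\<lambda>p. of_real (flat_exp 0 (real n * (snd p - snd b))))"
    using 1[of 0 n "- n * snd b"] by (simp add: algebra_simps)
  moreover have "smooth (\<lambda>p. of_real (flat_exp 0 (real n * (snd c - snd p))))"
    using 1[of 0 "- n" "n * snd c"] by (simp add: algebra_simps)
  ultimately show ?thesis unfolding box_bump_def of_real_mult
    by (intro smooth_mult)
qed

lemma mem_box_prod:
  fixes p b c :: "real \<times> real"
  shows "p \<in> box b c \<longleftrightarrow> fst b < fst p \<and> fst p < fst c \<and> snd b < snd p \<and> snd p < snd c"
    and "p \<in> cbox b c \<longleftrightarrow> fst b \<le> fst p \<and> fst p \<le> fst c \<and> snd b \<le> snd p \<and> snd p \<le> snd c"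
  by (cases p; cases b; cases c; auto simp: mem_box Basis_prod_def)+

lemma box_bump_outside: "p \<notin> box b c \<Longrightarrow> box_bump b c n p = 0"
  by (auto simp: mem_box_prod box_bump_def flat_exp_def zero_less_mult_iff)

lemma flat_exp_0_bounds: "0 \<le> flat_exp 0 t" "flat_exp 0 t \<le> 1"
  by (auto simp: flat_exp_def)

lemma box_bump_bounds: "0 \<le> box_bump b c n p" "box_bump b c n p \<le> 1"
  unfolding box_bump_def by (auto intro!: mult_nonneg_nonneg mult_le_one flat_exp_0_bounds)

lemma flat_exp_tendsto_1: "t > 0 \<Longrightarrow> (\<lambda>n. flat_exp 0 (real n * t)) \<longlonglongrightarrow> 1"
proof -
  assume t: "t > 0"
  have "(\<lambda>n. inverse (real n)) \<longlonglongrightarrow> 0" by (rule lim_inverse_n)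
  then have "(\<lambda>n. exp (- (inverse (real n) * inverse t))) \<longlonglongrightarrow> exp (- (0 * inverse t))"
    by (intro tendsto_intros)
  moreover have "\<forall>\<^sub>F n in sequentially. exp (- (inverse (real n) * inverse t)) = flat_exp 0 (real n * t)"
    using eventually_gt_at_top[of 0] by eventually_elim (use t in \<open>auto simp: flat_exp_def\<close>)
  ultimately show ?thesis using Lim_transform_eventually by fastforce
qed

lemma box_bump_tendsto: "(\<lambda>n. box_bump b c n p) \<longlonglongrightarrow> indicator (box b c) p"
proof (cases "p \<in> box b c")
  case True
  then have "(\<lambda>n. box_bump b c n p) \<longlonglongrightarrow> 1 * 1 * (1 * 1)"
    unfolding box_bump_def mem_box_prod by (intro tendsto_mult flat_exp_tendsto_1) auto
  then show ?thesis using True by simp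
qed (simp add: box_bump_outside)

lemma box_bump_test_function:
  assumes "cbox b c \<subseteq> half_plane_interior a"
  shows "(\<lambda>p. of_real (box_bump b c n p)) \<in> test_functions a"
  by (rule test_functionI[OF smooth_box_bump compact_cbox assms])
     (use box_bump_outside box_subset_cbox in fastforce)

section \<open>Weak derivatives\<close>

lemma closed_half_plane: "closed (half_plane a)"
  unfolding half_plane_def by (intro closed_Times) auto

lemma open_half_plane_interior: "open (half_plane_interior a)"
  unfolding half_plane_interior_def by (intro open_Times) auto

lemma half_plane_lebesgue [measurable, simp]: "half_plane a \<in> sets lebesgue"
  using closed_half_plane borel_closed by (metis sets_completionI_sets sets_lborel)

lemma half_plane_interior_subset: "half_plane_interior a \<subseteq> half_plane a"
  by (auto simp: half_plane_def half_plane_interior_def)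

lemma AE_half_plane_interior: "AE p in lebesgue_on (half_plane a). p \<in> half_plane_interior a"
proof -
  have "negligible {p::real \<times> real. p \<bullet> (0, 1) = a}"
    by (rule negligible_standard_hyperplane) (simp add: Basis_prod_def)
  then have "AE p in lebesgue. p \<notin> {p::real \<times> real. p \<bullet> (0, 1) = a}"
    unfolding negligible_iff_null_sets by (rule AE_not_in)
  then have "AE p in lebesgue. p \<in> half_plane a \<longrightarrow> p \<in> half_plane_interior a"
    by eventually_elim (auto simp: half_plane_def half_plane_interior_def)
  then show ?thesis
    by (subst AE_restrict_space_iff) simp_all
qed

lemma lebesgue_on_supported:
  fixes f :: "'a::euclidean_space \<Rightarrow> 'b::{banach, second_countable_topology}"
  assumes "K \<subseteq> S" "K \<in> sets lebesgue" "S \<in> sets lebesgue" "\<And>p. p \<in> S - K \<Longrightarrow> f p = 0"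
  shows "integrable (lebesgue_on S) f \<longleftrightarrow> integrable (lebesgue_on K) f"
    and "integral\<^sup>L (lebesgue_on S) f = integral\<^sup>L (lebesgue_on K) f"
proof -
  have *: "(\<lambda>x. indicator S x *\<^sub>R f x) = (\<lambda>x. indicator K x *\<^sub>R f x)"
    using assms(1,4) by (auto simp: fun_eq_iff indicator_def)
  show "integrable (lebesgue_on S) f \<longleftrightarrow> integrable (lebesgue_on K) f"
    using assms(2,3) * by (simp add: integrable_restrict_space)
  show "integral\<^sup>L (lebesgue_on S) f = integral\<^sup>L (lebesgue_on K) f"
    using assms(2,3) * by (simp add: integral_restrict_space)
qed

lemma integrable_compact_times_continuous:
  fixes v \<eta> :: "real \<times> real \<Rightarrow> complex"
  assumes "compact K" "v absolutely_integrable_on K" "continuous_on K \<eta>"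
  shows "integrable (lebesgue_on K) (\<lambda>p. v p * \<eta> p)"
proof -
  have K: "K \<in> sets lebesgue" by (simp add: assms(1) lmeasurable_compact fmeasurableD)
  have v: "integrable (lebesgue_on K) v"
    by (rule absolutely_integrable_imp_integrable[OF assms(2) K])
  have \<eta>: "\<eta> \<in> borel_measurable (lebesgue_on K)"
    by (rule continuous_imp_measurable_on_sets_lebesgue[OF assms(3) K])
  obtain B where B: "\<And>p. p \<in> K \<Longrightarrow> norm (\<eta> p) \<le> B"
    using compact_imp_bounded[OF compact_continuous_image[OF assms(3,1)]]
    by (auto simp: bounded_iff)
  show ?thesis
  proof (rule Bochner_Integration.integrable_bound)
    show "integrable (lebesgue_on K) (\<lambda>p. B * norm (v p))"
      using v by simp
    show "(\<lambda>p. v p * \<eta> p) \<in> borel_measurable (lebesgue_on K)"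
      using v \<eta> by (auto intro: borel_measurable_times)
    show "AE p in lebesgue_on K. norm (v p * \<eta> p) \<le> norm (B * norm (v p))"
    proof (rule AE_I2)
      fix p assume "p \<in> space (lebesgue_on K)"
      then have "norm (\<eta> p) \<le> \<bar>B\<bar>" using B[of p] by simp
      then show "norm (v p * \<eta> p) \<le> norm (B * norm (v p))"
        by (simp add: norm_mult abs_mult mult.commute mult_right_mono)
    qed
  qed
qed

lemma integrable_times_test_function:
  assumes "locally_integrable a v" "\<eta> \<in> test_functions a"
  shows "integrable (lebesgue_on (half_plane a)) (\<lambda>p. v p * \<eta> p)"
proof -
  obtain K where K: "compact K" "K \<subseteq> half_plane_interior a" "\<And>p. p \<notin> K \<Longrightarrow> \<eta> p = 0"
    by (rule test_functionE[OF assms(2)]) (rule that)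
  have "integrable (lebesgue_on K) (\<lambda>p. v p * \<eta> p)"
  proof (rule integrable_compact_times_continuous[OF K(1)])
    show "v absolutely_integrable_on K" using assms(1) K by (simp add: locally_integrable_def)
    show "continuous_on K \<eta>"
      using smooth_continuous[OF test_function_smooth[OF assms(2)]] continuous_on_subset by blast
  qed
  moreover have "K \<subseteq> half_plane a" using K(2) half_plane_interior_subset by blast
  ultimately show ?thesis
    using lebesgue_on_supported(1)[of K "half_plane a" "\<lambda>p. v p * \<eta> p"] K
    by (simp add: lmeasurable_compact fmeasurableD)
qed

text \<open>At almost every point the value is the limit of the averages over small boxes with a corner at
  that point, and all these averages vanish.\<close>
lemma AE_zero_if_box_integrals_zero:
  fixes f :: "'a::euclidean_space \<Rightarrow> 'b::euclidean_space"
  assumes "\<And>b c. f integrable_on cbox b c" "\<And>b c. integral (cbox b c) f = 0"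
  shows "AE x in lebesgue. f x = 0"
proof -
  obtain N where N: "negligible N"
    "\<And>x e. \<lbrakk>x \<notin> N; 0 < e\<rbrakk> \<Longrightarrow> \<exists>d>0. \<forall>h. 0 < h \<and> h < d \<longrightarrow>
        norm (integral (cbox x (x + h *\<^sub>R One)) f /\<^sub>R h ^ DIM('a) - f x) < e"
    by (rule integrable_ccontinuous_explicit[OF assms(1)]) (rule that)
  have "f x = 0" if "x \<notin> N" for x
  proof (rule ccontr)
    assume "f x \<noteq> 0"
    then have "norm (f x) > 0" by simp
    from N(2)[OF that this] obtain d where "d > 0" and "\<forall>h. 0 < h \<and> h < d \<longrightarrow>
        norm (integral (cbox x (x + h *\<^sub>R One)) f /\<^sub>R h ^ DIM('a) - f x) < norm (f x)"
      by blast
    from this(2)[rule_format, of "d / 2"] \<open>d > 0\<close> show False by (simp add: assms(2))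
  qed
  then have "{x. f x \<noteq> 0} \<subseteq> N" by blast
  then have "{x. f x \<noteq> 0} \<in> null_sets lebesgue"
    using N(1) negligible_subset negligible_iff_null_sets by blast
  then show ?thesis by (simp add: completion.AE_iff_null_sets)
qed

text \<open>Test against the bumps of the box and let them converge to its indicator function; dominated
  convergence applies because the bumps take values between \<open>0\<close> and \<open>1\<close>.\<close>
lemma integral_box_zero_if_orthogonal_to_test_functions:
  assumes loc: "locally_integrable a d"
    and orth: "\<And>\<eta>. \<eta> \<in> test_functions a \<Longrightarrow> (\<integral>p. d p * \<eta> p \<partial>lebesgue_on (half_plane a)) = 0"
    and sub: "cbox b c \<subseteq> half_plane_interior a"
  shows "integral (cbox b c) d = 0"
proof -
  let ?C = "cbox b c"
  have subH: "?C \<subseteq> half_plane a" using sub half_plane_interior_subset by blast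
  have aint: "d absolutely_integrable_on ?C"
    using loc sub by (simp add: locally_integrable_def)
  then have int: "integrable (lebesgue_on ?C) d"
    by (rule absolutely_integrable_imp_integrable) simp
  let ?f = "\<lambda>n p. d p * of_real (box_bump b c n p)"
  have zero: "(\<integral>p. ?f n p \<partial>lebesgue_on ?C) = 0" for n
  proof -
    have "(\<integral>p. ?f n p \<partial>lebesgue_on (half_plane a)) = 0"
      by (rule orth[OF box_bump_test_function[OF sub]])
    moreover have "?f n p = 0" if "p \<in> half_plane a - ?C" for p
      using that box_bump_outside box_subset_cbox by fastforce
    ultimately show ?thesis
      using lebesgue_on_supported(2)[of ?C "half_plane a" "?f n"] subH by simp
  qed
  have "(\<lambda>n. \<integral>p. ?f n p \<partial>lebesgue_on ?C) \<longlonglongrightarrow> (\<integral>p. d p * of_real (indicator (box b c) p) \<partial>lebesgue_on ?C)"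
  proof (rule integral_dominated_convergence[where w = "\<lambda>p. norm (d p)"])
    show "integrable (lebesgue_on ?C) (\<lambda>p. norm (d p))" using int by simp
    have "continuous_on ?C (\<lambda>p. complex_of_real (box_bump b c n p))" for n
      using smooth_continuous[OF smooth_box_bump] continuous_on_subset by blast
    from integrable_compact_times_continuous[OF compact_cbox aint this]
    show "?f n \<in> borel_measurable (lebesgue_on ?C)" for n by auto
    have "box b c \<in> sets (lebesgue_on ?C)"
      by (simp add: sets_restrict_space_iff box_subset_cbox)
    then show "(\<lambda>p. d p * of_real (indicator (box b c) p)) \<in> borel_measurable (lebesgue_on ?C)"
      using int by (intro borel_measurable_times borel_measurable_of_real borel_measurable_indicator) auto
    show "AE p in lebesgue_on ?C. (\<lambda>n. ?f n p) \<longlonglongrightarrow> d p * of_real (indicator (box b c) p)"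
      by (intro AE_I2 tendsto_intros box_bump_tendsto)
    show "AE p in lebesgue_on ?C. norm (?f n p) \<le> norm (d p)" for n
      by (intro AE_I2) (simp add: norm_mult box_bump_bounds mult_left_le abs_of_nonneg)
  qed
  then have "(\<integral>p. d p * of_real (indicator (box b c) p) \<partial>lebesgue_on ?C) = 0"
    using LIMSEQ_unique by (auto simp: zero)
  also have "(\<integral>p. d p * of_real (indicator (box b c) p) \<partial>lebesgue_on ?C)
      = (\<integral>p. d p * of_real (indicator (box b c) p) \<partial>lebesgue_on (box b c))"
    by (rule lebesgue_on_supported(2)) (auto simp: box_subset_cbox)
  also have "\<dots> = (\<integral>p. d p \<partial>lebesgue_on (box b c))"
    by (rule Bochner_Integration.integral_cong) auto
  also have "\<dots> = integral (box b c) d"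
  proof (rule lebesgue_integral_eq_integral)
    show "integrable (lebesgue_on (box b c)) d"
      by (rule absolutely_integrable_imp_integrable[OF set_integrable_subset[OF aint]])
         (auto simp: box_subset_cbox)
  qed simp
  also have "\<dots> = integral ?C d" by (rule integral_open_interval)
  finally show ?thesis .
qed

text \<open>The du Bois-Reymond lemma. The open half plane is a countable union of compact boxes; on such a
  box extend the function by zero, so that its integral over any box is again an integral over a box
  inside the half plane.\<close>
lemma AE_zero_if_orthogonal_to_test_functions:
  assumes loc: "locally_integrable a d"
    and orth: "\<And>\<eta>. \<eta> \<in> test_functions a \<Longrightarrow> (\<integral>p. d p * \<eta> p \<partial>lebesgue_on (half_plane a)) = 0"
  shows "AE p in lebesgue_on (half_plane a). d p = 0"
proof -
  have box: "AE p in lebesgue. p \<in> cbox b c \<longrightarrow> d p = 0" if sub: "cbox b c \<subseteq> half_plane_interior a" for b c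
  proof -
    let ?f = "\<lambda>p. if p \<in> cbox b c then d p else 0"
    have aint: "d absolutely_integrable_on cbox b c"
      using loc sub by (simp add: locally_integrable_def)
    have "integral (cbox b' c') ?f = 0" "?f integrable_on cbox b' c'" for b' c'
    proof -
      have 1: "integral (cbox b' c') ?f = integral (cbox b c \<inter> cbox b' c') d"
        by (rule integral_restrict_Int)
      have 2: "?f integrable_on cbox b' c' \<longleftrightarrow> d integrable_on (cbox b c \<inter> cbox b' c')"
        by (rule integrable_restrict_Int)
      obtain b'' c'' where eq: "cbox b c \<inter> cbox b' c' = cbox b'' c''"
        using that[OF Int_interval] .
      then have sub': "cbox b'' c'' \<subseteq> cbox b c" by blast
      have "integral (cbox b'' c'') d = 0"
        by (rule integral_box_zero_if_orthogonal_to_test_functions[OF loc orth]) (use sub sub' in auto)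
      then show "integral (cbox b' c') ?f = 0" using 1 eq by simp
      have "d integrable_on cbox b'' c''"
        using set_lebesgue_integral_eq_integral(1)[OF set_integrable_subset[OF aint _ sub']] by simp
      then show "?f integrable_on cbox b' c'" using 2 eq by simp
    qed
    then have "AE p in lebesgue. ?f p = 0" by (intro AE_zero_if_box_integrals_zero)
    then show ?thesis by eventually_elim (auto split: if_splits)
  qed
  obtain \<D> where \<D>: "countable \<D>" "\<D> \<subseteq> Pow (half_plane_interior a)"
    "\<And>X. X \<in> \<D> \<Longrightarrow> \<exists>b c. X = cbox b c" "\<Union>\<D> = half_plane_interior a"
    by (rule open_countable_Union_open_cbox[OF open_half_plane_interior]) (rule that)
  have "AE p in lebesgue. \<forall>X\<in>\<D>. p \<in> X \<longrightarrow> d p = 0"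
  proof (rule AE_ball_countable'[OF _ \<D>(1)])
    fix X assume "X \<in> \<D>"
    with \<D>(2,3) obtain b c where "X = cbox b c" "cbox b c \<subseteq> half_plane_interior a" by blast
    then show "AE p in lebesgue. p \<in> X \<longrightarrow> d p = 0" using box[of b c] by simp
  qed
  then have "AE p in lebesgue. p \<in> half_plane_interior a \<longrightarrow> d p = 0"
    by eventually_elim (use \<D>(4) in blast)
  then have "AE p in lebesgue_on (half_plane a). p \<in> half_plane_interior a \<longrightarrow> d p = 0"
    by (subst AE_restrict_space_iff) (simp, erule eventually_mono, simp)
  then show ?thesis using AE_half_plane_interior by eventually_elim blast
qed

lemma locally_integrable_add:
  "locally_integrable a u \<Longrightarrow> locally_integrable a v \<Longrightarrow> locally_integrable a (\<lambda>p. u p + v p)"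
  by (auto simp: locally_integrable_def intro!: set_integral_add)

lemma locally_integrable_scale:
  "locally_integrable a u \<Longrightarrow> locally_integrable a (\<lambda>p. c * u p)"
  by (auto simp: locally_integrable_def intro!: set_integrable_mult_right)

lemma has_weak_deriv_unique:
  assumes "has_weak_deriv a e v w" "has_weak_deriv a e v w'"
  shows "AE p in lebesgue_on (half_plane a). w p = w' p"
proof -
  note loc = assms[unfolded has_weak_deriv_def]
  let ?d = "\<lambda>p. w p + (-1) * w' p"
  have "AE p in lebesgue_on (half_plane a). ?d p = 0"
  proof (rule AE_zero_if_orthogonal_to_test_functions)
    show "locally_integrable a ?d"
      using loc by (intro locally_integrable_add locally_integrable_scale) simp_all
    fix \<eta> assume \<eta>: "\<eta> \<in> test_functions a"
    have "(\<integral>p. ?d p * \<eta> p \<partial>lebesgue_on (half_plane a))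
        = (\<integral>p. w p * \<eta> p - w' p * \<eta> p \<partial>lebesgue_on (half_plane a))"
      by (simp add: algebra_simps)
    also have "\<dots> = (\<integral>p. w p * \<eta> p \<partial>lebesgue_on (half_plane a)) - (\<integral>p. w' p * \<eta> p \<partial>lebesgue_on (half_plane a))"
      using loc \<eta> by (intro Bochner_Integration.integral_diff integrable_times_test_function) simp_all
    also have "\<dots> = 0"
    proof -
      have "- (\<integral>p. w p * \<eta> p \<partial>lebesgue_on (half_plane a)) = - (\<integral>p. w' p * \<eta> p \<partial>lebesgue_on (half_plane a))"
        using loc \<eta> by simp
      then show ?thesis by simp
    qed
    finally show "(\<integral>p. ?d p * \<eta> p \<partial>lebesgue_on (half_plane a)) = 0" .
  qed
  then show ?thesis by eventually_elim simp
qed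

lemma test_function_dir_deriv_axis:
  assumes "\<eta> \<in> test_functions a" "e = (1, 0) \<or> e = (0, 1)"
  shows "dir_deriv e \<eta> \<in> test_functions a"
  using assms test_function_Dx test_function_Dy by auto

lemma has_weak_deriv_add:
  assumes "has_weak_deriv a e u w" "has_weak_deriv a e u' w'" and e: "e = (1, 0) \<or> e = (0, 1)"
  shows "has_weak_deriv a e (\<lambda>p. u p + u' p) (\<lambda>p. w p + w' p)"
proof -
  note loc = assms(1,2)[unfolded has_weak_deriv_def]
  have "(\<integral>p. (u p + u' p) * dir_deriv e \<eta> p \<partial>lebesgue_on (half_plane a)) =
        - (\<integral>p. (w p + w' p) * \<eta> p \<partial>lebesgue_on (half_plane a))"
    if \<eta>: "\<eta> \<in> test_functions a" for \<eta>
  proof -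
    note int = integrable_times_test_function[OF _ \<eta>]
      integrable_times_test_function[OF _ test_function_dir_deriv_axis[OF \<eta> e]]
    show ?thesis using loc \<eta> by (simp add: distrib_right int)
  qed
  then show ?thesis
    using loc by (auto simp: has_weak_deriv_def intro: locally_integrable_add)
qed

lemma has_weak_deriv_scale:
  assumes "has_weak_deriv a e u w"
  shows "has_weak_deriv a e (\<lambda>p. c * u p) (\<lambda>p. c * w p)"
  using assms by (auto simp: has_weak_deriv_def mult.assoc intro: locally_integrable_scale)

lemma locally_integrable_cong_AE:
  assumes "locally_integrable a u" and AE: "AE p in lebesgue_on (half_plane a). u p = u' p"
  shows "locally_integrable a u'"
  unfolding locally_integrable_def
proof (intro allI impI)
  fix K assume K: "compact K \<and> K \<subseteq> half_plane_interior a"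
  have "AE p in lebesgue. p \<in> half_plane a \<longrightarrow> u p = u' p"
    using AE by (subst (asm) AE_restrict_space_iff) auto
  then have "negligible {p. \<not> (p \<in> half_plane a \<longrightarrow> u p = u' p)}"
    by (simp add: completion.AE_iff_null_sets negligible_iff_null_sets)
  moreover have "u' p = u p" if "p \<in> K - {p. \<not> (p \<in> half_plane a \<longrightarrow> u p = u' p)}" for p
    using that K half_plane_interior_subset[of a] by auto
  moreover have "u absolutely_integrable_on K"
    using assms(1) K by (simp add: locally_integrable_def)
  ultimately show "u' absolutely_integrable_on K"
    using absolutely_integrable_spike by blast
qed

lemma has_weak_deriv_cong_AE:
  assumes wd: "has_weak_deriv a e u w" and e: "e = (1, 0) \<or> e = (0, 1)"
    and AE: "AE p in lebesgue_on (half_plane a). u p = u' p"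
      "AE p in lebesgue_on (half_plane a). w p = w' p"
  shows "has_weak_deriv a e u' w'"
proof -
  note loc = wd[unfolded has_weak_deriv_def]
  have loc': "locally_integrable a u'" "locally_integrable a w'"
    using loc locally_integrable_cong_AE AE by blast+
  have "(\<integral>p. u' p * dir_deriv e \<eta> p \<partial>lebesgue_on (half_plane a)) =
        - (\<integral>p. w' p * \<eta> p \<partial>lebesgue_on (half_plane a))"
    if \<eta>: "\<eta> \<in> test_functions a" for \<eta>
  proof -
    note int = borel_measurable_integrable[OF integrable_times_test_function[OF _ \<eta>]]
      borel_measurable_integrable[OF integrable_times_test_function[OF _ test_function_dir_deriv_axis[OF \<eta> e]]]
    have "(\<integral>p. u' p * dir_deriv e \<eta> p \<partial>lebesgue_on (half_plane a))
        = (\<integral>p. u p * dir_deriv e \<eta> p \<partial>lebesgue_on (half_plane a))"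
    proof (rule integral_cong_AE)
      show "AE p in lebesgue_on (half_plane a). u' p * dir_deriv e \<eta> p = u p * dir_deriv e \<eta> p"
        using AE(1) by eventually_elim simp
    qed (use int loc loc' in simp_all)
    moreover have "(\<integral>p. w' p * \<eta> p \<partial>lebesgue_on (half_plane a))
        = (\<integral>p. w p * \<eta> p \<partial>lebesgue_on (half_plane a))"
    proof (rule integral_cong_AE)
      show "AE p in lebesgue_on (half_plane a). w' p * \<eta> p = w p * \<eta> p"
        using AE(2) by eventually_elim simp
    qed (use int loc loc' in simp_all)
    ultimately show ?thesis using loc \<eta> by simp
  qed
  then show ?thesis using loc' by (auto simp: has_weak_deriv_def)
qed

lemma weak_deriv_works: "has_weak_deriv a e v w \<Longrightarrow> has_weak_deriv a e v (weak_deriv a e v)"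
  unfolding weak_deriv_def by (rule someI[of "has_weak_deriv a e v"])

lemma weak_deriv_AE_eq:
  "has_weak_deriv a e v w \<Longrightarrow> AE p in lebesgue_on (half_plane a). weak_deriv a e v p = w p"
  using has_weak_deriv_unique weak_deriv_works by blast

text \<open>The chosen representatives are even equal, because functions that agree almost everywhere have
  the same set of weak derivatives to choose from.\<close>
lemma weak_deriv_cong_AE:
  assumes "AE p in lebesgue_on (half_plane a). u p = u' p" "e = (1, 0) \<or> e = (0, 1)"
  shows "weak_deriv a e u = weak_deriv a e u'"
proof -
  have "AE p in lebesgue_on (half_plane a). u' p = u p"
    using assms(1) by (auto elim: eventually_mono)
  then have "has_weak_deriv a e u = has_weak_deriv a e u'"
    using has_weak_deriv_cong_AE assms by (intro ext iffI) (blast intro: AE_I2)+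
  then show ?thesis by (simp add: weak_deriv_def)
qed

section \<open>Integration by parts against the weight\<close>

definition weight :: "real \<Rightarrow> real \<Rightarrow> real \<times> real \<Rightarrow> real" where
  "weight \<nu> \<mu> p = weight_x \<nu> (fst p) * weight_y \<mu> (snd p)"

lemma weight_pos: "weight \<nu> \<mu> p > 0"
  by (simp add: weight_def weight_x_def weight_y_def)

lemma continuous_weight: "continuous_on S (weight \<nu> \<mu>)"
  unfolding weight_def weight_x_def weight_y_def by (intro continuous_intros)

lemma weight_square: "(weight \<nu> \<mu> (x, y))\<^sup>2 = exp (2 * \<nu> * \<bar>x\<bar>) * exp (\<mu> * y\<^sup>2)"
proof -
  have "(exp t)\<^sup>2 = exp (2 * t)" for t :: real by (simp add: exp_double)
  then show ?thesis
    by (simp add: weight_def weight_x_def weight_y_def power_mult_distrib mult.assoc)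
qed

lemma integrable_test_function_times:
  fixes h c b :: "real \<times> real \<Rightarrow> complex"
  assumes h: "h \<in> test_functions a" and c: "continuous_on UNIV c"
    and b: "b \<in> borel_measurable borel" "\<And>p. cmod (b p) \<le> B"
  shows "integrable lborel (\<lambda>p. b p * (h p * c p))"
    and "integrable (lebesgue_on (half_plane a)) (\<lambda>p. b p * (h p * c p))"
    and "(\<integral>p. b p * (h p * c p) \<partial>lebesgue_on (half_plane a)) = (\<integral>p. b p * (h p * c p) \<partial>lborel)"
proof -
  obtain K where K: "compact K" "K \<subseteq> half_plane_interior a" "\<And>p. p \<notin> K \<Longrightarrow> h p = 0"
    by (rule test_functionE[OF h]) (rule that)
  have cont: "continuous_on UNIV (\<lambda>p. h p * c p)"
    by (intro continuous_intros smooth_continuous[OF test_function_smooth[OF h]] c)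
  have "integrable lborel (\<lambda>p. indicator K p *\<^sub>R (h p * c p))"
    by (intro borel_integrable_compact K continuous_on_subset[OF cont]) simp
  moreover have "(\<lambda>p. indicator K p *\<^sub>R (h p * c p)) = (\<lambda>p. h p * c p)"
    using K(3) by (auto simp: fun_eq_iff indicator_def simp del: split_paired_All)
  ultimately have int: "integrable lborel (\<lambda>p. h p * c p)" by simp
  have m: "(\<lambda>p. b p * (h p * c p)) \<in> borel_measurable borel"
    by (intro borel_measurable_times b borel_measurable_continuous_onI cont)
  show intb: "integrable lborel (\<lambda>p. b p * (h p * c p))"
  proof (rule Bochner_Integration.integrable_bound)
    show "integrable lborel (\<lambda>p. B * norm (h p * c p))"
      using int by (intro integrable_mult_right integrable_norm)
    show "AE p in lborel. norm (b p * (h p * c p)) \<le> norm (B * norm (h p * c p))"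
    proof (rule AE_I2)
      fix p
      have "cmod (b p) \<le> \<bar>B\<bar>" using b(2)[of p] by linarith
      then show "norm (b p * (h p * c p)) \<le> norm (B * norm (h p * c p))"
        by (simp only: norm_mult abs_mult real_norm_def abs_norm_cancel mult_right_mono norm_ge_zero mult_nonneg_nonneg)
    qed
  qed (use m in simp)
  have m': "(\<lambda>p. b p * (h p * c p)) \<in> borel_measurable lborel" using m by simp
  have "half_plane a \<subseteq> UNIV" by simp
  note supp = lebesgue_on_supported[OF this half_plane_lebesgue, of "\<lambda>p. b p * (h p * c p)", unfolded lebesgue_on_UNIV_eq]
  have z: "b p * (h p * c p) = 0" if "p \<in> UNIV - half_plane a" for p
  proof -
    have "p \<notin> K" using that K(2) half_plane_interior_subset[of a] by blast
    then show ?thesis by (simp add: K(3))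
  qed
  show "integrable (lebesgue_on (half_plane a)) (\<lambda>p. b p * (h p * c p))"
    using supp(1)[OF _ z] intb integrable_completion[OF m'] by simp
  show "(\<integral>p. b p * (h p * c p) \<partial>lebesgue_on (half_plane a)) = (\<integral>p. b p * (h p * c p) \<partial>lborel)"
    using supp(2)[OF _ z] integral_completion[OF m'] by simp
qed

text \<open>The Lebesgue integral of a non-integrable function is \<open>0\<close> by convention, so that in Fubini's theorem
  no distinction between integrable and other slices is necessary.\<close>
lemma integral_lborel_eq_0_if_has_integral:
  fixes f :: "real \<Rightarrow> complex"
  assumes "(f has_integral 0) {-R..R}" "\<And>x. x \<notin> {-R..R} \<Longrightarrow> f x = 0"
  shows "(\<integral>x. f x \<partial>lborel) = 0"
proof (cases "integrable lborel f")
  case True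
  have "(f has_integral 0) UNIV"
    by (rule has_integral_on_superset[OF assms]) simp_all
  then show ?thesis using has_integral_integral_lborel[OF True] has_integral_unique by blast
next
  case False
  then show ?thesis by (rule not_integrable_integral_eq)
qed

lemma compact_subset_square:
  assumes "compact (K :: (real \<times> real) set)"
  obtains R where "R > 0" "\<And>x y. (x, y) \<in> K \<Longrightarrow> \<bar>x\<bar> < R \<and> \<bar>y\<bar> < R"
proof -
  obtain B where B: "\<And>p. p \<in> K \<Longrightarrow> norm p \<le> B"
    using compact_imp_bounded[OF assms] by (auto simp: bounded_iff)
  show thesis
  proof (rule that[of "\<bar>B\<bar> + 1"])
    fix x y assume "(x, y) \<in> K"
    then have "norm (x, y) \<le> B" by (rule B)
    moreover have "\<bar>x\<bar> \<le> norm (x, y)" "\<bar>y\<bar> \<le> norm (x, y)"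
      using norm_fst_le[of x y] norm_snd_le[of y x] by simp_all
    ultimately show "\<bar>x\<bar> < \<bar>B\<bar> + 1 \<and> \<bar>y\<bar> < \<bar>B\<bar> + 1" by linarith
  qed simp
qed

lemma has_vector_derivative_slice:
  assumes "h differentiable (at (x, y))"
  shows "((\<lambda>x. h (x, y)) has_vector_derivative Dx h (x, y)) (at x)"
    and "((\<lambda>y. h (x, y)) has_vector_derivative Dy h (x, y)) (at y)"
proof -
  note d = has_derivative_frechet[OF assms]
  have lin: "dir_deriv (t *\<^sub>R e) h (x, y) = t *\<^sub>R dir_deriv e h (x, y)" for t e
    using linear_scale[OF has_derivative_linear[OF d]] .
  have linx: "(\<lambda>t. t *\<^sub>R Dx h (x, y)) = (\<lambda>t. dir_deriv (t, 0) h (x, y))"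
  proof
    show "t *\<^sub>R Dx h (x, y) = dir_deriv (t, 0) h (x, y)" for t
      using lin[of t "(1, 0)"] by simp
  qed
  have liny: "(\<lambda>t. t *\<^sub>R Dy h (x, y)) = (\<lambda>t. dir_deriv (0, t) h (x, y))"
  proof
    show "t *\<^sub>R Dy h (x, y) = dir_deriv (0, t) h (x, y)" for t
      using lin[of t "(0, 1)"] by simp
  qed
  have "((\<lambda>x. (x, y)) has_derivative (\<lambda>t. (t, 0))) (at x)"
    by (auto intro!: derivative_eq_intros)
  from has_derivative_compose[OF this d]
  show "((\<lambda>x. h (x, y)) has_vector_derivative Dx h (x, y)) (at x)"
    unfolding has_vector_derivative_def linx .
  have "((\<lambda>y. (x, y)) has_derivative (\<lambda>t. (0, t))) (at y)"
    by (auto intro!: derivative_eq_intros)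
  from has_derivative_compose[OF this d]
  show "((\<lambda>y. h (x, y)) has_vector_derivative Dy h (x, y)) (at y)"
    unfolding has_vector_derivative_def liny .
qed

lemma weight_derivative_x:
  assumes "x \<noteq> 0"
  shows "((\<lambda>x. (weight \<nu> \<mu> (x, y))\<^sup>2) has_real_derivative
           2 * \<nu> * sgn x * (weight \<nu> \<mu> (x, y))\<^sup>2) (at x)"
proof -
  have [derivative_intros]: "(abs has_real_derivative sgn x) (at x)"
  proof (cases "x > 0")
    case True
    show ?thesis
      by (rule DERIV_cong_ev[THEN iffD2, OF refl _ refl, of _ "\<lambda>x. x"])
         (use True in \<open>auto intro!: eventually_mono[OF eventually_nhds_in_open[of "{0<..}"]]\<close>)
  next
    case False
    with assms have "x < 0" by simp
    then have "((\<lambda>x. - x) has_real_derivative sgn x) (at x)"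
      by (auto intro!: derivative_eq_intros)
    then show ?thesis
      by (rule DERIV_cong_ev[THEN iffD2, OF refl _ refl, rotated])
         (use \<open>x < 0\<close> in \<open>auto intro!: eventually_mono[OF eventually_nhds_in_open[of "{..<0}"]]\<close>)
  qed
  have "((\<lambda>x. exp (2 * \<nu> * \<bar>x\<bar>) * exp (\<mu> * y\<^sup>2)) has_real_derivative
      2 * \<nu> * sgn x * (exp (2 * \<nu> * \<bar>x\<bar>) * exp (\<mu> * y\<^sup>2))) (at x)"
    using assms by (auto intro!: derivative_eq_intros)
  then show ?thesis by (simp add: weight_square)
qed

lemma weight_derivative_y:
  "((\<lambda>y. y ^ k * (weight \<nu> \<mu> (x, y))\<^sup>2) has_real_derivative
     (real k * y ^ (k - 1) + 2 * \<mu> * y ^ Suc k) * (weight \<nu> \<mu> (x, y))\<^sup>2) (at y)"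
proof -
  have "((\<lambda>y. y ^ k * (exp (2 * \<nu> * \<bar>x\<bar>) * exp (\<mu> * y\<^sup>2))) has_real_derivative
     (real k * y ^ (k - 1) + 2 * \<mu> * y ^ Suc k) * (exp (2 * \<nu> * \<bar>x\<bar>) * exp (\<mu> * y\<^sup>2))) (at y)"
    by (auto intro!: derivative_eq_intros simp: algebra_simps)
  then show ?thesis by (simp add: weight_square)
qed

lemma borel_measurable_sgn_fst: "(\<lambda>p::real \<times> real. sgn (fst p)) \<in> borel_measurable borel"
proof -
  have [measurable]: "(fst :: real \<times> real \<Rightarrow> real) \<in> borel_measurable borel"
    by (intro borel_measurable_continuous_onI continuous_intros)
  show ?thesis
    unfolding sgn_if by measurable
qed

text \<open>The integrand is \<open>\<partial>\<^sub>x(h y\<^sup>k \<phi>\<^sup>2 \<psi>\<^sup>2)\<close>. On each horizontal line it is the derivative of a compactly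
  supported function, except at \<open>x = 0\<close>, where the weight has a kink; the fundamental theorem of calculus
  tolerates this because the weight is continuous there.\<close>
lemma integral_divergence_x:
  fixes h :: "real \<times> real \<Rightarrow> complex" and \<nu> \<mu> :: real and k :: nat
  assumes h: "h \<in> test_functions a"
  defines "G \<equiv> \<lambda>p. (Dx h p + of_real (2 * \<nu> * sgn (fst p)) * h p) * of_real (snd p ^ k * (weight \<nu> \<mu> p)\<^sup>2)"
  shows "integrable (lebesgue_on (half_plane a)) G" "(\<integral>p. G p \<partial>lebesgue_on (half_plane a)) = 0"
proof -
  define c :: "real \<times> real \<Rightarrow> complex" where "c = (\<lambda>p. of_real (snd p ^ k * (weight \<nu> \<mu> p)\<^sup>2))"
  define b :: "real \<times> real \<Rightarrow> complex" where "b = (\<lambda>p. of_real (2 * \<nu> * sgn (fst p)))"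
  have G: "G p = 1 * (Dx h p * c p) + b p * (h p * c p)" for p
    by (simp add: G_def c_def b_def algebra_simps)
  have c: "continuous_on UNIV c"
    unfolding c_def by (intro continuous_intros continuous_weight)
  have b: "b \<in> borel_measurable borel" "cmod (b p) \<le> 2 * \<bar>\<nu>\<bar>" for p
    unfolding b_def using borel_measurable_sgn_fst
    by (auto simp: norm_mult abs_mult sgn_if intro!: borel_measurable_of_real borel_measurable_times)
  note I1 = integrable_test_function_times[OF test_function_Dx[OF h] c, of "\<lambda>_. 1" 1, simplified]
  note I2 = integrable_test_function_times[OF h c b]
  show "integrable (lebesgue_on (half_plane a)) G"
    unfolding G using I1(2) I2(2) by simp
  have intG: "integrable lborel G"
    unfolding G using I1(1) I2(1) by simp
  obtain K where K: "compact K" "\<And>p. p \<notin> K \<Longrightarrow> h p = 0" "\<And>p e. p \<notin> K \<Longrightarrow> dir_deriv e h p = 0"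
    by (rule test_functionE[OF h]) (rule that)
  obtain R where R: "R > 0" "\<And>x y. (x, y) \<in> K \<Longrightarrow> \<bar>x\<bar> < R \<and> \<bar>y\<bar> < R"
    by (rule compact_subset_square[OF K(1)]) (rule that)
  have slice: "(\<integral>x. G (x, y) \<partial>lborel) = 0" for y
  proof (rule integral_lborel_eq_0_if_has_integral)
    let ?f = "\<lambda>x. h (x, y) * of_real (y ^ k * (weight \<nu> \<mu> (x, y))\<^sup>2)"
    have "((\<lambda>x. G (x, y)) has_integral (?f R - ?f (-R))) {-R..R}"
    proof (rule fundamental_theorem_of_calculus_strong[of "{0}"])
      show "(?f has_vector_derivative G (x, y)) (at x)" if "x \<in> {-R..R} - {0}" for x
      proof -
        have "((\<lambda>x. y ^ k * (weight \<nu> \<mu> (x, y))\<^sup>2) has_real_derivative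
            y ^ k * (2 * \<nu> * sgn x * (weight \<nu> \<mu> (x, y))\<^sup>2)) (at x)"
          using that by (intro DERIV_cmult weight_derivative_x) simp
        from has_vector_derivative_mult[OF
            has_vector_derivative_slice(1)[OF smooth_differentiable[OF test_function_smooth[OF h]]]
            has_vector_derivative_of_real[OF this]]
        have "(?f has_vector_derivative
            h (x, y) * of_real (y ^ k * (2 * \<nu> * sgn x * (weight \<nu> \<mu> (x, y))\<^sup>2))
            + Dx h (x, y) * of_real (y ^ k * (weight \<nu> \<mu> (x, y))\<^sup>2)) (at x)" .
        then show ?thesis by (simp add: G_def algebra_simps)
      qed
      show "continuous_on {-R..R} ?f"
        by (intro continuous_intros
            continuous_on_compose2[OF smooth_continuous[OF test_function_smooth[OF h]]]
            continuous_on_compose2[OF continuous_weight[of UNIV]]) simp_all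
    qed (use R(1) in simp_all)
    moreover have "h (R, y) = 0" "h (-R, y) = 0"
      using R(2)[of R y] R(2)[of "-R" y] K(2) R(1) by fastforce+
    ultimately show "((\<lambda>x. G (x, y)) has_integral 0) {-R..R}" by simp
    fix x assume "x \<notin> {-R..R}"
    then have "(x, y) \<notin> K" using R(2)[of x y] by auto
    then show "G (x, y) = 0" by (simp add: G_def K)
  qed
  have "(\<integral>p. G p \<partial>lborel) = (\<integral>y. \<integral>x. G (x, y) \<partial>lborel \<partial>lborel)"
    using lborel_pair.integral_snd[of "\<lambda>x y. G (x, y)"] intG by (simp add: lborel_prod)
  then have "(\<integral>p. G p \<partial>lborel) = 0" by (simp add: slice)
  then show "(\<integral>p. G p \<partial>lebesgue_on (half_plane a)) = 0"
    unfolding G using I1 I2 by simp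
qed

text \<open>The integrand is \<open>\<partial>\<^sub>y(h y\<^sup>k \<phi>\<^sup>2 \<psi>\<^sup>2)\<close>, integrated along vertical lines. For \<open>k = 0\<close> the truncated
  difference \<open>k - 1\<close> is harmless because of the factor \<open>k\<close>.\<close>
lemma integral_divergence_y:
  fixes h :: "real \<times> real \<Rightarrow> complex" and \<nu> \<mu> :: real and k :: nat
  assumes h: "h \<in> test_functions a"
  defines "G \<equiv> \<lambda>p. (Dy h p * of_real (snd p ^ k)
      + h p * of_real (real k * snd p ^ (k - 1) + 2 * \<mu> * snd p ^ Suc k)) * of_real ((weight \<nu> \<mu> p)\<^sup>2)"
  shows "integrable (lebesgue_on (half_plane a)) G" "(\<integral>p. G p \<partial>lebesgue_on (half_plane a)) = 0"
proof -
  define c :: "real \<times> real \<Rightarrow> complex" where "c = (\<lambda>p. of_real (snd p ^ k * (weight \<nu> \<mu> p)\<^sup>2))"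
  define d :: "real \<times> real \<Rightarrow> complex" where
    "d = (\<lambda>p. of_real ((real k * snd p ^ (k - 1) + 2 * \<mu> * snd p ^ Suc k) * (weight \<nu> \<mu> p)\<^sup>2))"
  have G: "G p = Dy h p * c p + h p * d p" for p
    by (simp add: G_def c_def d_def algebra_simps)
  have c: "continuous_on UNIV c" "continuous_on UNIV d"
    unfolding c_def d_def by (intro continuous_intros continuous_weight)+
  note I1 = integrable_test_function_times[OF test_function_Dy[OF h] c(1), of "\<lambda>_. 1" 1, simplified]
  note I2 = integrable_test_function_times[OF h c(2), of "\<lambda>_. 1" 1, simplified]
  show "integrable (lebesgue_on (half_plane a)) G"
    unfolding G using I1(2) I2(2) by simp
  have intG: "integrable lborel G"
    unfolding G using I1(1) I2(1) by simp
  obtain K where K: "compact K" "\<And>p. p \<notin> K \<Longrightarrow> h p = 0" "\<And>p e. p \<notin> K \<Longrightarrow> dir_deriv e h p = 0"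
    by (rule test_functionE[OF h]) (rule that)
  obtain R where R: "R > 0" "\<And>x y. (x, y) \<in> K \<Longrightarrow> \<bar>x\<bar> < R \<and> \<bar>y\<bar> < R"
    by (rule compact_subset_square[OF K(1)]) (rule that)
  have slice: "(\<integral>y. G (x, y) \<partial>lborel) = 0" for x
  proof (rule integral_lborel_eq_0_if_has_integral)
    let ?f = "\<lambda>y. h (x, y) * of_real (y ^ k * (weight \<nu> \<mu> (x, y))\<^sup>2)"
    have "((\<lambda>y. G (x, y)) has_integral (?f R - ?f (-R))) {-R..R}"
    proof (rule fundamental_theorem_of_calculus)
      show "(?f has_vector_derivative G (x, y)) (at y within {-R..R})" for y
      proof -
        from has_vector_derivative_mult[OF
            has_vector_derivative_slice(2)[OF smooth_differentiable[OF test_function_smooth[OF h]]]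
            has_vector_derivative_of_real[OF weight_derivative_y]]
        have "(?f has_vector_derivative
            h (x, y) * of_real ((real k * y ^ (k - 1) + 2 * \<mu> * y ^ Suc k) * (weight \<nu> \<mu> (x, y))\<^sup>2)
            + Dy h (x, y) * of_real (y ^ k * (weight \<nu> \<mu> (x, y))\<^sup>2)) (at y)" .
        then have "(?f has_vector_derivative G (x, y)) (at y)"
          by (simp add: G_def algebra_simps)
        then show ?thesis by (rule has_vector_derivative_at_within)
      qed
    qed (use R(1) in simp_all)
    moreover have "h (x, R) = 0" "h (x, -R) = 0"
      using R(2)[of x R] R(2)[of x "-R"] K(2) R(1) by fastforce+
    ultimately show "((\<lambda>y. G (x, y)) has_integral 0) {-R..R}" by simp
    fix y assume "y \<notin> {-R..R}"
    then have "(x, y) \<notin> K" using R(2)[of x y] by auto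
    then show "G (x, y) = 0" by (simp add: G_def K)
  qed
  have "(\<integral>p. G p \<partial>lborel) = (\<integral>x. \<integral>y. G (x, y) \<partial>lborel \<partial>lborel)"
    using lborel_pair.integral_fst[of "\<lambda>x y. G (x, y)"] intG by (simp add: lborel_prod)
  then have "(\<integral>p. G p \<partial>lborel) = 0" by (simp add: slice)
  then show "(\<integral>p. G p \<partial>lebesgue_on (half_plane a)) = 0"
    unfolding G using I1 I2 by simp
qed

section \<open>The weighted Sobolev space as a seminormed space\<close>

abbreviation half_plane_measure :: "real \<Rightarrow> (real \<times> real) measure" where
  "half_plane_measure a \<equiv> lebesgue_on (half_plane a)"

text \<open>Lebesgue measure is complete, so measurability passes to functions that agree almost everywhere.
  This is needed because weak derivatives of sums are known only up to null sets.\<close>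
lemma borel_measurable_half_plane_cong_AE:
  fixes f g :: "real \<times> real \<Rightarrow> complex"
  assumes "f \<in> borel_measurable (half_plane_measure a)"
    and AE: "AE p in half_plane_measure a. f p = g p"
  shows "g \<in> borel_measurable (half_plane_measure a)"
proof -
  have "AE p in lebesgue. p \<in> half_plane a \<longrightarrow> f p = g p"
    using AE by (subst (asm) AE_restrict_space_iff) simp_all
  then have "AE p in lebesgue. (if p \<in> half_plane a then f p else 0) = (if p \<in> half_plane a then g p else 0)"
    by eventually_elim simp
  moreover have "(\<lambda>p. if p \<in> half_plane a then f p else 0) \<in> borel_measurable lebesgue"
    using assms(1) by (simp add: borel_measurable_if)
  ultimately have "(\<lambda>p. if p \<in> half_plane a then g p else 0) \<in> borel_measurable lebesgue"
    by (rule borel_measurable_AE[rotated])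
  then show ?thesis by (simp add: borel_measurable_if)
qed

lemma square_integrable_half_plane_cong_AE:
  assumes f: "square_integrable (half_plane_measure a) f"
    and AE: "AE p in half_plane_measure a. f p = g p"
  shows "square_integrable (half_plane_measure a) g"
    and "L2_seminorm (half_plane_measure a) g = L2_seminorm (half_plane_measure a) f"
proof -
  have m: "f \<in> borel_measurable (half_plane_measure a)" using f by (simp add: square_integrable_def)
  have g: "g \<in> borel_measurable (half_plane_measure a)"
    by (rule borel_measurable_half_plane_cong_AE[OF m AE])
  show "square_integrable (half_plane_measure a) g"
    by (rule square_integrable_bound[OF f g, of 1]) (use AE in \<open>eventually_elim, simp\<close>)
  show "L2_seminorm (half_plane_measure a) g = L2_seminorm (half_plane_measure a) f"
    by (rule sym, rule L2_seminorm_cong_AE[OF m g AE])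
qed

lemma continuous_imp_measurable_half_plane:
  fixes f :: "real \<times> real \<Rightarrow> 'b::euclidean_space"
  assumes "continuous_on UNIV f"
  shows "f \<in> borel_measurable (half_plane_measure a)"
  using continuous_imp_measurable_on_sets_lebesgue[OF continuous_on_subset[OF assms] half_plane_lebesgue]
  by simp

definition weighted ::
  "real \<Rightarrow> real \<Rightarrow> (real \<Rightarrow> real) \<Rightarrow> (real \<times> real \<Rightarrow> complex) \<Rightarrow> real \<times> real \<Rightarrow> complex" where
  "weighted \<nu> \<mu> c v = (\<lambda>p. of_real (c (snd p) * weight \<nu> \<mu> p) * v p)"

lemma weighted_add:
  "weighted \<nu> \<mu> c (\<lambda>p. u p + v p) = (\<lambda>p. weighted \<nu> \<mu> c u p + weighted \<nu> \<mu> c v p)"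
  by (simp add: weighted_def algebra_simps)

lemma weighted_scale:
  "weighted \<nu> \<mu> c (\<lambda>p. k * u p) = (\<lambda>p. k * weighted \<nu> \<mu> c u p)"
  by (simp add: weighted_def algebra_simps)

lemma cmod_weighted:
  "cmod (weighted \<nu> \<mu> c v p) = \<bar>c (snd p)\<bar> * weight \<nu> \<mu> p * cmod (v p)"
  using weight_pos[of \<nu> \<mu> p] by (simp add: weighted_def norm_mult abs_mult)

lemma weighted_measurable:
  assumes "v \<in> borel_measurable (half_plane_measure a)"
    and "(\<lambda>p. c (snd p)) \<in> borel_measurable (half_plane_measure a)"
  shows "weighted \<nu> \<mu> c v \<in> borel_measurable (half_plane_measure a)"
proof -
  have "weight \<nu> \<mu> \<in> borel_measurable (half_plane_measure a)"
    by (intro continuous_imp_measurable_half_plane continuous_weight)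
  with assms show ?thesis
    unfolding weighted_def by (intro borel_measurable_times borel_measurable_of_real) simp_all
qed

lemma measurable_half_plane_snd:
  "continuous_on UNIV c \<Longrightarrow> (\<lambda>p. c (snd p) :: real) \<in> borel_measurable (half_plane_measure a)"
  by (rule continuous_imp_measurable_half_plane,
      erule continuous_on_compose2[OF _ continuous_on_snd[OF continuous_on_id]]) simp

lemma L2_weighted_iff:
  "v \<in> L2_weighted a \<nu> \<mu> \<longleftrightarrow> square_integrable (half_plane_measure a) (weighted \<nu> \<mu> (\<lambda>_. 1) v)"
proof -
  have eq: "(\<lambda>(x, y). (cmod (v (x, y)))\<^sup>2 * (weight_x \<nu> x)\<^sup>2 * (weight_y \<mu> y)\<^sup>2)
      = (\<lambda>p. (cmod (weighted \<nu> \<mu> (\<lambda>_. 1) v p))\<^sup>2)"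
    by (rule ext) (simp add: cmod_weighted power_mult_distrib weight_def mult.commute split: prod.split)
  have "v \<in> borel_measurable (half_plane_measure a)"
    if m: "weighted \<nu> \<mu> (\<lambda>_. 1) v \<in> borel_measurable (half_plane_measure a)"
  proof -
    have "continuous_on UNIV (\<lambda>p. complex_of_real (inverse (weight \<nu> \<mu> p)))"
      using weight_pos by (intro continuous_intros continuous_weight) (metis less_numeral_extra(3))
    note borel_measurable_times[OF continuous_imp_measurable_half_plane[OF this] m]
    moreover have "(\<lambda>p. of_real (inverse (weight \<nu> \<mu> p)) * weighted \<nu> \<mu> (\<lambda>_. 1) v p) = v"
    proof
      fix p
      show "of_real (inverse (weight \<nu> \<mu> p)) * weighted \<nu> \<mu> (\<lambda>_. 1) v p = v p"
        using weight_pos[of \<nu> \<mu> p] by (simp add: weighted_def)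
    qed
    ultimately show ?thesis by simp
  qed
  moreover have "weighted \<nu> \<mu> (\<lambda>_. 1) v \<in> borel_measurable (half_plane_measure a)"
    if "v \<in> borel_measurable (half_plane_measure a)"
    using weighted_measurable[OF that] by simp
  ultimately have iff: "v \<in> borel_measurable (half_plane_measure a)
      \<longleftrightarrow> weighted \<nu> \<mu> (\<lambda>_. 1) v \<in> borel_measurable (half_plane_measure a)"
    by (rule iffI[rotated])
  show ?thesis
    unfolding L2_weighted_def square_integrable_def mem_Collect_eq eq iff by (rule refl)
qed

lemma L2_norm_weighted_eq:
  "L2_norm_weighted a \<nu> \<mu> v = L2_seminorm (half_plane_measure a) (weighted \<nu> \<mu> (\<lambda>_. 1) v)"
proof -
  have eq: "(\<lambda>(x, y). (cmod (v (x, y)))\<^sup>2 * (weight_x \<nu> x)\<^sup>2 * (weight_y \<mu> y)\<^sup>2)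
      = (\<lambda>p. (cmod (weighted \<nu> \<mu> (\<lambda>_. 1) v p))\<^sup>2)"
    by (rule ext) (simp add: cmod_weighted power_mult_distrib weight_def mult.commute split: prod.split)
  show ?thesis unfolding L2_norm_weighted_def L2_seminorm_def eq ..
qed

lemma weighted_sqrt_y_times:
  "weighted \<nu> \<mu> (\<lambda>_. 1) (sqrt_y_times v) = weighted \<nu> \<mu> sqrt v"
  by (auto simp: weighted_def sqrt_y_times_def fun_eq_iff split: prod.splits)

text \<open>The first three parts make up the norm of the space, as unweighted \<open>L\<^sup>2\<close> seminorms. The fourth,
  with the factor \<open>y\<^sup>3\<^sup>/\<^sup>2\<close>, is the one that has to be controlled by the Hardy inequality.\<close>
definition weighted_value where "weighted_value a \<nu> \<mu> v = weighted \<nu> \<mu> (\<lambda>_. 1) v" for a :: real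
definition weighted_x_slope where "weighted_x_slope a \<nu> \<mu> v = weighted \<nu> \<mu> sqrt (weak_Dx a v)"
definition weighted_y_slope where "weighted_y_slope a \<nu> \<mu> v = weighted \<nu> \<mu> sqrt (weak_Dy a v)"
definition weighted_moment where "weighted_moment a \<nu> \<mu> v = weighted \<nu> \<mu> (\<lambda>y. y * sqrt y) v" for a :: real

lemma V_space_iff:
  "v \<in> V_space a \<nu> \<mu> \<longleftrightarrow>
     has_weak_deriv a (1, 0) v (weak_Dx a v) \<and> has_weak_deriv a (0, 1) v (weak_Dy a v) \<and>
     square_integrable (half_plane_measure a) (weighted_value a \<nu> \<mu> v) \<and>
     square_integrable (half_plane_measure a) (weighted_x_slope a \<nu> \<mu> v) \<and>
     square_integrable (half_plane_measure a) (weighted_y_slope a \<nu> \<mu> v)"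
proof -
  have *: "(\<exists>w. has_weak_deriv a e v w) \<longleftrightarrow> has_weak_deriv a e v (weak_deriv a e v)" for e
    using weak_deriv_works by blast
  show ?thesis
    unfolding V_space_def mem_Collect_eq L2_weighted_iff weighted_sqrt_y_times
      weighted_value_def weighted_x_slope_def weighted_y_slope_def * by blast
qed

lemma V_norm_eq:
  "V_norm a \<nu> \<mu> v = sqrt ((L2_seminorm (half_plane_measure a) (weighted_value a \<nu> \<mu> v))\<^sup>2
     + (L2_seminorm (half_plane_measure a) (weighted_x_slope a \<nu> \<mu> v))\<^sup>2
     + (L2_seminorm (half_plane_measure a) (weighted_y_slope a \<nu> \<mu> v))\<^sup>2)"
  unfolding V_norm_def L2_norm_weighted_eq weighted_sqrt_y_times weighted_value_def weighted_x_slope_def weighted_y_slope_def ..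

lemma V_norm_nonneg [simp]: "V_norm a \<nu> \<mu> v \<ge> 0"
  by (simp add: V_norm_eq)

lemma parts_le_V_norm:
  "L2_seminorm (half_plane_measure a) (weighted_value a \<nu> \<mu> v) \<le> V_norm a \<nu> \<mu> v"
  "L2_seminorm (half_plane_measure a) (weighted_x_slope a \<nu> \<mu> v) \<le> V_norm a \<nu> \<mu> v"
  "L2_seminorm (half_plane_measure a) (weighted_y_slope a \<nu> \<mu> v) \<le> V_norm a \<nu> \<mu> v"
  unfolding V_norm_eq by (rule real_le_rsqrt, simp)+

lemma weak_deriv_add_AE:
  assumes "has_weak_deriv a e u (weak_deriv a e u)" "has_weak_deriv a e v (weak_deriv a e v)"
    and e: "e = (1, 0) \<or> e = (0, 1)"
  shows "AE p in half_plane_measure a. weak_deriv a e u p + weak_deriv a e v p = weak_deriv a e (\<lambda>p. u p + v p) p"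
  using weak_deriv_AE_eq[OF has_weak_deriv_add[OF assms]] by eventually_elim simp

lemma weak_deriv_scale_AE:
  assumes "has_weak_deriv a e u (weak_deriv a e u)"
  shows "AE p in half_plane_measure a. c * weak_deriv a e u p = weak_deriv a e (\<lambda>p. c * u p) p"
  using weak_deriv_AE_eq[OF has_weak_deriv_scale[OF assms, of c]] by eventually_elim simp

lemma V_space_parts_add:
  assumes u: "u \<in> V_space a \<nu> \<mu>" and v: "v \<in> V_space a \<nu> \<mu>"
  shows "AE p in half_plane_measure a. weighted_x_slope a \<nu> \<mu> u p + weighted_x_slope a \<nu> \<mu> v p = weighted_x_slope a \<nu> \<mu> (\<lambda>p. u p + v p) p"
    and "AE p in half_plane_measure a. weighted_y_slope a \<nu> \<mu> u p + weighted_y_slope a \<nu> \<mu> v p = weighted_y_slope a \<nu> \<mu> (\<lambda>p. u p + v p) p"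
    and "weighted_value a \<nu> \<mu> (\<lambda>p. u p + v p) = (\<lambda>p. weighted_value a \<nu> \<mu> u p + weighted_value a \<nu> \<mu> v p)"
    and "weighted_moment a \<nu> \<mu> (\<lambda>p. u p + v p) = (\<lambda>p. weighted_moment a \<nu> \<mu> u p + weighted_moment a \<nu> \<mu> v p)"
proof -
  note w = u[unfolded V_space_iff] v[unfolded V_space_iff]
  have wx: "AE p in half_plane_measure a. weak_Dx a u p + weak_Dx a v p = weak_Dx a (\<lambda>p. u p + v p) p"
    and wy: "AE p in half_plane_measure a. weak_Dy a u p + weak_Dy a v p = weak_Dy a (\<lambda>p. u p + v p) p"
    using w by (simp_all add: weak_deriv_add_AE)
  show "AE p in half_plane_measure a. weighted_x_slope a \<nu> \<mu> u p + weighted_x_slope a \<nu> \<mu> v p = weighted_x_slope a \<nu> \<mu> (\<lambda>p. u p + v p) p"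
    using wx by eventually_elim (simp add: weighted_x_slope_def weighted_def distrib_left[symmetric])
  show "AE p in half_plane_measure a. weighted_y_slope a \<nu> \<mu> u p + weighted_y_slope a \<nu> \<mu> v p = weighted_y_slope a \<nu> \<mu> (\<lambda>p. u p + v p) p"
    using wy by eventually_elim (simp add: weighted_y_slope_def weighted_def distrib_left[symmetric])
qed (simp_all add: weighted_value_def weighted_moment_def weighted_add)

lemma V_space_parts_scale:
  assumes u: "u \<in> V_space a \<nu> \<mu>"
  shows "AE p in half_plane_measure a. c * weighted_x_slope a \<nu> \<mu> u p = weighted_x_slope a \<nu> \<mu> (\<lambda>p. c * u p) p"
    and "AE p in half_plane_measure a. c * weighted_y_slope a \<nu> \<mu> u p = weighted_y_slope a \<nu> \<mu> (\<lambda>p. c * u p) p"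
    and "weighted_value a \<nu> \<mu> (\<lambda>p. c * u p) = (\<lambda>p. c * weighted_value a \<nu> \<mu> u p)"
    and "weighted_moment a \<nu> \<mu> (\<lambda>p. c * u p) = (\<lambda>p. c * weighted_moment a \<nu> \<mu> u p)"
proof -
  note w = u[unfolded V_space_iff]
  have wx: "AE p in half_plane_measure a. c * weak_Dx a u p = weak_Dx a (\<lambda>p. c * u p) p"
    and wy: "AE p in half_plane_measure a. c * weak_Dy a u p = weak_Dy a (\<lambda>p. c * u p) p"
    using w by (simp_all add: weak_deriv_scale_AE)
  show "AE p in half_plane_measure a. c * weighted_x_slope a \<nu> \<mu> u p = weighted_x_slope a \<nu> \<mu> (\<lambda>p. c * u p) p"
    using wx by eventually_elim (simp add: weighted_x_slope_def weighted_def flip: mult.left_commute[of c])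
  show "AE p in half_plane_measure a. c * weighted_y_slope a \<nu> \<mu> u p = weighted_y_slope a \<nu> \<mu> (\<lambda>p. c * u p) p"
    using wy by eventually_elim (simp add: weighted_y_slope_def weighted_def flip: mult.left_commute[of c])
qed (simp_all add: weighted_value_def weighted_moment_def weighted_scale)

text \<open>The norm is the Euclidean norm in three-space of the seminorms of the parts, so the triangle inequality
  follows from those for the parts and in three-space.\<close>
lemma V_space_add:
  assumes u: "u \<in> V_space a \<nu> \<mu>" and v: "v \<in> V_space a \<nu> \<mu>"
  shows "(\<lambda>p. u p + v p) \<in> V_space a \<nu> \<mu>"
    and "V_norm a \<nu> \<mu> (\<lambda>p. u p + v p) \<le> V_norm a \<nu> \<mu> u + V_norm a \<nu> \<mu> v"
proof -
  note w = u[unfolded V_space_iff] v[unfolded V_space_iff]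
  let ?M = "half_plane_measure a" and ?w = "\<lambda>p. u p + v p"
  note X = square_integrable_half_plane_cong_AE[OF square_integrable_add V_space_parts_add(1)[OF u v]]
  note Y = square_integrable_half_plane_cong_AE[OF square_integrable_add V_space_parts_add(2)[OF u v]]
  have U: "square_integrable ?M (weighted_value a \<nu> \<mu> ?w)"
    using w unfolding V_space_parts_add(3)[OF u v] by (intro square_integrable_add) simp_all
  show "?w \<in> V_space a \<nu> \<mu>"
  proof (unfold V_space_iff, intro conjI)
    show "has_weak_deriv a (1, 0) ?w (weak_Dx a ?w)" "has_weak_deriv a (0, 1) ?w (weak_Dy a ?w)"
      using weak_deriv_works[OF has_weak_deriv_add] w by blast+
  qed (rule U, (rule X(1) Y(1); use w in simp)+)
  have "L2_seminorm ?M (weighted_x_slope a \<nu> \<mu> ?w) \<le> L2_seminorm ?M (weighted_x_slope a \<nu> \<mu> u) + L2_seminorm ?M (weighted_x_slope a \<nu> \<mu> v)"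
    by (subst X(2)) (use w in \<open>simp_all add: L2_seminorm_triangle\<close>)
  moreover have "L2_seminorm ?M (weighted_y_slope a \<nu> \<mu> ?w) \<le> L2_seminorm ?M (weighted_y_slope a \<nu> \<mu> u) + L2_seminorm ?M (weighted_y_slope a \<nu> \<mu> v)"
    by (subst Y(2)) (use w in \<open>simp_all add: L2_seminorm_triangle\<close>)
  moreover have "L2_seminorm ?M (weighted_value a \<nu> \<mu> ?w) \<le> L2_seminorm ?M (weighted_value a \<nu> \<mu> u) + L2_seminorm ?M (weighted_value a \<nu> \<mu> v)"
    unfolding V_space_parts_add(3)[OF u v] using w by (intro L2_seminorm_triangle) simp_all
  moreover have eucl: "sqrt (r\<^sup>2 + s\<^sup>2 + t\<^sup>2) = norm (r, s, t)" for r s t :: real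
    by (simp add: norm_Pair add.assoc)
  ultimately have "V_norm a \<nu> \<mu> ?w \<le> sqrt
      ((L2_seminorm ?M (weighted_value a \<nu> \<mu> u) + L2_seminorm ?M (weighted_value a \<nu> \<mu> v))\<^sup>2
     + (L2_seminorm ?M (weighted_x_slope a \<nu> \<mu> u) + L2_seminorm ?M (weighted_x_slope a \<nu> \<mu> v))\<^sup>2
     + (L2_seminorm ?M (weighted_y_slope a \<nu> \<mu> u) + L2_seminorm ?M (weighted_y_slope a \<nu> \<mu> v))\<^sup>2)"
    unfolding V_norm_eq by (intro real_sqrt_le_mono add_mono power_mono) simp_all
  also have "\<dots> \<le> V_norm a \<nu> \<mu> u + V_norm a \<nu> \<mu> v"
    unfolding V_norm_eq eucl
    using norm_triangle_ineq[of
        "(L2_seminorm ?M (weighted_value a \<nu> \<mu> u), L2_seminorm ?M (weighted_x_slope a \<nu> \<mu> u), L2_seminorm ?M (weighted_y_slope a \<nu> \<mu> u))"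
        "(L2_seminorm ?M (weighted_value a \<nu> \<mu> v), L2_seminorm ?M (weighted_x_slope a \<nu> \<mu> v), L2_seminorm ?M (weighted_y_slope a \<nu> \<mu> v))"]
    by simp
  finally show "V_norm a \<nu> \<mu> ?w \<le> V_norm a \<nu> \<mu> u + V_norm a \<nu> \<mu> v" .
qed

lemma V_space_scale:
  assumes u: "u \<in> V_space a \<nu> \<mu>"
  shows "(\<lambda>p. c * u p) \<in> V_space a \<nu> \<mu>"
    and "V_norm a \<nu> \<mu> (\<lambda>p. c * u p) = cmod c * V_norm a \<nu> \<mu> u"
proof -
  note w = u[unfolded V_space_iff]
  let ?M = "half_plane_measure a" and ?w = "\<lambda>p. c * u p"
  note X = square_integrable_half_plane_cong_AE[OF square_integrable_scale V_space_parts_scale(1)[OF u]]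
  note Y = square_integrable_half_plane_cong_AE[OF square_integrable_scale V_space_parts_scale(2)[OF u]]
  have U: "square_integrable ?M (weighted_value a \<nu> \<mu> ?w)"
    using w unfolding V_space_parts_scale(3)[OF u] by (intro square_integrable_scale) simp_all
  show "?w \<in> V_space a \<nu> \<mu>"
  proof (unfold V_space_iff, intro conjI)
    show "has_weak_deriv a (1, 0) ?w (weak_Dx a ?w)" "has_weak_deriv a (0, 1) ?w (weak_Dy a ?w)"
      using weak_deriv_works[OF has_weak_deriv_scale] w by blast+
  qed (rule U, (rule X(1) Y(1); use w in simp)+)
  have "L2_seminorm ?M (weighted_x_slope a \<nu> \<mu> ?w) = cmod c * L2_seminorm ?M (weighted_x_slope a \<nu> \<mu> u)"
    by (subst X(2)) (use w in \<open>simp_all add: L2_seminorm_scale\<close>)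
  moreover have "L2_seminorm ?M (weighted_y_slope a \<nu> \<mu> ?w) = cmod c * L2_seminorm ?M (weighted_y_slope a \<nu> \<mu> u)"
    by (subst Y(2)) (use w in \<open>simp_all add: L2_seminorm_scale\<close>)
  moreover have "L2_seminorm ?M (weighted_value a \<nu> \<mu> ?w) = cmod c * L2_seminorm ?M (weighted_value a \<nu> \<mu> u)"
    unfolding V_space_parts_scale(3)[OF u] by (rule L2_seminorm_scale)
  ultimately have "V_norm a \<nu> \<mu> ?w = sqrt ((cmod c)\<^sup>2 * (V_norm a \<nu> \<mu> u)\<^sup>2)"
    unfolding V_norm_eq by (simp add: power_mult_distrib distrib_left)
  then show "V_norm a \<nu> \<mu> ?w = cmod c * V_norm a \<nu> \<mu> u"
    by (simp add: real_sqrt_mult)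
qed

lemma V_space_diff:
  assumes u: "u \<in> V_space a \<nu> \<mu>" and v: "v \<in> V_space a \<nu> \<mu>"
  shows "(\<lambda>p. u p - v p) \<in> V_space a \<nu> \<mu>"
  using V_space_add(1)[OF u V_space_scale(1)[OF v, of "-1"]] by simp

section \<open>Test functions in the weighted Sobolev space\<close>

lemma continuous_locally_integrable:
  assumes "continuous_on UNIV v"
  shows "locally_integrable a v"
  unfolding locally_integrable_def
proof (intro allI impI)
  fix K assume K: "compact K \<and> K \<subseteq> half_plane_interior a"
  have "integrable lborel (\<lambda>p. indicator K p *\<^sub>R v p)"
    using K by (intro borel_integrable_compact continuous_on_subset[OF assms]) simp_all
  then show "v absolutely_integrable_on K"
    unfolding set_integrable_def using integrable_completion borel_measurable_integrable by blast
qed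

lemma test_function_locally_integrable: "u \<in> test_functions a \<Longrightarrow> locally_integrable a u"
  by (intro continuous_locally_integrable smooth_continuous test_function_smooth)

text \<open>Integration by parts with \<open>\<nu> = \<mu> = 0\<close> and \<open>k = 0\<close>, where the weight is \<open>1\<close>, applied to the product
  of \<open>u\<close> and a test function.\<close>
lemma has_weak_deriv_test_function:
  assumes u: "u \<in> test_functions a"
  shows "has_weak_deriv a (1, 0) u (Dx u)" "has_weak_deriv a (0, 1) u (Dy u)"
proof -
  let ?M = "half_plane_measure a"
  have w: "weight 0 0 p = 1" for p
    by (simp add: weight_def weight_x_def weight_y_def)
  have "(\<integral>p. u p * Dx \<eta> p \<partial>?M) = - (\<integral>p. Dx u p * \<eta> p \<partial>?M)"
    "(\<integral>p. u p * Dy \<eta> p \<partial>?M) = - (\<integral>p. Dy u p * \<eta> p \<partial>?M)"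
    if \<eta>: "\<eta> \<in> test_functions a" for \<eta>
  proof -
    have h: "(\<lambda>p. u p * \<eta> p) \<in> test_functions a"
      by (rule test_function_mult_smooth[OF \<eta> test_function_smooth[OF u]])
    note sm = smooth_differentiable[OF test_function_smooth[OF u]]
      smooth_differentiable[OF test_function_smooth[OF \<eta>]]
    note loc = test_function_locally_integrable[OF u]
      test_function_locally_integrable[OF test_function_Dx[OF u]]
      test_function_locally_integrable[OF test_function_Dy[OF u]]
    note int = integrable_times_test_function[OF _ \<eta>]
      integrable_times_test_function[OF loc(1) test_function_Dx[OF \<eta>]]
      integrable_times_test_function[OF loc(1) test_function_Dy[OF \<eta>]]
    have "(\<integral>p. u p * Dx \<eta> p + Dx u p * \<eta> p \<partial>?M) = 0"
      using integral_divergence_x(2)[OF h, of 0 0 0] by (simp add: dir_deriv_mult sm w)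
    then show "(\<integral>p. u p * Dx \<eta> p \<partial>?M) = - (\<integral>p. Dx u p * \<eta> p \<partial>?M)"
      using int loc by (simp add: add_eq_0_iff2)
    have "(\<integral>p. u p * Dy \<eta> p + Dy u p * \<eta> p \<partial>?M) = 0"
      using integral_divergence_y(2)[OF h, of 0 0 0] by (simp add: dir_deriv_mult sm w)
    then show "(\<integral>p. u p * Dy \<eta> p \<partial>?M) = - (\<integral>p. Dy u p * \<eta> p \<partial>?M)"
      using int loc by (simp add: add_eq_0_iff2)
  qed
  then show "has_weak_deriv a (1, 0) u (Dx u)" "has_weak_deriv a (0, 1) u (Dy u)"
    using test_function_locally_integrable u test_function_Dx test_function_Dy
    by (simp_all add: has_weak_deriv_def)
qed

lemma continuous_weighted:
  assumes "continuous_on UNIV c" "continuous_on UNIV h"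
  shows "continuous_on UNIV (weighted \<nu> \<mu> c h)"
proof -
  have "continuous_on UNIV (\<lambda>p::real \<times> real. c (snd p))"
    by (rule continuous_on_compose2[OF assms(1) continuous_on_snd[OF continuous_on_id]]) simp
  then show ?thesis
    unfolding weighted_def by (intro continuous_on_mult continuous_on_of_real continuous_weight assms(2))
qed

lemma test_function_square_integrable:
  assumes h: "h \<in> test_functions a" and c: "continuous_on UNIV c"
  shows "square_integrable (half_plane_measure a) (weighted \<nu> \<mu> c h)"
proof -
  have cont: "continuous_on UNIV (weighted \<nu> \<mu> c h)"
    by (rule continuous_weighted[OF c smooth_continuous[OF test_function_smooth[OF h]]])
  have k: "continuous_on UNIV (\<lambda>p. cnj (weighted \<nu> \<mu> c h p) * weighted \<nu> \<mu> c (\<lambda>_. 1) p)"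
    by (intro continuous_on_mult continuous_on_cnj cont continuous_weighted[OF c] continuous_on_const)
  have "integrable (half_plane_measure a) (\<lambda>p. 1 * (h p * (cnj (weighted \<nu> \<mu> c h p) * weighted \<nu> \<mu> c (\<lambda>_. 1) p)))"
    by (rule integrable_test_function_times(2)[OF h k, of _ 1]) simp_all
  moreover have "(\<lambda>p. 1 * (h p * (cnj (weighted \<nu> \<mu> c h p) * weighted \<nu> \<mu> c (\<lambda>_. 1) p)))
      = (\<lambda>p. weighted \<nu> \<mu> c h p * cnj (weighted \<nu> \<mu> c h p))"
    by (rule ext) (simp add: weighted_def)
  ultimately have "integrable (half_plane_measure a) (\<lambda>p. weighted \<nu> \<mu> c h p * cnj (weighted \<nu> \<mu> c h p))"
    by (simp only:)
  from integrable_norm[OF this]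
  have "integrable (half_plane_measure a) (\<lambda>p. (cmod (weighted \<nu> \<mu> c h p))\<^sup>2)"
    by (simp add: norm_mult power2_eq_square)
  then show ?thesis
    using continuous_imp_measurable_half_plane[OF cont] by (simp add: square_integrable_def)
qed

lemma test_function_parts:
  assumes u: "u \<in> test_functions a"
  shows "AE p in half_plane_measure a. weighted \<nu> \<mu> sqrt (Dx u) p = weighted_x_slope a \<nu> \<mu> u p"
    and "AE p in half_plane_measure a. weighted \<nu> \<mu> sqrt (Dy u) p = weighted_y_slope a \<nu> \<mu> u p"
proof -
  show "AE p in half_plane_measure a. weighted \<nu> \<mu> sqrt (Dx u) p = weighted_x_slope a \<nu> \<mu> u p"
    using weak_deriv_AE_eq[OF has_weak_deriv_test_function(1)[OF u]]
    by eventually_elim (simp add: weighted_x_slope_def weighted_def)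
  show "AE p in half_plane_measure a. weighted \<nu> \<mu> sqrt (Dy u) p = weighted_y_slope a \<nu> \<mu> u p"
    using weak_deriv_AE_eq[OF has_weak_deriv_test_function(2)[OF u]]
    by eventually_elim (simp add: weighted_y_slope_def weighted_def)
qed

lemma continuous_on_y_sqrt_y: "continuous_on UNIV (\<lambda>y::real. y * sqrt y)"
  by (intro continuous_intros)

lemma test_function_V_space:
  assumes u: "u \<in> test_functions a"
  shows "u \<in> V_space a \<nu> \<mu>"
proof -
  have cs: "continuous_on UNIV sqrt" "continuous_on UNIV (\<lambda>_::real. 1::real)"
    by (intro continuous_intros)+
  note X = test_function_square_integrable[OF test_function_Dx[OF u] cs(1), of \<nu> \<mu>]
  note Y = test_function_square_integrable[OF test_function_Dy[OF u] cs(1), of \<nu> \<mu>]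
  show ?thesis
    unfolding V_space_iff
    using weak_deriv_works[OF has_weak_deriv_test_function(1)[OF u]]
      weak_deriv_works[OF has_weak_deriv_test_function(2)[OF u]]
      test_function_square_integrable[OF u cs(2), of \<nu> \<mu>]
      square_integrable_half_plane_cong_AE(1)[OF X test_function_parts(1)[OF u]]
      square_integrable_half_plane_cong_AE(1)[OF Y test_function_parts(2)[OF u]]
    by (simp add: weighted_value_def)
qed

lemma V0_spaceI:
  assumes "v \<in> V_space a \<nu> \<mu>"
    and "\<And>\<epsilon>. \<epsilon> > 0 \<Longrightarrow> \<exists>w\<in>test_functions a. V_norm a \<nu> \<mu> (\<lambda>p. v p - w p) < \<epsilon>"
  shows "v \<in> V0_space a \<nu> \<mu>"
  using assms by (simp add: V0_space_def)

lemma V0_space_V_space: "v \<in> V0_space a \<nu> \<mu> \<Longrightarrow> v \<in> V_space a \<nu> \<mu>"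
  by (simp add: V0_space_def)

lemma V0_space_approx:
  assumes "v \<in> V0_space a \<nu> \<mu>" "\<epsilon> > 0"
  obtains w where "w \<in> test_functions a" "V_norm a \<nu> \<mu> (\<lambda>p. v p - w p) < \<epsilon>"
  using assms unfolding V0_space_def by blast

lemma V0_space_add:
  assumes u: "u \<in> V0_space a \<nu> \<mu>" and v: "v \<in> V0_space a \<nu> \<mu>"
  shows "(\<lambda>p. u p + v p) \<in> V0_space a \<nu> \<mu>"
proof (rule V0_spaceI)
  note V = V0_space_V_space[OF u] V0_space_V_space[OF v]
  show "(\<lambda>p. u p + v p) \<in> V_space a \<nu> \<mu>" by (rule V_space_add(1)[OF V])
  fix \<epsilon> :: real assume "\<epsilon> > 0"
  then have e: "\<epsilon> / 2 > 0" by simp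
  obtain w where w: "w \<in> test_functions a" "V_norm a \<nu> \<mu> (\<lambda>p. u p - w p) < \<epsilon> / 2"
    by (rule V0_space_approx[OF u e])
  obtain w' where w': "w' \<in> test_functions a" "V_norm a \<nu> \<mu> (\<lambda>p. v p - w' p) < \<epsilon> / 2"
    by (rule V0_space_approx[OF v e])
  have "V_norm a \<nu> \<mu> (\<lambda>p. (u p - w p) + (v p - w' p)) < \<epsilon>"
    using V_space_add(2)[OF V_space_diff[OF V(1) test_function_V_space[OF w(1)]]
        V_space_diff[OF V(2) test_function_V_space[OF w'(1)]]] w(2) w'(2) by linarith
  moreover have "(\<lambda>p. (u p - w p) + (v p - w' p)) = (\<lambda>p. (u p + v p) - (w p + w' p))"
    by (simp add: algebra_simps)
  ultimately show "\<exists>w\<in>test_functions a. V_norm a \<nu> \<mu> (\<lambda>p. u p + v p - w p) < \<epsilon>"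
    using test_function_add[OF w(1) w'(1)] by auto
qed

lemma V0_space_scale:
  assumes u: "u \<in> V0_space a \<nu> \<mu>"
  shows "(\<lambda>p. c * u p) \<in> V0_space a \<nu> \<mu>"
proof (rule V0_spaceI)
  note V = V0_space_V_space[OF u]
  show "(\<lambda>p. c * u p) \<in> V_space a \<nu> \<mu>" by (rule V_space_scale(1)[OF V])
  fix \<epsilon> :: real assume "\<epsilon> > 0"
  then have e: "\<epsilon> / (cmod c + 1) > 0" by (simp add: add_nonneg_pos)
  obtain w where w: "w \<in> test_functions a" "V_norm a \<nu> \<mu> (\<lambda>p. u p - w p) < \<epsilon> / (cmod c + 1)"
    by (rule V0_space_approx[OF u e])
  have "V_norm a \<nu> \<mu> (\<lambda>p. c * (u p - w p)) = cmod c * V_norm a \<nu> \<mu> (\<lambda>p. u p - w p)"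
    by (rule V_space_scale(2)[OF V_space_diff[OF V test_function_V_space[OF w(1)]]])
  also have "\<dots> \<le> (cmod c + 1) * V_norm a \<nu> \<mu> (\<lambda>p. u p - w p)"
    by (intro mult_right_mono) simp_all
  also have "\<dots> < \<epsilon>"
    using w(2) by (simp add: pos_less_divide_eq add_nonneg_pos mult.commute)
  finally have "V_norm a \<nu> \<mu> (\<lambda>p. c * u p - c * w p) < \<epsilon>"
    by (simp add: right_diff_distrib)
  then show "\<exists>w\<in>test_functions a. V_norm a \<nu> \<mu> (\<lambda>p. c * u p - w p) < \<epsilon>"
    using test_function_scale[OF w(1), of c] by (intro bexI[of _ "\<lambda>p. c * w p"])
qed

lemma V0_space_diff:
  assumes u: "u \<in> V0_space a \<nu> \<mu>" and v: "v \<in> V0_space a \<nu> \<mu>"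
  shows "(\<lambda>p. u p - v p) \<in> V0_space a \<nu> \<mu>"
  using V0_space_add[OF u V0_space_scale[OF v, of "-1"]] by simp

section \<open>A Hardy-type inequality\<close>

text \<open>Integrate \<open>\<partial>\<^sub>y(y\<^sup>2 \<bar>w\<bar>\<^sup>2 \<phi>\<^sup>2 \<psi>\<^sup>2)\<close>. The derivative of the Gaussian weight contributes
  \<open>2 \<mu> y\<^sup>3 \<bar>w\<bar>\<^sup>2\<close>, the derivative of \<open>y\<^sup>2\<close> a nonnegative term that can be dropped, and the derivative of
  \<open>\<bar>w\<bar>\<^sup>2\<close> at least \<open>-2 y\<^sup>2 \<bar>w\<bar> \<bar>w\<^sub>y\<bar>\<close>, whose integral is estimated by the Cauchy-Schwarz inequality after
  splitting \<open>y\<^sup>2 = y\<^sup>3\<^sup>/\<^sup>2 y\<^sup>1\<^sup>/\<^sup>2\<close>.\<close>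

lemma test_function_Hardy:
  assumes w: "w \<in> test_functions a" and "a > 0" "\<mu> > 0"
  shows "\<mu> * L2_seminorm (half_plane_measure a) (weighted_moment a \<nu> \<mu> w)
    \<le> L2_seminorm (half_plane_measure a) (weighted \<nu> \<mu> sqrt (Dy w))"
proof -
  let ?M = "half_plane_measure a"
  let ?Z = "weighted_moment a \<nu> \<mu> w" and ?Y = "weighted \<nu> \<mu> sqrt (Dy w)"
  have Z: "square_integrable ?M ?Z"
    unfolding weighted_moment_def by (rule test_function_square_integrable[OF w continuous_on_y_sqrt_y])
  have "continuous_on UNIV sqrt" by (intro continuous_intros)
  then have Y: "square_integrable ?M ?Y"
    by (rule test_function_square_integrable[OF test_function_Dy[OF w]])
  define h where "h = (\<lambda>p. w p * cnj (w p))"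
  have h: "h \<in> test_functions a"
    unfolding h_def by (rule test_function_mult_smooth[OF test_function_cnj[OF w] test_function_smooth[OF w]])
  have sm: "w differentiable (at p)" "(\<lambda>p. cnj (w p)) differentiable (at p)" for p
    using smooth_differentiable[OF test_function_smooth[OF w]]
      smooth_differentiable[OF test_function_smooth[OF test_function_cnj[OF w]]] by simp_all
  have Dyh: "Dy h p = w p * cnj (Dy w p) + Dy w p * cnj (w p)" for p
    unfolding h_def by (simp add: dir_deriv_mult[OF sm] dir_deriv_cnj[OF sm(1)])
  define G where "G = (\<lambda>p. (Dy h p * of_real (snd p ^ 2)
      + h p * of_real (real 2 * snd p ^ (2 - 1) + 2 * \<mu> * snd p ^ Suc 2)) * of_real ((weight \<nu> \<mu> p)\<^sup>2))"
  have G: "integrable ?M G" "(\<integral>p. G p \<partial>?M) = 0"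
    unfolding G_def by (rule integral_divergence_y[OF h])+
  have "(\<integral>p. 2 * \<mu> * (cmod (?Z p))\<^sup>2 - 2 * (cmod (?Z p) * cmod (?Y p)) \<partial>?M) \<le> (\<integral>p. Re (G p) \<partial>?M)"
  proof (rule integral_mono)
    show "integrable ?M (\<lambda>p. 2 * \<mu> * (cmod (?Z p))\<^sup>2 - 2 * (cmod (?Z p) * cmod (?Y p)))"
      using Z integrable_cmod_mult[OF Z Y] by (simp add: square_integrable_def)
    show "integrable ?M (\<lambda>p. Re (G p))" using G(1) by simp
    fix p assume "p \<in> space ?M"
    then have y: "snd p > 0" using \<open>a > 0\<close> by (auto simp: half_plane_def)
    define y W where "y = snd p" and "W = weight \<nu> \<mu> p"
    have yp: "y > 0" using y by (simp add: y_def)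
    have W: "W > 0" by (simp add: W_def weight_pos)
    have Zp: "cmod (?Z p) = y * sqrt y * W * cmod (w p)" and Yp: "cmod (?Y p) = sqrt y * W * cmod (Dy w p)"
      using yp by (simp_all add: weighted_moment_def cmod_weighted y_def W_def abs_mult)
    have ss: "sqrt y * sqrt y = y" using yp by simp
    have Z2: "(cmod (?Z p))\<^sup>2 = y ^ 3 * W\<^sup>2 * (cmod (w p))\<^sup>2"
      unfolding Zp using yp by (simp add: power_mult_distrib power2_eq_square power3_eq_cube)
    have ZY: "cmod (?Z p) * cmod (?Y p) = y\<^sup>2 * W\<^sup>2 * (cmod (w p) * cmod (Dy w p))"
      unfolding Zp Yp using ss by (simp add: power2_eq_square algebra_simps)
    have ReG: "Re (G p) = (2 * Re (w p * cnj (Dy w p)) * y\<^sup>2 + (cmod (w p))\<^sup>2 * (2 * y + 2 * \<mu> * y ^ 3)) * W\<^sup>2"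
    proof -
      have "Re (h p) = (cmod (w p))\<^sup>2"
        by (simp add: h_def complex_mult_cnj cmod_power2)
      moreover have "Re (Dy h p) = 2 * Re (w p * cnj (Dy w p))"
        by (simp add: Dyh)
      moreover have "Re (z * of_real t) = Re z * t" for z t by simp
      moreover have "G p = (Dy h p * of_real (y\<^sup>2) + h p * of_real (2 * y + 2 * \<mu> * y ^ 3)) * of_real (W\<^sup>2)"
        by (simp add: G_def y_def W_def eval_nat_numeral)
      ultimately show ?thesis by (simp only: plus_complex.sel)
    qed
    have "- (cmod (w p) * cmod (Dy w p)) \<le> Re (w p * cnj (Dy w p))"
      using abs_Re_le_cmod[of "w p * cnj (Dy w p)"] by (simp only: norm_mult complex_mod_cnj)
    then have "2 * (- (cmod (w p) * cmod (Dy w p))) * y\<^sup>2 + (cmod (w p))\<^sup>2 * (0 + 2 * \<mu> * y ^ 3)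
        \<le> 2 * Re (w p * cnj (Dy w p)) * y\<^sup>2 + (cmod (w p))\<^sup>2 * (2 * y + 2 * \<mu> * y ^ 3)"
      using yp by (intro add_mono mult_right_mono mult_left_mono) simp_all
    then have "(2 * (- (cmod (w p) * cmod (Dy w p))) * y\<^sup>2 + (cmod (w p))\<^sup>2 * (0 + 2 * \<mu> * y ^ 3)) * W\<^sup>2
        \<le> Re (G p)"
      unfolding ReG by (rule mult_right_mono) simp
    then show "2 * \<mu> * (cmod (?Z p))\<^sup>2 - 2 * (cmod (?Z p) * cmod (?Y p)) \<le> Re (G p)"
      unfolding Z2 ZY by (simp add: algebra_simps)
  qed
  also have "\<dots> = 0" using G by simp
  finally have "2 * \<mu> * (L2_seminorm ?M ?Z)\<^sup>2 - 2 * (\<integral>p. cmod (?Z p) * cmod (?Y p) \<partial>?M) \<le> 0"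
    using Z integrable_cmod_mult[OF Z Y] by (simp add: square_integrable_def L2_seminorm_power2)
  then have "\<mu> * (L2_seminorm ?M ?Z)\<^sup>2 \<le> L2_seminorm ?M ?Z * L2_seminorm ?M ?Y"
    using L2_Cauchy_Schwarz_cmod[OF Z Y] by linarith
  then have "L2_seminorm ?M ?Z * (\<mu> * L2_seminorm ?M ?Z) \<le> L2_seminorm ?M ?Z * L2_seminorm ?M ?Y"
    by (simp add: power2_eq_square algebra_simps)
  then show ?thesis
    by (cases "L2_seminorm ?M ?Z = 0") (simp_all add: mult_le_cancel_left order_less_le)
qed

text \<open>Convergence in norm does not control \<open>y\<^sup>3\<^sup>/\<^sup>2 v\<close> a priori. Below a height \<open>n\<close> it does, since
  \<open>y\<^sup>3\<^sup>/\<^sup>2 \<le> n\<^sup>3\<^sup>/\<^sup>2\<close> there; so the inequality passes from test functions to \<open>v\<close> with the factor cut off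
  above \<open>n\<close>, with a constant that does not depend on \<open>n\<close>, and then \<open>n\<close> tends to infinity.\<close>
lemma V0_space_Hardy:
  assumes v: "v \<in> V0_space a \<nu> \<mu>" and "a > 0" "\<mu> > 0"
  shows "square_integrable (half_plane_measure a) (weighted_moment a \<nu> \<mu> v)"
    and "\<mu> * L2_seminorm (half_plane_measure a) (weighted_moment a \<nu> \<mu> v)
      \<le> L2_seminorm (half_plane_measure a) (weighted_y_slope a \<nu> \<mu> v)"
proof -
  let ?M = "half_plane_measure a"
  define c :: "nat \<Rightarrow> real \<Rightarrow> real" where "c n y = (if y \<le> real n then y * sqrt y else 0)" for n y
  have "(\<lambda>p::real \<times> real. snd p) \<in> borel_measurable ?M"
    by (intro continuous_imp_measurable_half_plane continuous_intros)
  moreover have "c n \<in> borel_measurable borel" for n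
    unfolding c_def by measurable
  ultimately have cm: "(\<lambda>p::real \<times> real. c n (snd p)) \<in> borel_measurable ?M" for n
    by (rule measurable_compose)
  have Vv: "v \<in> V_space a \<nu> \<mu>" by (rule V0_space_V_space[OF v])
  have vL2: "v \<in> L2_weighted a \<nu> \<mu>"
    using Vv by (simp add: V_space_def)
  then have vm: "v \<in> borel_measurable ?M" by (simp add: L2_weighted_def)
  have pos: "snd p > 0" if "p \<in> space ?M" for p
    using that \<open>a > 0\<close> by (auto simp: half_plane_def)
  have trunc_U: "square_integrable ?M (weighted \<nu> \<mu> (c n) u)"
    "L2_seminorm ?M (weighted \<nu> \<mu> (c n) u) \<le> (real n * sqrt (real n)) * L2_seminorm ?M (weighted_value a \<nu> \<mu> u)"
    if u: "u \<in> V_space a \<nu> \<mu>" for n u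
  proof -
    have U: "square_integrable ?M (weighted_value a \<nu> \<mu> u)" using u by (simp add: V_space_iff)
    have m: "weighted \<nu> \<mu> (c n) u \<in> borel_measurable ?M"
      using u by (intro weighted_measurable cm) (simp add: V_space_def L2_weighted_def)
    have le: "AE p in ?M. cmod (weighted \<nu> \<mu> (c n) u p) \<le> (real n * sqrt (real n)) * cmod (weighted_value a \<nu> \<mu> u p)"
    proof (rule AE_I2)
      fix p assume "p \<in> space ?M"
      then have "\<bar>c n (snd p)\<bar> \<le> real n * sqrt (real n)"
        using pos[of p] by (auto simp: c_def abs_mult intro!: mult_mono)
      then have "\<bar>c n (snd p)\<bar> * (weight \<nu> \<mu> p * cmod (u p)) \<le> (real n * sqrt (real n)) * (weight \<nu> \<mu> p * cmod (u p))"
        using weight_pos[of \<nu> \<mu> p] by (intro mult_right_mono) simp_all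
      then show "cmod (weighted \<nu> \<mu> (c n) u p) \<le> (real n * sqrt (real n)) * cmod (weighted_value a \<nu> \<mu> u p)"
        by (simp add: cmod_weighted weighted_value_def mult.assoc)
    qed
    show "square_integrable ?M (weighted \<nu> \<mu> (c n) u)"
      by (rule square_integrable_bound[OF U m le])
    show "L2_seminorm ?M (weighted \<nu> \<mu> (c n) u) \<le> (real n * sqrt (real n)) * L2_seminorm ?M (weighted_value a \<nu> \<mu> u)"
      by (rule L2_seminorm_bound[OF U m _ le]) simp
  qed
  have key: "\<mu> * L2_seminorm ?M (weighted \<nu> \<mu> (c n) v) \<le> L2_seminorm ?M (weighted_y_slope a \<nu> \<mu> v)" for n
  proof (rule field_le_epsilon)
    fix e :: real assume "e > 0"
    \<comment> \<open>\<open>K\<close> times the distance of \<open>w\<close> from \<open>v\<close> bounds the error: \<open>\<mu> n\<^sup>3\<^sup>/\<^sup>2\<close> for the cut-off part of \<open>v - w\<close>, and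
      \<open>1\<close> for replacing the \<open>y\<close>-slope of \<open>w\<close> by that of \<open>v\<close>.\<close>
    define K where "K = \<mu> * (real n * sqrt (real n)) + 1"
    have K: "K > 0" using \<open>\<mu> > 0\<close> by (simp add: K_def add_nonneg_pos)
    obtain w where w: "w \<in> test_functions a" and small: "V_norm a \<nu> \<mu> (\<lambda>p. v p - w p) < e / K"
      by (rule V0_space_approx[OF v divide_pos_pos[OF \<open>e > 0\<close> K]])
    let ?d = "\<lambda>p. v p - w p"
    have Vw: "w \<in> V_space a \<nu> \<mu>" by (rule test_function_V_space[OF w])
    have Vd: "?d \<in> V_space a \<nu> \<mu>" by (rule V_space_diff[OF Vv Vw])
    have "L2_seminorm ?M (weighted \<nu> \<mu> (c n) (\<lambda>p. ?d p + w p))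
        \<le> L2_seminorm ?M (weighted \<nu> \<mu> (c n) ?d) + L2_seminorm ?M (weighted \<nu> \<mu> (c n) w)"
      unfolding weighted_add by (intro L2_seminorm_triangle trunc_U(1) Vd Vw)
    then have 1: "L2_seminorm ?M (weighted \<nu> \<mu> (c n) v)
        \<le> L2_seminorm ?M (weighted \<nu> \<mu> (c n) ?d) + L2_seminorm ?M (weighted \<nu> \<mu> (c n) w)" by simp
    have 2: "L2_seminorm ?M (weighted \<nu> \<mu> (c n) ?d) \<le> (real n * sqrt (real n)) * V_norm a \<nu> \<mu> ?d"
      using trunc_U(2)[OF Vd, of n] parts_le_V_norm(1)[of a \<nu> \<mu> ?d]
      by (meson mult_left_mono mult_nonneg_nonneg of_nat_0_le_iff order_trans real_sqrt_ge_zero)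
    have 3: "L2_seminorm ?M (weighted \<nu> \<mu> (c n) w) \<le> 1 * L2_seminorm ?M (weighted_moment a \<nu> \<mu> w)"
    proof (rule L2_seminorm_bound)
      show "square_integrable ?M (weighted_moment a \<nu> \<mu> w)"
        unfolding weighted_moment_def by (rule test_function_square_integrable[OF w continuous_on_y_sqrt_y])
      show "weighted \<nu> \<mu> (c n) w \<in> borel_measurable ?M"
        using trunc_U(1)[OF Vw] by (simp add: square_integrable_def)
      show "AE p in ?M. cmod (weighted \<nu> \<mu> (c n) w p) \<le> 1 * cmod (weighted_moment a \<nu> \<mu> w p)"
        using weight_pos[of \<nu> \<mu>] by (intro AE_I2) (simp add: cmod_weighted weighted_moment_def c_def)
    qed simp
    have 4: "\<mu> * L2_seminorm ?M (weighted_moment a \<nu> \<mu> w) \<le> L2_seminorm ?M (weighted_y_slope a \<nu> \<mu> w)"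
    proof -
      have "continuous_on UNIV sqrt" by (intro continuous_intros)
      from square_integrable_half_plane_cong_AE(2)[OF
          test_function_square_integrable[OF test_function_Dy[OF w] this] test_function_parts(2)[OF w]]
      show ?thesis using test_function_Hardy[OF w \<open>a > 0\<close> \<open>\<mu> > 0\<close>, of \<nu>] by simp
    qed
    have 5: "L2_seminorm ?M (weighted_y_slope a \<nu> \<mu> w) \<le> L2_seminorm ?M (weighted_y_slope a \<nu> \<mu> v) + V_norm a \<nu> \<mu> ?d"
    proof -
      have m: "(\<lambda>p. (-1) * ?d p) \<in> V_space a \<nu> \<mu>"
        "V_norm a \<nu> \<mu> (\<lambda>p. (-1) * ?d p) = V_norm a \<nu> \<mu> ?d"
        using V_space_scale[OF Vd, of "-1"] by simp_all
      have sq: "square_integrable ?M (weighted_y_slope a \<nu> \<mu> v)" "square_integrable ?M (weighted_y_slope a \<nu> \<mu> (\<lambda>p. (-1) * ?d p))"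
        using Vv m(1) unfolding V_space_iff by blast+
      have "L2_seminorm ?M (weighted_y_slope a \<nu> \<mu> (\<lambda>p. v p + (-1) * ?d p))
          = L2_seminorm ?M (\<lambda>p. weighted_y_slope a \<nu> \<mu> v p + weighted_y_slope a \<nu> \<mu> (\<lambda>p. (-1) * ?d p) p)"
        by (rule square_integrable_half_plane_cong_AE(2)[OF square_integrable_add[OF sq] V_space_parts_add(2)[OF Vv m(1)]])
      also have "\<dots> \<le> L2_seminorm ?M (weighted_y_slope a \<nu> \<mu> v) + L2_seminorm ?M (weighted_y_slope a \<nu> \<mu> (\<lambda>p. (-1) * ?d p))"
        by (rule L2_seminorm_triangle[OF sq])
      also have "\<dots> \<le> L2_seminorm ?M (weighted_y_slope a \<nu> \<mu> v) + V_norm a \<nu> \<mu> ?d"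
        using parts_le_V_norm(3)[of a \<nu> \<mu> "\<lambda>p. (-1) * ?d p"] m(2) by simp
      finally show ?thesis by simp
    qed
    have "\<mu> * L2_seminorm ?M (weighted \<nu> \<mu> (c n) v)
        \<le> \<mu> * ((real n * sqrt (real n)) * V_norm a \<nu> \<mu> ?d + L2_seminorm ?M (weighted_moment a \<nu> \<mu> w))"
      using 1 2 3 \<open>\<mu> > 0\<close> by (intro mult_left_mono) linarith+
    also have "\<dots> \<le> \<mu> * ((real n * sqrt (real n)) * V_norm a \<nu> \<mu> ?d)
        + (L2_seminorm ?M (weighted_y_slope a \<nu> \<mu> v) + V_norm a \<nu> \<mu> ?d)"
      using 4 5 by (simp add: distrib_left)
    also have "\<dots> = L2_seminorm ?M (weighted_y_slope a \<nu> \<mu> v) + K * V_norm a \<nu> \<mu> ?d"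
      by (simp add: K_def algebra_simps)
    also have "\<dots> \<le> L2_seminorm ?M (weighted_y_slope a \<nu> \<mu> v) + e"
      using small K by (simp add: pos_less_divide_eq mult.commute less_imp_le)
    finally show "\<mu> * L2_seminorm ?M (weighted \<nu> \<mu> (c n) v) \<le> L2_seminorm ?M (weighted_y_slope a \<nu> \<mu> v) + e" .
  qed
  have Zm: "weighted_moment a \<nu> \<mu> v \<in> borel_measurable ?M"
    unfolding weighted_moment_def
    by (rule weighted_measurable[OF vm measurable_half_plane_snd[OF continuous_on_y_sqrt_y]])
  have mono: "cmod (weighted \<nu> \<mu> (c m) v p) \<le> cmod (weighted \<nu> \<mu> (c n) v p)"
    if "p \<in> space ?M" "m \<le> n" for p m n
  proof -
    have "\<bar>c m (snd p)\<bar> \<le> \<bar>c n (snd p)\<bar>"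
      using that(2) by (auto simp: c_def)
    then show ?thesis
      unfolding cmod_weighted using weight_pos[of \<nu> \<mu> p] by (intro mult_right_mono) simp_all
  qed
  have lim: "(\<lambda>n. weighted \<nu> \<mu> (c n) v p) \<longlonglongrightarrow> weighted_moment a \<nu> \<mu> v p" for p
  proof (rule tendsto_eventually)
    obtain N :: nat where "snd p \<le> real N" using real_arch_simple by blast
    then show "\<forall>\<^sub>F n in sequentially. weighted \<nu> \<mu> (c n) v p = weighted_moment a \<nu> \<mu> v p"
      by (intro eventually_sequentiallyI[of N]) (auto simp: weighted_def weighted_moment_def c_def)
  qed
  have bound: "L2_seminorm ?M (weighted \<nu> \<mu> (c n) v) \<le> L2_seminorm ?M (weighted_y_slope a \<nu> \<mu> v) / \<mu>" for n
    using key[of n] \<open>\<mu> > 0\<close> by (simp add: pos_le_divide_eq mult.commute)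
  note lim' = square_integrable_monotone_limit[OF trunc_U(1)[OF Vv] Zm mono lim bound]
  show "square_integrable ?M (weighted_moment a \<nu> \<mu> v)" by (rule lim'(1)) simp_all
  have "L2_seminorm ?M (weighted_moment a \<nu> \<mu> v) \<le> L2_seminorm ?M (weighted_y_slope a \<nu> \<mu> v) / \<mu>"
    by (rule lim'(2)) simp_all
  then show "\<mu> * L2_seminorm ?M (weighted_moment a \<nu> \<mu> v) \<le> L2_seminorm ?M (weighted_y_slope a \<nu> \<mu> v)"
    using \<open>\<mu> > 0\<close> by (simp add: pos_le_divide_eq mult.commute)
qed

section \<open>Bounded sesquilinear forms from pairings\<close>

text \<open>Bounded linear operators into \<open>L\<^sup>2\<close>, with linearity only up to null sets because this is all
  that holds for representatives of weak derivatives.\<close>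

definition V0_operator where
  "V0_operator a \<nu> \<mu> T \<longleftrightarrow>
     (\<forall>u\<in>V0_space a \<nu> \<mu>. square_integrable (half_plane_measure a) (T u)) \<and>
     (\<exists>C\<ge>0. \<forall>u\<in>V0_space a \<nu> \<mu>. L2_seminorm (half_plane_measure a) (T u) \<le> C * V_norm a \<nu> \<mu> u) \<and>
     (\<forall>u\<in>V0_space a \<nu> \<mu>. \<forall>v\<in>V0_space a \<nu> \<mu>.
        AE p in half_plane_measure a. T (\<lambda>p. u p + v p) p = T u p + T v p) \<and>
     (\<forall>c. \<forall>u\<in>V0_space a \<nu> \<mu>. AE p in half_plane_measure a. T (\<lambda>p. c * u p) p = c * T u p) \<and>
     (\<forall>u\<in>V0_space a \<nu> \<mu>. \<forall>v\<in>V0_space a \<nu> \<mu>.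
        (AE p in half_plane_measure a. u p = v p) \<longrightarrow> (AE p in half_plane_measure a. T u p = T v p))"

lemma V0_operatorD:
  assumes "V0_operator a \<nu> \<mu> T"
  shows "u \<in> V0_space a \<nu> \<mu> \<Longrightarrow> square_integrable (half_plane_measure a) (T u)"
    and "u \<in> V0_space a \<nu> \<mu> \<Longrightarrow> v \<in> V0_space a \<nu> \<mu> \<Longrightarrow>
        AE p in half_plane_measure a. T (\<lambda>p. u p + v p) p = T u p + T v p"
    and "u \<in> V0_space a \<nu> \<mu> \<Longrightarrow> AE p in half_plane_measure a. T (\<lambda>p. c * u p) p = c * T u p"
    and "u \<in> V0_space a \<nu> \<mu> \<Longrightarrow> v \<in> V0_space a \<nu> \<mu> \<Longrightarrow>
        AE p in half_plane_measure a. u p = v p \<Longrightarrow> AE p in half_plane_measure a. T u p = T v p"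
  using assms by (simp_all add: V0_operator_def)

lemma V0_operator_bound:
  assumes "V0_operator a \<nu> \<mu> T"
  obtains C where "C \<ge> 0"
    "\<And>u. u \<in> V0_space a \<nu> \<mu> \<Longrightarrow> L2_seminorm (half_plane_measure a) (T u) \<le> C * V_norm a \<nu> \<mu> u"
  using assms unfolding V0_operator_def by blast

lemma AE_sym: "AE p in M. f p = g p \<Longrightarrow> AE p in M. g p = f p"
  by (erule eventually_mono) simp

lemma V0_operator_X: "V0_operator a \<nu> \<mu> (weighted_x_slope a \<nu> \<mu>)"
  unfolding V0_operator_def
proof (intro conjI ballI allI impI exI[of _ 1])
  fix u v assume u: "u \<in> V0_space a \<nu> \<mu>" and v: "v \<in> V0_space a \<nu> \<mu>"
  note V = V0_space_V_space[OF u] V0_space_V_space[OF v]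
  show "AE p in half_plane_measure a. weighted_x_slope a \<nu> \<mu> (\<lambda>p. u p + v p) p = weighted_x_slope a \<nu> \<mu> u p + weighted_x_slope a \<nu> \<mu> v p"
    by (rule AE_sym[OF V_space_parts_add(1)[OF V]])
  show "AE p in half_plane_measure a. weighted_x_slope a \<nu> \<mu> u p = weighted_x_slope a \<nu> \<mu> v p"
    if "AE p in half_plane_measure a. u p = v p"
    using weak_deriv_cong_AE[OF that, of "(1, 0)"] by (simp add: weighted_x_slope_def)
next
  fix c u assume u: "u \<in> V0_space a \<nu> \<mu>"
  show "AE p in half_plane_measure a. weighted_x_slope a \<nu> \<mu> (\<lambda>p. c * u p) p = c * weighted_x_slope a \<nu> \<mu> u p"
    by (rule AE_sym[OF V_space_parts_scale(1)[OF V0_space_V_space[OF u]]])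
  show "square_integrable (half_plane_measure a) (weighted_x_slope a \<nu> \<mu> u)"
    using V0_space_V_space[OF u] by (simp add: V_space_iff)
  show "L2_seminorm (half_plane_measure a) (weighted_x_slope a \<nu> \<mu> u) \<le> 1 * V_norm a \<nu> \<mu> u"
    using parts_le_V_norm(2) by simp
qed simp

lemma V0_operator_Y: "V0_operator a \<nu> \<mu> (weighted_y_slope a \<nu> \<mu>)"
  unfolding V0_operator_def
proof (intro conjI ballI allI impI exI[of _ 1])
  fix u v assume u: "u \<in> V0_space a \<nu> \<mu>" and v: "v \<in> V0_space a \<nu> \<mu>"
  note V = V0_space_V_space[OF u] V0_space_V_space[OF v]
  show "AE p in half_plane_measure a. weighted_y_slope a \<nu> \<mu> (\<lambda>p. u p + v p) p = weighted_y_slope a \<nu> \<mu> u p + weighted_y_slope a \<nu> \<mu> v p"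
    by (rule AE_sym[OF V_space_parts_add(2)[OF V]])
  show "AE p in half_plane_measure a. weighted_y_slope a \<nu> \<mu> u p = weighted_y_slope a \<nu> \<mu> v p"
    if "AE p in half_plane_measure a. u p = v p"
    using weak_deriv_cong_AE[OF that, of "(0, 1)"] by (simp add: weighted_y_slope_def)
next
  fix c u assume u: "u \<in> V0_space a \<nu> \<mu>"
  show "AE p in half_plane_measure a. weighted_y_slope a \<nu> \<mu> (\<lambda>p. c * u p) p = c * weighted_y_slope a \<nu> \<mu> u p"
    by (rule AE_sym[OF V_space_parts_scale(2)[OF V0_space_V_space[OF u]]])
  show "square_integrable (half_plane_measure a) (weighted_y_slope a \<nu> \<mu> u)"
    using V0_space_V_space[OF u] by (simp add: V_space_iff)
  show "L2_seminorm (half_plane_measure a) (weighted_y_slope a \<nu> \<mu> u) \<le> 1 * V_norm a \<nu> \<mu> u"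
    using parts_le_V_norm(3) by simp
qed simp

lemma V0_operator_Z:
  assumes "a > 0" "\<mu> > 0"
  shows "V0_operator a \<nu> \<mu> (weighted_moment a \<nu> \<mu>)"
  unfolding V0_operator_def
proof (intro conjI ballI allI impI exI[of _ "1 / \<mu>"])
  fix u v assume u: "u \<in> V0_space a \<nu> \<mu>" and v: "v \<in> V0_space a \<nu> \<mu>"
  note V = V0_space_V_space[OF u] V0_space_V_space[OF v]
  show "AE p in half_plane_measure a. weighted_moment a \<nu> \<mu> (\<lambda>p. u p + v p) p = weighted_moment a \<nu> \<mu> u p + weighted_moment a \<nu> \<mu> v p"
    unfolding V_space_parts_add(4)[OF V] by simp
  show "AE p in half_plane_measure a. weighted_moment a \<nu> \<mu> u p = weighted_moment a \<nu> \<mu> v p"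
    if "AE p in half_plane_measure a. u p = v p"
    using that by eventually_elim (simp add: weighted_moment_def weighted_def)
next
  fix c u assume u: "u \<in> V0_space a \<nu> \<mu>"
  show "AE p in half_plane_measure a. weighted_moment a \<nu> \<mu> (\<lambda>p. c * u p) p = c * weighted_moment a \<nu> \<mu> u p"
    unfolding V_space_parts_scale(4)[OF V0_space_V_space[OF u]] by simp
  show "square_integrable (half_plane_measure a) (weighted_moment a \<nu> \<mu> u)"
    by (rule V0_space_Hardy(1)[OF u assms])
  show "L2_seminorm (half_plane_measure a) (weighted_moment a \<nu> \<mu> u) \<le> 1 / \<mu> * V_norm a \<nu> \<mu> u"
    using order_trans[OF V0_space_Hardy(2)[OF u assms] parts_le_V_norm(3)] \<open>\<mu> > 0\<close>
    by (simp add: pos_le_divide_eq mult.commute)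
qed (use assms in simp)

definition bounded_multiplier :: "real \<Rightarrow> (real \<times> real \<Rightarrow> real) \<Rightarrow> bool" where
  "bounded_multiplier a b \<longleftrightarrow>
     b \<in> borel_measurable (half_plane_measure a) \<and> (\<exists>C\<ge>0. \<forall>p\<in>half_plane a. \<bar>b p\<bar> \<le> C)"

lemma bounded_multiplier_const: "bounded_multiplier a (\<lambda>p. k)"
  unfolding bounded_multiplier_def by (intro conjI exI[of _ "\<bar>k\<bar>"]) simp_all

lemma bounded_multiplier_sgn_fst: "bounded_multiplier a (\<lambda>p. sgn (fst p))"
  unfolding bounded_multiplier_def
proof (intro conjI exI[of _ 1])
  show "(\<lambda>p. sgn (fst p)) \<in> borel_measurable (half_plane_measure a)"
    by (rule measurable_restrict_space1, rule measurable_completion)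
       (simp add: borel_measurable_sgn_fst)
qed (simp_all add: sgn_if)

text \<open>All lower-order coefficients become bounded after division by a power of \<open>y\<close> because the half plane
  keeps the distance \<open>a\<close> from the axis \<open>y = 0\<close>.\<close>
lemma bounded_multiplier_inverse_snd:
  assumes "a > 0"
  shows "bounded_multiplier a (\<lambda>p. inverse (snd p))"
  unfolding bounded_multiplier_def
proof (intro conjI exI[of _ "inverse a"])
  have "(\<lambda>p::real \<times> real. snd p) \<in> borel_measurable (half_plane_measure a)"
    by (intro continuous_imp_measurable_half_plane continuous_intros)
  then show "(\<lambda>p. inverse (snd p)) \<in> borel_measurable (half_plane_measure a)"
    by (rule borel_measurable_inverse)
qed (use assms in \<open>auto simp: half_plane_def le_imp_inverse_le\<close>)

lemma bounded_multiplier_add: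
  assumes "bounded_multiplier a b" "bounded_multiplier a c"
  shows "bounded_multiplier a (\<lambda>p. b p + c p)"
proof -
  from assms obtain B C where "B \<ge> 0" "\<forall>p\<in>half_plane a. \<bar>b p\<bar> \<le> B" "C \<ge> 0" "\<forall>p\<in>half_plane a. \<bar>c p\<bar> \<le> C"
    unfolding bounded_multiplier_def by blast
  then have "B + C \<ge> 0" "\<forall>p\<in>half_plane a. \<bar>b p + c p\<bar> \<le> B + C"
    by (simp, intro ballI order_trans[OF abs_triangle_ineq] add_mono) simp_all
  then show ?thesis using assms unfolding bounded_multiplier_def by (blast intro: borel_measurable_add)
qed

lemma bounded_multiplier_mult:
  assumes "bounded_multiplier a b" "bounded_multiplier a c"
  shows "bounded_multiplier a (\<lambda>p. b p * c p)"
proof -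
  from assms obtain B C where "B \<ge> 0" "\<forall>p\<in>half_plane a. \<bar>b p\<bar> \<le> B" "C \<ge> 0" "\<forall>p\<in>half_plane a. \<bar>c p\<bar> \<le> C"
    unfolding bounded_multiplier_def by blast
  then have "B * C \<ge> 0" "\<forall>p\<in>half_plane a. \<bar>b p * c p\<bar> \<le> B * C"
    by (simp_all add: abs_mult mult_mono)
  then show ?thesis using assms unfolding bounded_multiplier_def by (blast intro: borel_measurable_times)
qed

definition pairing where
  "pairing a b S T u v = (\<integral>p. of_real (b p) * S u p * cnj (T v p) \<partial>half_plane_measure a)"
  for b :: "real \<times> real \<Rightarrow> real" and S T :: "(real \<times> real \<Rightarrow> complex) \<Rightarrow> real \<times> real \<Rightarrow> complex"

lemma multiplier_square_integrable:
  assumes b: "bounded_multiplier a b"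
  obtains C where "C \<ge> 0"
    "\<And>f. square_integrable (half_plane_measure a) f \<Longrightarrow> square_integrable (half_plane_measure a) (\<lambda>p. of_real (b p) * f p)"
    "\<And>f. square_integrable (half_plane_measure a) f \<Longrightarrow>
        L2_seminorm (half_plane_measure a) (\<lambda>p. of_real (b p) * f p) \<le> C * L2_seminorm (half_plane_measure a) f"
proof -
  from b obtain C where C: "C \<ge> 0" "\<forall>p\<in>half_plane a. \<bar>b p\<bar> \<le> C"
    and bm: "b \<in> borel_measurable (half_plane_measure a)"
    unfolding bounded_multiplier_def by blast
  have m: "(\<lambda>p. of_real (b p) * f p) \<in> borel_measurable (half_plane_measure a)"
    if "square_integrable (half_plane_measure a) f" for f :: "real \<times> real \<Rightarrow> complex"
    using that bm unfolding square_integrable_def by (intro borel_measurable_times borel_measurable_of_real) simp_all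
  have le: "AE p in half_plane_measure a. cmod (of_real (b p) * f p) \<le> C * cmod (f p)" for f
    using C(2) by (intro AE_I2) (simp add: norm_mult mult_right_mono)
  show thesis
    by (rule that[OF C(1)])
       (rule square_integrable_bound[OF _ m le] L2_seminorm_bound[OF _ m C(1) le]; assumption)+
qed

lemma square_integrable_cnj: "square_integrable M f \<Longrightarrow> square_integrable M (\<lambda>x. cnj (f x))"
  by (simp add: square_integrable_def
      borel_measurable_continuous_on[OF continuous_on_cnj[OF continuous_on_id]])

lemma pairing_integrable:
  assumes b: "bounded_multiplier a b"
    and "square_integrable (half_plane_measure a) f" "square_integrable (half_plane_measure a) g"
  shows "integrable (half_plane_measure a) (\<lambda>p. of_real (b p) * f p * cnj (g p))"
proof -
  obtain C where "\<And>f. square_integrable (half_plane_measure a) f \<Longrightarrow> square_integrable (half_plane_measure a) (\<lambda>p. of_real (b p) * f p)"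
    by (rule multiplier_square_integrable[OF b]) (rule that)
  then show ?thesis
    using assms(2,3) by (intro integrable_mult_square_integrable square_integrable_cnj)
qed

lemma pairing_cong_AE:
  assumes b: "bounded_multiplier a b"
    and f: "square_integrable (half_plane_measure a) f" and g: "square_integrable (half_plane_measure a) g"
    and AE: "AE p in half_plane_measure a. f p = f' p" "AE p in half_plane_measure a. g p = g' p"
  shows "(\<integral>p. of_real (b p) * f p * cnj (g p) \<partial>half_plane_measure a)
    = (\<integral>p. of_real (b p) * f' p * cnj (g' p) \<partial>half_plane_measure a)"
proof (rule integral_cong_AE)
  show "(\<lambda>p. of_real (b p) * f p * cnj (g p)) \<in> borel_measurable (half_plane_measure a)"
    by (rule borel_measurable_integrable[OF pairing_integrable[OF b f g]])
  show "(\<lambda>p. of_real (b p) * f' p * cnj (g' p)) \<in> borel_measurable (half_plane_measure a)"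
    by (rule borel_measurable_integrable[OF pairing_integrable[OF b]])
       (rule square_integrable_half_plane_cong_AE(1)[OF f AE(1)] square_integrable_half_plane_cong_AE(1)[OF g AE(2)])+
  show "AE p in half_plane_measure a. of_real (b p) * f p * cnj (g p) = of_real (b p) * f' p * cnj (g' p)"
    using AE by eventually_elim simp
qed

definition bounded_sesquilinear_form where
  "bounded_sesquilinear_form a \<nu> \<mu> B \<longleftrightarrow>
     sesquilinear_form_on a (V0_space a \<nu> \<mu>) B \<and>
     (\<exists>M\<ge>0. \<forall>u\<in>V0_space a \<nu> \<mu>. \<forall>v\<in>V0_space a \<nu> \<mu>. cmod (B u v) \<le> M * V_norm a \<nu> \<mu> u * V_norm a \<nu> \<mu> v)"

lemma bounded_sesquilinear_form_pairing:
  assumes b: "bounded_multiplier a b" and S: "V0_operator a \<nu> \<mu> S" and T: "V0_operator a \<nu> \<mu> T"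
  shows "bounded_sesquilinear_form a \<nu> \<mu> (pairing a b S T)"
  unfolding bounded_sesquilinear_form_def sesquilinear_form_on_def
proof (intro conjI ballI allI impI)
  let ?M = "half_plane_measure a" and ?V0 = "V0_space a \<nu> \<mu>"
  note SD = V0_operatorD[OF S] and TD = V0_operatorD[OF T]
  note int = pairing_integrable[OF b SD(1) TD(1)]
  {
    fix u u' v assume "u \<in> ?V0" "u' \<in> ?V0" "v \<in> ?V0"
    then have "pairing a b S T (\<lambda>p. u p + u' p) v
        = (\<integral>p. of_real (b p) * (S u p + S u' p) * cnj (T v p) \<partial>?M)"
      unfolding pairing_def by (intro pairing_cong_AE[OF b] SD TD V0_space_add AE_I2 refl)
    also have "\<dots> = (\<integral>p. of_real (b p) * S u p * cnj (T v p) + of_real (b p) * S u' p * cnj (T v p) \<partial>?M)"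
      by (simp add: algebra_simps)
    also have "\<dots> = pairing a b S T u v + pairing a b S T u' v"
      unfolding pairing_def using \<open>u \<in> ?V0\<close> \<open>u' \<in> ?V0\<close> \<open>v \<in> ?V0\<close>
      by (intro Bochner_Integration.integral_add int)
    finally show "pairing a b S T (\<lambda>p. u p + u' p) v = pairing a b S T u v + pairing a b S T u' v" .
  next
    fix c u v assume "u \<in> ?V0" "v \<in> ?V0"
    then have "pairing a b S T (\<lambda>p. c * u p) v
        = (\<integral>p. of_real (b p) * (c * S u p) * cnj (T v p) \<partial>?M)"
      unfolding pairing_def by (intro pairing_cong_AE[OF b] SD TD V0_space_scale AE_I2 refl)
    also have "\<dots> = (\<integral>p. c * (of_real (b p) * S u p * cnj (T v p)) \<partial>?M)"
      by (simp add: mult.left_commute mult.assoc)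
    also have "\<dots> = c * pairing a b S T u v"
      unfolding pairing_def by (rule integral_mult_right_zero)
    finally show "pairing a b S T (\<lambda>p. c * u p) v = c * pairing a b S T u v" .
  next
    fix u v v' assume "u \<in> ?V0" "v \<in> ?V0" "v' \<in> ?V0"
    then have "pairing a b S T u (\<lambda>p. v p + v' p)
        = (\<integral>p. of_real (b p) * S u p * cnj (T v p + T v' p) \<partial>?M)"
      unfolding pairing_def by (intro pairing_cong_AE[OF b] SD TD V0_space_add AE_I2 refl)
    also have "\<dots> = (\<integral>p. of_real (b p) * S u p * cnj (T v p) + of_real (b p) * S u p * cnj (T v' p) \<partial>?M)"
      by (simp add: algebra_simps)
    also have "\<dots> = pairing a b S T u v + pairing a b S T u v'"
      unfolding pairing_def using \<open>u \<in> ?V0\<close> \<open>v \<in> ?V0\<close> \<open>v' \<in> ?V0\<close>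
      by (intro Bochner_Integration.integral_add int)
    finally show "pairing a b S T u (\<lambda>p. v p + v' p) = pairing a b S T u v + pairing a b S T u v'" .
  next
    fix c u v assume "u \<in> ?V0" "v \<in> ?V0"
    then have "pairing a b S T u (\<lambda>p. c * v p)
        = (\<integral>p. of_real (b p) * S u p * cnj (c * T v p) \<partial>?M)"
      unfolding pairing_def by (intro pairing_cong_AE[OF b] SD TD V0_space_scale AE_I2 refl)
    also have "\<dots> = (\<integral>p. cnj c * (of_real (b p) * S u p * cnj (T v p)) \<partial>?M)"
      by (simp add: mult.left_commute mult.assoc)
    also have "\<dots> = cnj c * pairing a b S T u v"
      unfolding pairing_def by (rule integral_mult_right_zero)
    finally show "pairing a b S T u (\<lambda>p. c * v p) = cnj c * pairing a b S T u v" .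
  next
    fix u u' v v' assume "u \<in> ?V0" "u' \<in> ?V0" "v \<in> ?V0" "v' \<in> ?V0"
      and "(AE p in ?M. u p = u' p) \<and> (AE p in ?M. v p = v' p)"
    then show "pairing a b S T u v = pairing a b S T u' v'"
      unfolding pairing_def by (intro pairing_cong_AE[OF b] SD TD) simp_all
  }
  obtain C where C: "C \<ge> 0"
    "\<And>f. square_integrable ?M f \<Longrightarrow> square_integrable ?M (\<lambda>p. of_real (b p) * f p)"
    "\<And>f. square_integrable ?M f \<Longrightarrow> L2_seminorm ?M (\<lambda>p. of_real (b p) * f p) \<le> C * L2_seminorm ?M f"
    by (rule multiplier_square_integrable[OF b]) (rule that)
  obtain CS where CS: "CS \<ge> 0" "\<And>u. u \<in> ?V0 \<Longrightarrow> L2_seminorm ?M (S u) \<le> CS * V_norm a \<nu> \<mu> u"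
    by (rule V0_operator_bound[OF S]) (rule that)
  obtain CT where CT: "CT \<ge> 0" "\<And>u. u \<in> ?V0 \<Longrightarrow> L2_seminorm ?M (T u) \<le> CT * V_norm a \<nu> \<mu> u"
    by (rule V0_operator_bound[OF T]) (rule that)
  show "\<exists>K\<ge>0. \<forall>u\<in>?V0. \<forall>v\<in>?V0. cmod (pairing a b S T u v) \<le> K * V_norm a \<nu> \<mu> u * V_norm a \<nu> \<mu> v"
  proof (intro exI[of _ "C * CS * CT"] conjI ballI)
    show "C * CS * CT \<ge> 0" using C(1) CS(1) CT(1) by simp
    fix u v assume u: "u \<in> ?V0" and v: "v \<in> ?V0"
    have "cmod (pairing a b S T u v) \<le> L2_seminorm ?M (\<lambda>p. of_real (b p) * S u p) * L2_seminorm ?M (\<lambda>p. cnj (T v p))"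
      unfolding pairing_def by (intro L2_Cauchy_Schwarz C(2) square_integrable_cnj SD(1) TD(1) u v)
    also have "L2_seminorm ?M (\<lambda>p. cnj (T v p)) = L2_seminorm ?M (T v)"
      by (simp add: L2_seminorm_def)
    also have "L2_seminorm ?M (\<lambda>p. of_real (b p) * S u p) * L2_seminorm ?M (T v)
        \<le> (C * (CS * V_norm a \<nu> \<mu> u)) * (CT * V_norm a \<nu> \<mu> v)"
    proof (rule mult_mono)
      show "L2_seminorm ?M (\<lambda>p. of_real (b p) * S u p) \<le> C * (CS * V_norm a \<nu> \<mu> u)"
        using C(3)[OF SD(1)[OF u]] mult_left_mono[OF CS(2)[OF u] C(1)] by linarith
      show "L2_seminorm ?M (T v) \<le> CT * V_norm a \<nu> \<mu> v" by (rule CT(2)[OF v])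
    qed (use C(1) CS(1) in simp_all)
    finally show "cmod (pairing a b S T u v) \<le> C * CS * CT * V_norm a \<nu> \<mu> u * V_norm a \<nu> \<mu> v"
      by (simp add: algebra_simps)
  qed
qed

lemma bounded_sesquilinear_form_add:
  assumes B: "bounded_sesquilinear_form a \<nu> \<mu> B" and C: "bounded_sesquilinear_form a \<nu> \<mu> C"
  shows "bounded_sesquilinear_form a \<nu> \<mu> (\<lambda>u v. B u v + C u v)"
proof -
  let ?V0 = "V0_space a \<nu> \<mu>"
  have "sesquilinear_form_on a ?V0 B" "sesquilinear_form_on a ?V0 C"
    using B C by (simp_all add: bounded_sesquilinear_form_def)
  note sesq = this[unfolded sesquilinear_form_on_def]
  have "sesquilinear_form_on a ?V0 (\<lambda>u v. B u v + C u v)"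
    unfolding sesquilinear_form_on_def
  proof (intro conjI ballI allI impI)
    fix u u' v assume "u \<in> ?V0" "u' \<in> ?V0" "v \<in> ?V0"
    then show "B (\<lambda>p. u p + u' p) v + C (\<lambda>p. u p + u' p) v = B u v + C u v + (B u' v + C u' v)"
      using sesq[THEN conjunct1] by simp
  next
    fix c u v assume "u \<in> ?V0" "v \<in> ?V0"
    then show "B (\<lambda>p. c * u p) v + C (\<lambda>p. c * u p) v = c * (B u v + C u v)"
      using sesq[THEN conjunct2, THEN conjunct1] by (simp add: distrib_left)
  next
    fix u v v' assume "u \<in> ?V0" "v \<in> ?V0" "v' \<in> ?V0"
    then show "B u (\<lambda>p. v p + v' p) + C u (\<lambda>p. v p + v' p) = B u v + C u v + (B u v' + C u v')"
      using sesq[THEN conjunct2, THEN conjunct2, THEN conjunct1] by simp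
  next
    fix c u v assume "u \<in> ?V0" "v \<in> ?V0"
    then show "B u (\<lambda>p. c * v p) + C u (\<lambda>p. c * v p) = cnj c * (B u v + C u v)"
      using sesq[THEN conjunct2, THEN conjunct2, THEN conjunct2, THEN conjunct1] by (simp add: distrib_left)
  next
    fix u u' v v' assume "u \<in> ?V0" "u' \<in> ?V0" "v \<in> ?V0" "v' \<in> ?V0"
      and "(AE p in half_plane_measure a. u p = u' p) \<and> (AE p in half_plane_measure a. v p = v' p)"
    then have "B u v = B u' v'" "C u v = C u' v'"
      using sesq[THEN conjunct2, THEN conjunct2, THEN conjunct2, THEN conjunct2] by blast+
    then show "B u v + C u v = B u' v' + C u' v'" by (rule arg_cong2)
  qed
  moreover obtain M where M: "M \<ge> 0" "\<And>u v. u \<in> ?V0 \<Longrightarrow> v \<in> ?V0 \<Longrightarrow> cmod (B u v) \<le> M * V_norm a \<nu> \<mu> u * V_norm a \<nu> \<mu> v"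
    using B unfolding bounded_sesquilinear_form_def by blast
  moreover obtain N where N: "N \<ge> 0" "\<And>u v. u \<in> ?V0 \<Longrightarrow> v \<in> ?V0 \<Longrightarrow> cmod (C u v) \<le> N * V_norm a \<nu> \<mu> u * V_norm a \<nu> \<mu> v"
    using C unfolding bounded_sesquilinear_form_def by blast
  have "cmod (B u v + C u v) \<le> (M + N) * V_norm a \<nu> \<mu> u * V_norm a \<nu> \<mu> v" if "u \<in> ?V0" "v \<in> ?V0" for u v
    using norm_triangle_ineq[of "B u v" "C u v"] M(2)[OF that] N(2)[OF that] by (simp add: distrib_right)
  ultimately show ?thesis
    using N(1) unfolding bounded_sesquilinear_form_def by (intro conjI exI[of _ "M + N"]) simp_all
qed

text \<open>Split \<open>B(u\<^sub>n, v\<^sub>n) - B(u, v) = B(u\<^sub>n - u, v\<^sub>n) + B(u, v\<^sub>n - v)\<close>; the norms of the \<open>v\<^sub>n\<close> stay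
  bounded because they converge.\<close>
lemma bounded_sesquilinear_form_continuous:
  assumes B: "bounded_sesquilinear_form a \<nu> \<mu> B"
  shows "continuous_form_on_V0 a \<nu> \<mu> B"
  unfolding continuous_form_on_V0_def
proof (intro allI ballI impI, elim conjE)
  let ?V0 = "V0_space a \<nu> \<mu>" and ?N = "V_norm a \<nu> \<mu>"
  fix us vs :: "nat \<Rightarrow> real \<times> real \<Rightarrow> complex" and u v
  assume u: "u \<in> ?V0" and v: "v \<in> ?V0" and "range us \<subseteq> ?V0" "range vs \<subseteq> ?V0"
    and lu: "(\<lambda>n. ?N (\<lambda>p. us n p - u p)) \<longlonglongrightarrow> 0" and lv: "(\<lambda>n. ?N (\<lambda>p. vs n p - v p)) \<longlonglongrightarrow> 0"
  then have us: "us n \<in> ?V0" and vs: "vs n \<in> ?V0" for n by blast+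
  note du = V0_space_diff[OF us u] and dv = V0_space_diff[OF vs v]
  obtain M where M: "M \<ge> 0" "\<And>u v. u \<in> ?V0 \<Longrightarrow> v \<in> ?V0 \<Longrightarrow> cmod (B u v) \<le> M * ?N u * ?N v"
    using B unfolding bounded_sesquilinear_form_def by blast
  have addl: "B (\<lambda>p. f p + g p) w = B f w + B g w" and addr: "B w (\<lambda>p. f p + g p) = B w f + B w g"
    if "f \<in> ?V0" "g \<in> ?V0" "w \<in> ?V0" for f g w
    using that B[unfolded bounded_sesquilinear_form_def sesquilinear_form_on_def,
        THEN conjunct1, THEN conjunct1]
      B[unfolded bounded_sesquilinear_form_def sesquilinear_form_on_def,
        THEN conjunct1, THEN conjunct2, THEN conjunct2, THEN conjunct1] by simp_all
  have bound: "norm (B (us n) (vs n) - B u v)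
      \<le> M * ?N (\<lambda>p. us n p - u p) * (?N (\<lambda>p. vs n p - v p) + ?N v) + M * ?N u * ?N (\<lambda>p. vs n p - v p)" for n
  proof -
    have "B (us n) (vs n) = B (\<lambda>p. us n p - u p) (vs n) + B u (vs n)"
      using addl[OF du[of n] u vs[of n]] by simp
    moreover have "B u (vs n) = B u (\<lambda>p. vs n p - v p) + B u v"
      using addr[OF dv[of n] v u] by simp
    ultimately have "B (us n) (vs n) - B u v = B (\<lambda>p. us n p - u p) (vs n) + B u (\<lambda>p. vs n p - v p)" by simp
    then have "norm (B (us n) (vs n) - B u v)
        \<le> cmod (B (\<lambda>p. us n p - u p) (vs n)) + cmod (B u (\<lambda>p. vs n p - v p))"
      by (simp add: norm_triangle_ineq)
    also have "\<dots> \<le> M * ?N (\<lambda>p. us n p - u p) * ?N (vs n) + M * ?N u * ?N (\<lambda>p. vs n p - v p)"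
      by (intro add_mono M(2) du dv u vs)
    also have "?N (vs n) \<le> ?N (\<lambda>p. vs n p - v p) + ?N v"
      using V_space_add(2)[OF V0_space_V_space[OF dv[of n]] V0_space_V_space[OF v]] by simp
    then have "M * ?N (\<lambda>p. us n p - u p) * ?N (vs n)
        \<le> M * ?N (\<lambda>p. us n p - u p) * (?N (\<lambda>p. vs n p - v p) + ?N v)"
      by (intro mult_left_mono) (use M(1) in simp_all)
    finally show ?thesis by simp
  qed
  have "(\<lambda>n. M * ?N (\<lambda>p. us n p - u p) * (?N (\<lambda>p. vs n p - v p) + ?N v) + M * ?N u * ?N (\<lambda>p. vs n p - v p))
      \<longlonglongrightarrow> M * 0 * (0 + ?N v) + M * ?N u * 0"
    by (intro tendsto_intros lu lv)
  then have "(\<lambda>n. M * ?N (\<lambda>p. us n p - u p) * (?N (\<lambda>p. vs n p - v p) + ?N v) + M * ?N u * ?N (\<lambda>p. vs n p - v p))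
      \<longlonglongrightarrow> 0" by simp
  then have "(\<lambda>n. B (us n) (vs n) - B u v) \<longlonglongrightarrow> 0"
    by (rule Lim_null_comparison[OF always_eventually[OF allI[OF bound]]])
  then show "(\<lambda>n. B (us n) (vs n)) \<longlonglongrightarrow> B u v"
    by (rule LIM_zero_cancel)
qed

section \<open>The extension of the Heston form\<close>

lemma weighted_mult_cnj:
  "weighted \<nu> \<mu> c f p * cnj (weighted \<nu> \<mu> d g p)
    = of_real (c (snd p) * d (snd p)) * of_real ((weight \<nu> \<mu> p)\<^sup>2) * (f p * cnj (g p))"
  by (simp add: weighted_def power2_eq_square)

lemma pairing_test_function:
  assumes b: "bounded_multiplier a b"
    and f: "square_integrable (half_plane_measure a) f" "AE p in half_plane_measure a. f p = S u p"
    and g: "square_integrable (half_plane_measure a) g" "AE p in half_plane_measure a. g p = T v p"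
  shows "has_bochner_integral (half_plane_measure a) (\<lambda>p. of_real (b p) * (f p * cnj (g p))) (pairing a b S T u v)"
  using pairing_integrable[OF b f(1) g(1)] pairing_cong_AE[OF b f(1) g(1) f(2) g(2)]
  by (simp add: has_bochner_integral_iff pairing_def mult.assoc)

text \<open>The coefficients \<open>p/y\<^sup>2\<close>, \<open>q/y\<^sup>2\<close> and \<open>s/y\<^sup>3\<close> of the lower-order terms left after integration by parts,
  expanded in powers of \<open>1/y\<close> so that their boundedness can be read off.\<close>
definition coeff_XZ :: "real \<Rightarrow> real \<Rightarrow> real \<Rightarrow> real \<Rightarrow> real \<Rightarrow> real \<Rightarrow> real \<times> real \<Rightarrow> real" where
  "coeff_XZ \<sigma> r \<rho> \<omega> \<nu> \<mu> p = \<nu> * (sgn (fst p) * inverse (snd p))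
     + ((\<rho> * \<sigma> - r) * (inverse (snd p) * inverse (snd p))
     + (1/2 * inverse (snd p) + \<rho> * \<sigma> * (2 * \<mu> - \<omega>)))"

definition coeff_YZ :: "real \<Rightarrow> real \<Rightarrow> real \<Rightarrow> real \<Rightarrow> real \<Rightarrow> real \<times> real \<Rightarrow> real" where
  "coeff_YZ \<kappa> m \<sigma> \<omega> \<mu> p = (1/2 * \<sigma>\<^sup>2 - \<kappa> * m) * (inverse (snd p) * inverse (snd p))
     + (\<kappa> * inverse (snd p) + \<sigma>\<^sup>2 * (\<mu> - \<omega>))"

definition coeff_ZZ :: "real \<Rightarrow> real \<Rightarrow> real \<Rightarrow> real \<Rightarrow> real \<Rightarrow> real \<times> real \<Rightarrow> real" where
  "coeff_ZZ \<kappa> m \<sigma> r \<omega> p = r * (inverse (snd p) * (inverse (snd p) * inverse (snd p)))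
     + ((- (1/2 * \<omega> * \<sigma>\<^sup>2) - \<omega> * \<kappa> * m) * (inverse (snd p) * inverse (snd p))
     + (\<omega> * \<kappa> * inverse (snd p) - 1/2 * \<omega>\<^sup>2 * \<sigma>\<^sup>2))"

lemma bounded_multiplier_coefficients:
  assumes "a > 0"
  shows "bounded_multiplier a (coeff_XZ \<sigma> r \<rho> \<omega> \<nu> \<mu>)"
    and "bounded_multiplier a (coeff_YZ \<kappa> m \<sigma> \<omega> \<mu>)"
    and "bounded_multiplier a (coeff_ZZ \<kappa> m \<sigma> r \<omega>)"
proof -
  note intros = bounded_multiplier_add bounded_multiplier_mult bounded_multiplier_const
    bounded_multiplier_sgn_fst bounded_multiplier_inverse_snd[OF assms]
  show "bounded_multiplier a (coeff_XZ \<sigma> r \<rho> \<omega> \<nu> \<mu>)"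
    unfolding coeff_XZ_def by (intro intros)
  show "bounded_multiplier a (coeff_YZ \<kappa> m \<sigma> \<omega> \<mu>)"
    unfolding coeff_YZ_def by (intro intros)
  show "bounded_multiplier a (coeff_ZZ \<kappa> m \<sigma> r \<omega>)"
    unfolding coeff_ZZ_def diff_conv_add_uminus by (intro intros)
qed

definition heston_extension where
  "heston_extension a \<kappa> m \<sigma> r \<rho> \<omega> \<nu> \<mu> u v =
     pairing a (\<lambda>_. 1/2) (weighted_x_slope a \<nu> \<mu>) (weighted_x_slope a \<nu> \<mu>) u v
   + (pairing a (\<lambda>_. 1/2 * \<sigma>\<^sup>2) (weighted_y_slope a \<nu> \<mu>) (weighted_y_slope a \<nu> \<mu>) u v
   + (pairing a (\<lambda>_. \<rho> * \<sigma>) (weighted_x_slope a \<nu> \<mu>) (weighted_y_slope a \<nu> \<mu>) u v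
   + (pairing a (coeff_XZ \<sigma> r \<rho> \<omega> \<nu> \<mu>) (weighted_x_slope a \<nu> \<mu>) (weighted_moment a \<nu> \<mu>) u v
   + (pairing a (coeff_YZ \<kappa> m \<sigma> \<omega> \<mu>) (weighted_y_slope a \<nu> \<mu>) (weighted_moment a \<nu> \<mu>) u v
   + pairing a (coeff_ZZ \<kappa> m \<sigma> r \<omega>) (weighted_moment a \<nu> \<mu>) (weighted_moment a \<nu> \<mu>) u v))))"

lemma bounded_sesquilinear_form_heston:
  assumes "a > 0" "\<mu> > 0"
  shows "bounded_sesquilinear_form a \<nu> \<mu> (heston_extension a \<kappa> m \<sigma> r \<rho> \<omega> \<nu> \<mu>)"
  unfolding heston_extension_def
  by (intro bounded_sesquilinear_form_add bounded_sesquilinear_form_pairing bounded_multiplier_const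
      bounded_multiplier_coefficients V0_operator_X V0_operator_Y V0_operator_Z assms)

text \<open>The pointwise identity behind the integration by parts. Here \<open>A, B, U\<close> stand for \<open>u\<^sub>x, u\<^sub>y, u\<close>, then
  \<open>Ax, Ay, By\<close> for \<open>u\<^sub>x\<^sub>x, u\<^sub>x\<^sub>y, u\<^sub>y\<^sub>y\<close>, and \<open>V, Vx, Vy\<close> for the conjugates of \<open>v, v\<^sub>x, v\<^sub>y\<close>; \<open>N\<close> is
  \<open>\<nu> sgn(x)\<close> and \<open>W\<close> the squared weight. The subtracted terms at the end are the \<open>x\<close>-derivative of
  \<open>y u\<^sub>x V W\<close> and the \<open>y\<close>-derivatives of \<open>y u\<^sub>y V W\<close> and \<open>y u\<^sub>x V W\<close>, whose integrals vanish.\<close>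
lemma heston_integrand_identity:
  fixes A B Ax By Ay U V Vx Vy W Y :: complex and \<kappa> m \<sigma> r \<rho> \<omega> \<mu> N :: complex
  shows "(- (1/2 * Y) * Ax - (1/2 * \<sigma>\<^sup>2 * Y) * By - (\<rho> * \<sigma> * Y) * Ay
      - (\<omega> * \<rho> * \<sigma> * Y\<^sup>2 - 1/2 * Y + r) * A
      - (\<omega> * \<sigma>\<^sup>2 * Y\<^sup>2 + \<kappa> * (m - Y)) * B
      - (1/2 * \<omega> * \<sigma>\<^sup>2 * Y * (\<omega> * Y\<^sup>2 + 1) + \<omega> * Y * \<kappa> * (m - Y) - r) * U) * V * W =
    1/2 * (Y * W * (A * Vx)) + (1/2 * \<sigma>\<^sup>2 * (Y * W * (B * Vy)) + (\<rho> * \<sigma> * (Y * W * (A * Vy))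
    + ((N * Y + (\<rho> * \<sigma> - r) + (1/2 * Y + \<rho> * \<sigma> * (2 * \<mu> - \<omega>) * Y\<^sup>2)) * W * (A * V)
    + (((1/2 * \<sigma>\<^sup>2 - \<kappa> * m) + (\<kappa> * Y + \<sigma>\<^sup>2 * (\<mu> - \<omega>) * Y\<^sup>2)) * W * (B * V)
    + (r + ((- (1/2 * \<omega> * \<sigma>\<^sup>2) - \<omega> * \<kappa> * m) * Y + (\<omega> * \<kappa> * Y\<^sup>2 - 1/2 * \<omega>\<^sup>2 * \<sigma>\<^sup>2 * Y ^ 3))) * W * (U * V)))))
    - (1/2 * ((A * Vx + Ax * V + 2 * N * (A * V)) * (Y * W))
    + (1/2 * \<sigma>\<^sup>2 * (((B * Vy + By * V) * Y + B * V * (1 + 2 * \<mu> * Y\<^sup>2)) * W)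
    + \<rho> * \<sigma> * (((A * Vy + Ay * V) * Y + A * V * (1 + 2 * \<mu> * Y\<^sup>2)) * W)))"
  by (simp add: field_simps power2_eq_square power3_eq_cube)

text \<open>In the proof \<open>F\<close> is the integrand of the extension and \<open>D\<close> collects the derivative terms of
  \<open>heston_integrand_identity\<close>; the integrand of the form is \<open>F - D\<close>, and \<open>D\<close> integrates to zero.\<close>
lemma heston_form_test_functions:
  assumes "a > 0" and u: "u \<in> test_functions a" and v: "v \<in> test_functions a"
  shows "heston_extension a \<kappa> m \<sigma> r \<rho> \<omega> \<nu> \<mu> u v = heston_form a \<kappa> m \<sigma> r \<rho> \<omega> \<nu> \<mu> u v"
proof -
  let ?M = "half_plane_measure a"
  let ?Z = "\<lambda>y. y * sqrt y"
  let ?W = "\<lambda>p. complex_of_real ((weight \<nu> \<mu> p)\<^sup>2)"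
  have cs: "continuous_on UNIV sqrt" by (intro continuous_intros)
  note cz = continuous_on_y_sqrt_y
  note sq = test_function_square_integrable[of _ a _ \<nu> \<mu>]
  note X = sq[OF test_function_Dx cs] test_function_parts(1)[of _ a \<nu> \<mu>]
  note Y = sq[OF test_function_Dy cs] test_function_parts(2)[of _ a \<nu> \<mu>]
  note Z = sq[OF _ cz, folded weighted_moment_def[of a]]
  have Z2: "AE p in ?M. weighted_moment a \<nu> \<mu> w p = weighted_moment a \<nu> \<mu> w p" for w by simp
  note bm = bounded_multiplier_const bounded_multiplier_coefficients[OF \<open>a > 0\<close>]

  define F where "F p =
      of_real (1/2) * (weighted \<nu> \<mu> sqrt (Dx u) p * cnj (weighted \<nu> \<mu> sqrt (Dx v) p))
    + (of_real (1/2 * \<sigma>\<^sup>2) * (weighted \<nu> \<mu> sqrt (Dy u) p * cnj (weighted \<nu> \<mu> sqrt (Dy v) p))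
    + (of_real (\<rho> * \<sigma>) * (weighted \<nu> \<mu> sqrt (Dx u) p * cnj (weighted \<nu> \<mu> sqrt (Dy v) p))
    + (of_real (coeff_XZ \<sigma> r \<rho> \<omega> \<nu> \<mu> p) * (weighted \<nu> \<mu> sqrt (Dx u) p * cnj (weighted_moment a \<nu> \<mu> v p))
    + (of_real (coeff_YZ \<kappa> m \<sigma> \<omega> \<mu> p) * (weighted \<nu> \<mu> sqrt (Dy u) p * cnj (weighted_moment a \<nu> \<mu> v p))
    + of_real (coeff_ZZ \<kappa> m \<sigma> r \<omega> p) * (weighted_moment a \<nu> \<mu> u p * cnj (weighted_moment a \<nu> \<mu> v p))))))" for p
  have F: "has_bochner_integral ?M F (heston_extension a \<kappa> m \<sigma> r \<rho> \<omega> \<nu> \<mu> u v)"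
    unfolding F_def heston_extension_def
    by (intro has_bochner_integral_add pairing_test_function bm X Y Z Z2 u v)

  define h1 where "h1 = (\<lambda>p. Dx u p * cnj (v p))"
  define h2 where "h2 = (\<lambda>p. Dy u p * cnj (v p))"
  have h: "h1 \<in> test_functions a" "h2 \<in> test_functions a"
    unfolding h1_def h2_def
    by (rule test_function_mult_smooth[OF test_function_cnj[OF v]], rule test_function_smooth,
        rule test_function_Dx test_function_Dy, rule u)+
  have sm: "w differentiable (at p)" if "w \<in> test_functions a" for w p
    by (rule smooth_differentiable[OF test_function_smooth[OF that]])
  have Dh: "Dx h1 p = Dx u p * cnj (Dx v p) + Dx (Dx u) p * cnj (v p)"
    "Dy h1 p = Dx u p * cnj (Dy v p) + Dy (Dx u) p * cnj (v p)"
    "Dy h2 p = Dy u p * cnj (Dy v p) + Dy (Dy u) p * cnj (v p)" for p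
    unfolding h1_def h2_def
    by (simp_all add: dir_deriv_mult dir_deriv_cnj sm u v test_function_Dx test_function_Dy test_function_cnj)
  define G1 where "G1 = (\<lambda>p. (Dx h1 p + of_real (2 * \<nu> * sgn (fst p)) * h1 p) * of_real (snd p ^ 1 * (weight \<nu> \<mu> p)\<^sup>2))"
  define G2 where "G2 = (\<lambda>p. (Dy h2 p * of_real (snd p ^ 1)
      + h2 p * of_real (real 1 * snd p ^ (1 - 1) + 2 * \<mu> * snd p ^ Suc 1)) * of_real ((weight \<nu> \<mu> p)\<^sup>2))"
  define G3 where "G3 = (\<lambda>p. (Dy h1 p * of_real (snd p ^ 1)
      + h1 p * of_real (real 1 * snd p ^ (1 - 1) + 2 * \<mu> * snd p ^ Suc 1)) * of_real ((weight \<nu> \<mu> p)\<^sup>2))"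
  have G: "has_bochner_integral ?M G1 0" "has_bochner_integral ?M G2 0" "has_bochner_integral ?M G3 0"
    unfolding G1_def G2_def G3_def has_bochner_integral_iff
    by (intro conjI integral_divergence_x integral_divergence_y h)+
  define D where "D = (\<lambda>p. of_real (1/2) * G1 p + (of_real (1/2 * \<sigma>\<^sup>2) * G2 p + of_real (\<rho> * \<sigma>) * G3 p))"
  have "has_bochner_integral ?M D (of_real (1/2) * 0 + (of_real (1/2 * \<sigma>\<^sup>2) * 0 + of_real (\<rho> * \<sigma>) * 0))"
    unfolding D_def by (intro has_bochner_integral_add has_bochner_integral_mult_right G)
  then have D: "has_bochner_integral ?M D 0" by simp

  have point: "heston_operator \<kappa> m \<sigma> r \<rho> \<omega> u p * cnj (v p) * ?W p = F p - D p" if "p \<in> space ?M" for p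
  proof -
    obtain x y where p: "p = (x, y)" by (cases p)
    have y: "y > 0" using that \<open>a > 0\<close> by (simp add: p half_plane_def)
    have "sqrt y * (y * sqrt y) = y\<^sup>2" "(y * sqrt y) * (y * sqrt y) = y ^ 3"
      using y by (simp_all add: power2_eq_square power3_eq_cube)
    then have W: "weighted \<nu> \<mu> sqrt f p * cnj (weighted \<nu> \<mu> sqrt g p) = of_real y * ?W p * (f p * cnj (g p))"
      "weighted \<nu> \<mu> sqrt f p * cnj (weighted_moment a \<nu> \<mu> g p) = of_real (y\<^sup>2) * ?W p * (f p * cnj (g p))"
      "weighted_moment a \<nu> \<mu> f p * cnj (weighted_moment a \<nu> \<mu> g p) = of_real (y ^ 3) * ?W p * (f p * cnj (g p))" for f g
      using y unfolding weighted_moment_def weighted_mult_cnj by (simp_all add: p)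
    have coef: "coeff_XZ \<sigma> r \<rho> \<omega> \<nu> \<mu> p * y\<^sup>2 = \<nu> * sgn x * y + (\<rho> * \<sigma> - r) + (1/2 * y + \<rho> * \<sigma> * (2 * \<mu> - \<omega>) * y\<^sup>2)"
      "coeff_YZ \<kappa> m \<sigma> \<omega> \<mu> p * y\<^sup>2 = (1/2 * \<sigma>\<^sup>2 - \<kappa> * m) + (\<kappa> * y + \<sigma>\<^sup>2 * (\<mu> - \<omega>) * y\<^sup>2)"
      "coeff_ZZ \<kappa> m \<sigma> r \<omega> p * y ^ 3 = r + ((- (1/2 * \<omega> * \<sigma>\<^sup>2) - \<omega> * \<kappa> * m) * y + (\<omega> * \<kappa> * y\<^sup>2 - 1/2 * \<omega>\<^sup>2 * \<sigma>\<^sup>2 * y ^ 3))"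
      using y by (simp_all add: p coeff_XZ_def coeff_YZ_def coeff_ZZ_def field_simps power2_eq_square power3_eq_cube)
    have F': "F p = 1/2 * (of_real y * ?W p * (Dx u p * cnj (Dx v p)))
      + (of_real (1/2 * \<sigma>\<^sup>2) * (of_real y * ?W p * (Dy u p * cnj (Dy v p)))
      + (of_real (\<rho> * \<sigma>) * (of_real y * ?W p * (Dx u p * cnj (Dy v p)))
      + (of_real (coeff_XZ \<sigma> r \<rho> \<omega> \<nu> \<mu> p * y\<^sup>2) * ?W p * (Dx u p * cnj (v p))
      + (of_real (coeff_YZ \<kappa> m \<sigma> \<omega> \<mu> p * y\<^sup>2) * ?W p * (Dy u p * cnj (v p))
      + of_real (coeff_ZZ \<kappa> m \<sigma> r \<omega> p * y ^ 3) * ?W p * (u p * cnj (v p))))))"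
      unfolding F_def W of_real_mult[of "coeff_XZ \<sigma> r \<rho> \<omega> \<nu> \<mu> p"] of_real_mult[of "coeff_YZ \<kappa> m \<sigma> \<omega> \<mu> p"]
        of_real_mult[of "coeff_ZZ \<kappa> m \<sigma> r \<omega> p"] by (simp add: mult.assoc)
    have D': "D p = 1/2 * ((Dx u p * cnj (Dx v p) + Dx (Dx u) p * cnj (v p)
          + 2 * of_real (\<nu> * sgn x) * (Dx u p * cnj (v p))) * (of_real y * ?W p))
      + (of_real (1/2 * \<sigma>\<^sup>2) * (((Dy u p * cnj (Dy v p) + Dy (Dy u) p * cnj (v p)) * of_real y
          + Dy u p * cnj (v p) * (1 + 2 * of_real \<mu> * (of_real y)\<^sup>2)) * ?W p)
      + of_real (\<rho> * \<sigma>) * (((Dx u p * cnj (Dy v p) + Dy (Dx u) p * cnj (v p)) * of_real y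
          + Dx u p * cnj (v p) * (1 + 2 * of_real \<mu> * (of_real y)\<^sup>2)) * ?W p))"
      unfolding D_def G1_def G2_def G3_def Dh unfolding h1_def h2_def
      by (simp add: p power2_eq_square)
    have H: "heston_operator \<kappa> m \<sigma> r \<rho> \<omega> u p =
        - (1/2 * of_real y) * Dx (Dx u) p - (1/2 * (of_real \<sigma>)\<^sup>2 * of_real y) * Dy (Dy u) p
        - (of_real \<rho> * of_real \<sigma> * of_real y) * Dy (Dx u) p
        - (of_real \<omega> * of_real \<rho> * of_real \<sigma> * (of_real y)\<^sup>2 - 1/2 * of_real y + of_real r) * Dx u p
        - (of_real \<omega> * (of_real \<sigma>)\<^sup>2 * (of_real y)\<^sup>2 + of_real \<kappa> * (of_real m - of_real y)) * Dy u p
        - (1/2 * of_real \<omega> * (of_real \<sigma>)\<^sup>2 * of_real y * (of_real \<omega> * (of_real y)\<^sup>2 + 1)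
            + of_real \<omega> * of_real y * of_real \<kappa> * (of_real m - of_real y) - of_real r) * u p"
      by (simp add: heston_operator_def p)
    show ?thesis
      unfolding H F' D' coef
      using heston_integrand_identity[of "of_real y" "Dx (Dx u) p" "of_real \<sigma>" "Dy (Dy u) p" "of_real \<rho>" "Dy (Dx u) p"
          "of_real \<omega>" "of_real r" "Dx u p" "of_real \<kappa>" "of_real m" "Dy u p" "u p" "cnj (v p)" "?W p"
          "cnj (Dx v p)" "cnj (Dy v p)" "of_real (\<nu> * sgn x)" "of_real \<mu>"]
      by simp
  qed
  have "heston_form a \<kappa> m \<sigma> r \<rho> \<omega> \<nu> \<mu> u v
      = (\<integral>p. heston_operator \<kappa> m \<sigma> r \<rho> \<omega> u p * cnj (v p) * ?W p \<partial>?M)"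
    unfolding heston_form_def
    by (rule Bochner_Integration.integral_cong)
       (auto simp: weight_def power_mult_distrib)
  also have "\<dots> = (\<integral>p. F p - D p \<partial>?M)"
    by (rule Bochner_Integration.integral_cong[OF refl point])
  also have "\<dots> = heston_extension a \<kappa> m \<sigma> r \<rho> \<omega> \<nu> \<mu> u v"
    using has_bochner_integral_diff[OF F D] by (simp add: has_bochner_integral_iff)
  finally show ?thesis ..
qed

theorem lemma2p2:
  fixes a \<kappa> m \<sigma> r \<rho> \<omega> \<nu> \<mu> :: real
  assumes "a > 0" "\<kappa> > 0" "m > 0" "\<sigma> > 0" "r \<ge> 0" "\<rho> \<in> {-1..1}"
    and "\<omega> > 0" "\<nu> > 0" "\<mu> > 0"
    and Feller: "\<kappa> * m > \<sigma>\<^sup>2 / 2"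
  shows "\<exists>B. sesquilinear_form_on a (V0_space a \<nu> \<mu>) B \<and>
             continuous_form_on_V0 a \<nu> \<mu> B \<and>
             (\<forall>u \<in> test_functions a. \<forall>v \<in> test_functions a.
                B u v = heston_form a \<kappa> m \<sigma> r \<rho> \<omega> \<nu> \<mu> u v) \<and>
             (\<exists>M>0. \<forall>u \<in> V0_space a \<nu> \<mu>. \<forall>v \<in> V0_space a \<nu> \<mu>.
                cmod (B u v) \<le> M * V_norm a \<nu> \<mu> u * V_norm a \<nu> \<mu> v)"
proof (intro exI[of _ "heston_extension a \<kappa> m \<sigma> r \<rho> \<omega> \<nu> \<mu>"] conjI)
  let ?B = "heston_extension a \<kappa> m \<sigma> r \<rho> \<omega> \<nu> \<mu>"
  have B: "bounded_sesquilinear_form a \<nu> \<mu> ?B"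
    by (rule bounded_sesquilinear_form_heston[OF \<open>a > 0\<close> \<open>\<mu> > 0\<close>])
  then show "sesquilinear_form_on a (V0_space a \<nu> \<mu>) ?B"
    by (simp add: bounded_sesquilinear_form_def)
  show "continuous_form_on_V0 a \<nu> \<mu> ?B"
    by (rule bounded_sesquilinear_form_continuous[OF B])
  show "\<forall>u\<in>test_functions a. \<forall>v\<in>test_functions a. ?B u v = heston_form a \<kappa> m \<sigma> r \<rho> \<omega> \<nu> \<mu> u v"
    using heston_form_test_functions[OF \<open>a > 0\<close>] by blast
  obtain M where M: "M \<ge> 0" "\<And>u v. u \<in> V0_space a \<nu> \<mu> \<Longrightarrow> v \<in> V0_space a \<nu> \<mu> \<Longrightarrow>
      cmod (?B u v) \<le> M * V_norm a \<nu> \<mu> u * V_norm a \<nu> \<mu> v"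
    using B unfolding bounded_sesquilinear_form_def by blast
  show "\<exists>M>0. \<forall>u\<in>V0_space a \<nu> \<mu>. \<forall>v\<in>V0_space a \<nu> \<mu>.
      cmod (?B u v) \<le> M * V_norm a \<nu> \<mu> u * V_norm a \<nu> \<mu> v"
  \<comment> \<open>The constant is required to be positive, whereas \<open>M\<close> may be zero.\<close>
  proof (intro exI[of _ "M + 1"] conjI ballI)
    fix u v assume "u \<in> V0_space a \<nu> \<mu>" "v \<in> V0_space a \<nu> \<mu>"
    then have "cmod (?B u v) \<le> M * V_norm a \<nu> \<mu> u * V_norm a \<nu> \<mu> v" by (rule M(2))
    also have "\<dots> \<le> (M + 1) * V_norm a \<nu> \<mu> u * V_norm a \<nu> \<mu> v"
      by (intro mult_right_mono) simp_all
    finally show "cmod (?B u v) \<le> (M + 1) * V_norm a \<nu> \<mu> u * V_norm a \<nu> \<mu> v" .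
  qed (use M(1) in simp)
qed

end
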